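(* Let $\Omega\subset\mathbb{R}^N$, $N\ge 2$, be a region satisfying (B2), and let $\{b_j:j\ge1\}$ be a sequence of $\Delta$-orthonormal DBS eigenfunctions constructed as in the context. Then $L^2_H(\Omega)$, with the $L^2(\Omega)$ inner product, is a Reproducing Kernel Hilbert space with reproducing kernel $$R_\Omega(x,y):=\sum_{j=1}^\infty\Delta b_j(x)\,\Delta b_j(y)\qquad\text{for }(x,y)\in\Omega\times\Omega.$$
   Context: A region is a nonempty connected open subset of $\mathbb{R}^N$. All functions are real valued and derivatives are weak. (B1): $\Omega$ is bounded and $\partial\Omega$ is the union of a finite number of disjoint closed Lipschitz surfaces, each having finite surface area. $\sigma$ is $(N-1)$-dimensional Hausdorff measure on $\partial\Omega$, $\nu$ the outward unit normal, $\gamma$ the boundary trace on $H^1(\Omega)$. $H_0(\Delta,\Omega)=\{u\in H_0^1(\Omega):\Delta u\in L^2(\Omega)\}$ ($\Delta$ the weak Laplacian), a Hilbert space with inner product $[u,v]_\Delta:=a(u,v):=\int_\Omega\Delta u\,\Delta v\,dx$ and norm $\|u\|_\Delta$. "$\Delta$-orthonormal" refers to $[\cdot,\cdot]_\Delta$. For $u\in H_0(\Delta,\Omega)$, $D_\nu u\in L^2(\partial\Omega,d\sigma)$ is the normal derivative determined by $\int_{\partial\Omega}\gamma(v)D_\nu u\,d\sigma=\int_\Omega(\nabla u\cdot\nabla v+v\Delta u)\,dx$ for all $v\in H^1(\Omega)$. (B2): (B1) holds and $D_\nu$ is a compact mapping of $H_0(\Delta,\Omega)$ into $L^2(\partial\Omega,d\sigma)$.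 A DBS (Dirichlet Biharmonic Steklov) eigenvalue/eigenfunction is a pair $(q,b)\in\mathbb{R}\times H_0(\Delta,\Omega)$ with $b\ne 0$ and $\int_\Omega\Delta b\,\Delta v\,dx=q\int_{\partial\Omega}D_\nu b\,D_\nu v\,d\sigma$ for all $v\in H_0(\Delta,\Omega)$. Construction of $\{b_j\}$: put $\mathcal{M}(u):=\int_{\partial\Omega}|D_\nu u|^2\,d\sigma$. For $k=1,2,\dots$, given $b_1,\dots,b_{k-1}$, let $C_k:=\{u\in H_0(\Delta,\Omega):\|u\|_\Delta\le 1,\ a(u,b_j)=0\text{ for }1\le j\le k-1\}$, $\beta_k:=\sup_{C_k}\mathcal{M}$, and let $b_k\in C_k$ be a maximizer of $\mathcal{M}$ on $C_k$. The $b_k$ are $\Delta$-orthonormal DBS eigenfunctions with eigenvalues $q_k=1/\beta_k$. $L^2_H(\Omega)$ (the harmonic Bergman space) is the space of all $u\in L^2(\Omega)$ with $\int_\Omega u\,\Delta v\,dx=0$ for all $v\in C_c^2(\Omega)$; its elements, and the functions $\Delta b_j\in L^2_H(\Omega)$, are represented by their $C^\infty$ versions on $\Omega$. That $R_\Omega$ is the reproducing kernel means $k(x)=\int_\Omega R_\Omega(x,y)k(y)\,dy$ for all $x\in\Omega$ and $k\in L^2_H(\Omega)$, with $R_\Omega(x,\cdot)\in L^2_H(\Omega)$. *)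

theory Defs
  imports "HOL-Analysis.Analysis"
begin

section \<open>Square-integrable functions\<close>

text \<open>
  Elements of \<open>L\<^sup>2\<close> spaces are represented by functions; equality in \<open>L\<^sup>2\<close> is equality almost
  everywhere. Functions on an open set \<open>\<Omega>\<close> are total functions whose values off \<open>\<Omega>\<close> are ignored,
  since the measure is \<^term>\<open>lebesgue_on \<Omega>\<close>.
\<close>

definition L2 :: "'x measure \<Rightarrow> ('x \<Rightarrow> real) set" where
  "L2 M = {f \<in> borel_measurable M. integrable M (\<lambda>x. (f x)\<^sup>2)}"

definition L2_inner :: "'x measure \<Rightarrow> ('x \<Rightarrow> real) \<Rightarrow> ('x \<Rightarrow> real) \<Rightarrow> real" where
  "L2_inner M f g = (\<integral>x. f x * g x \<partial>M)"

definition L2_norm :: "'x measure \<Rightarrow> ('x \<Rightarrow> real) \<Rightarrow> real" where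
  "L2_norm M f = sqrt (L2_inner M f f)"


section \<open>Smooth functions and test functions\<close>

definition partial :: "'a::euclidean_space \<Rightarrow> ('a \<Rightarrow> real) \<Rightarrow> 'a \<Rightarrow> real" where
  "partial i f x = frechet_derivative f (at x) i"

definition laplacian :: "('a::euclidean_space \<Rightarrow> real) \<Rightarrow> 'a \<Rightarrow> real" where
  "laplacian f x = (\<Sum>i\<in>Basis. partial i (partial i f) x)"

text \<open>\<open>C\<^sup>k\<close> functions on an open set \<open>S\<close>.\<close>

primrec Ck_on :: "nat \<Rightarrow> 'a::euclidean_space set \<Rightarrow> ('a \<Rightarrow> real) \<Rightarrow> bool" where
  "Ck_on 0 S f \<longleftrightarrow> continuous_on S f"
| "Ck_on (Suc k) S f \<longleftrightarrow>
     (\<forall>x\<in>S. f differentiable (at x)) \<and> (\<forall>i\<in>Basis. Ck_on k S (partial i f))"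

definition Cinf_on :: "'a::euclidean_space set \<Rightarrow> ('a \<Rightarrow> real) \<Rightarrow> bool" where
  "Cinf_on S f \<longleftrightarrow> (\<forall>k. Ck_on k S f)"

text \<open>\<open>C\<^sub>c\<^sup>k(\<Omega>)\<close> and \<open>C\<^sub>c\<^sup>\<infinity>(\<Omega>)\<close>, the functions being extended by zero to the whole space.\<close>

definition Cc :: "nat \<Rightarrow> 'a::euclidean_space set \<Rightarrow> ('a \<Rightarrow> real) set" where
  "Cc k \<Omega> = {f. Ck_on k UNIV f \<and> compact (closure {x. f x \<noteq> 0}) \<and> closure {x. f x \<noteq> 0} \<subseteq> \<Omega>}"

definition Cc_inf :: "'a::euclidean_space set \<Rightarrow> ('a \<Rightarrow> real) set" where
  "Cc_inf \<Omega> = (\<Inter>k. Cc k \<Omega>)"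


section \<open>Weak derivatives and Sobolev spaces\<close>

definition has_weak_grad ::
    "'a::euclidean_space set \<Rightarrow> ('a \<Rightarrow> real) \<Rightarrow> ('a \<Rightarrow> 'a) \<Rightarrow> bool" where
  "has_weak_grad \<Omega> u G \<longleftrightarrow>
     (\<forall>i\<in>Basis. (\<lambda>x. G x \<bullet> i) \<in> L2 (lebesgue_on \<Omega>) \<and>
        (\<forall>\<phi>\<in>Cc_inf \<Omega>. (\<integral>x. u x * partial i \<phi> x \<partial>lebesgue_on \<Omega>)
                      = - (\<integral>x. (G x \<bullet> i) * \<phi> x \<partial>lebesgue_on \<Omega>)))"

definition has_weak_lap ::
    "'a::euclidean_space set \<Rightarrow> ('a \<Rightarrow> real) \<Rightarrow> ('a \<Rightarrow> real) \<Rightarrow> bool" where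
  "has_weak_lap \<Omega> u w \<longleftrightarrow> w \<in> L2 (lebesgue_on \<Omega>) \<and>
     (\<forall>\<phi>\<in>Cc_inf \<Omega>. (\<integral>x. u x * laplacian \<phi> x \<partial>lebesgue_on \<Omega>)
                   = (\<integral>x. w x * \<phi> x \<partial>lebesgue_on \<Omega>))"

text \<open>Weak derivatives are unique up to null sets, so the choices below are harmless.\<close>

definition weak_grad :: "'a::euclidean_space set \<Rightarrow> ('a \<Rightarrow> real) \<Rightarrow> 'a \<Rightarrow> 'a" where
  "weak_grad \<Omega> u = (SOME G. has_weak_grad \<Omega> u G)"

definition weak_lap :: "'a::euclidean_space set \<Rightarrow> ('a \<Rightarrow> real) \<Rightarrow> 'a \<Rightarrow> real" where
  "weak_lap \<Omega> u = (SOME w. has_weak_lap \<Omega> u w)"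

definition H1 :: "'a::euclidean_space set \<Rightarrow> ('a \<Rightarrow> real) set" where
  "H1 \<Omega> = {u \<in> L2 (lebesgue_on \<Omega>). \<exists>G. has_weak_grad \<Omega> u G}"

definition H1_norm :: "'a::euclidean_space set \<Rightarrow> ('a \<Rightarrow> real) \<Rightarrow> real" where
  "H1_norm \<Omega> u = sqrt (\<integral>x. (u x)\<^sup>2 + (norm (weak_grad \<Omega> u x))\<^sup>2 \<partial>lebesgue_on \<Omega>)"

definition H10 :: "'a::euclidean_space set \<Rightarrow> ('a \<Rightarrow> real) set" where
  "H10 \<Omega> = {u \<in> H1 \<Omega>. \<exists>\<phi>. (\<forall>n. \<phi> n \<in> Cc_inf \<Omega>) \<and>
              (\<lambda>n. H1_norm \<Omega> (\<lambda>x. u x - \<phi> n x)) \<longlonglongrightarrow> 0}"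

definition H0_Lap :: "'a::euclidean_space set \<Rightarrow> ('a \<Rightarrow> real) set" where
  "H0_Lap \<Omega> = {u \<in> H10 \<Omega>. \<exists>w. has_weak_lap \<Omega> u w}"

definition lap_inner ::
    "'a::euclidean_space set \<Rightarrow> ('a \<Rightarrow> real) \<Rightarrow> ('a \<Rightarrow> real) \<Rightarrow> real" where
  "lap_inner \<Omega> u v = L2_inner (lebesgue_on \<Omega>) (weak_lap \<Omega> u) (weak_lap \<Omega> v)"

definition lap_norm :: "'a::euclidean_space set \<Rightarrow> ('a \<Rightarrow> real) \<Rightarrow> real" where
  "lap_norm \<Omega> u = sqrt (lap_inner \<Omega> u u)"


section \<open>Hausdorff measure and Lipschitz boundaries\<close>

text \<open>
  The normalising factor makes the \<open>s\<close>-dimensional measure agree with Lebesgue measure on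
  \<open>s\<close>-dimensional planes. Only \<open>s \<ge> 1\<close> is meaningful here (for \<open>s = 0\<close> empty covering sets would be
  counted). Coverings are by bounded sets because \<^const>\<open>diameter\<close> is unspecified on unbounded ones.
\<close>

definition hausdorff_pre :: "nat \<Rightarrow> real \<Rightarrow> 'a::euclidean_space set \<Rightarrow> ennreal" where
  "hausdorff_pre s \<delta> A =
     (INF C \<in> {C :: nat \<Rightarrow> 'a set. A \<subseteq> (\<Union>i. C i) \<and> (\<forall>i. bounded (C i) \<and> diameter (C i) \<le> \<delta>)}.
        (\<Sum>i. ennreal (unit_ball_vol (real s) * (diameter (C i) / 2) ^ s)))"

definition hausdorff_outer :: "nat \<Rightarrow> 'a::euclidean_space set \<Rightarrow> ennreal" where
  "hausdorff_outer s A = (SUP \<delta>\<in>{0<..}. hausdorff_pre s \<delta> A)"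

definition hausdorff_measure :: "nat \<Rightarrow> 'a::euclidean_space measure" where
  "hausdorff_measure s = measure_of UNIV (sets borel) (hausdorff_outer s)"

definition surface_measure :: "'a::euclidean_space set \<Rightarrow> 'a measure" where
  "surface_measure \<Omega> = restrict_space (hausdorff_measure (DIM('a) - 1)) (frontier \<Omega>)"

text \<open>
  A closed Lipschitz surface bounding \<open>\<Omega>\<close>: near each of its points, in coordinates \<open>y = z + t e\<close>
  with \<open>z\<close> orthogonal to a unit vector \<open>e\<close>, the surface is the graph \<open>t = g z\<close> of a Lipschitz
  function and \<open>\<Omega>\<close> is the region above it (so that \<open>\<Omega>\<close> has an outward normal).
\<close>

definition closed_lipschitz_surface ::
    "'a::euclidean_space set \<Rightarrow> 'a set \<Rightarrow> bool" where
  "closed_lipschitz_surface \<Omega> S \<longleftrightarrow>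
     S \<noteq> {} \<and> compact S \<and> connected S \<and>
     (\<forall>p\<in>S. \<exists>U e g L. open U \<and> p \<in> U \<and> norm e = 1 \<and> L-lipschitz_on {z. z \<bullet> e = 0} g \<and>
        S \<inter> U = {y \<in> U. y \<bullet> e = g (y - (y \<bullet> e) *\<^sub>R e)} \<and>
        \<Omega> \<inter> U = {y \<in> U. y \<bullet> e > g (y - (y \<bullet> e) *\<^sub>R e)})"

definition region :: "'a::euclidean_space set \<Rightarrow> bool" where
  "region \<Omega> \<longleftrightarrow> \<Omega> \<noteq> {} \<and> open \<Omega> \<and> connected \<Omega>"

definition B1 :: "'a::euclidean_space set \<Rightarrow> bool" where
  "B1 \<Omega> \<longleftrightarrow> bounded \<Omega> \<and>
     (\<exists>F. finite F \<and> disjoint F \<and> \<Union>F = frontier \<Omega> \<and>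
        (\<forall>S\<in>F. closed_lipschitz_surface \<Omega> S \<and> emeasure (surface_measure \<Omega>) S < \<infinity>))"


section \<open>Traces and normal derivatives\<close>

text \<open>
  The trace operator on \<open>H\<^sup>1(\<Omega>)\<close> is the continuous extension of the restriction to the boundary of
  functions that are Lipschitz on the closure of \<open>\<Omega>\<close>. It is given here by its graph,
  the closure of the graph of that restriction map: \<open>is_trace \<Omega> v h\<close> means \<open>\<gamma>(v) = h\<close>.
\<close>

definition is_trace ::
    "'a::euclidean_space set \<Rightarrow> ('a \<Rightarrow> real) \<Rightarrow> ('a \<Rightarrow> real) \<Rightarrow> bool" where
  "is_trace \<Omega> v h \<longleftrightarrow> v \<in> H1 \<Omega> \<and> h \<in> L2 (surface_measure \<Omega>) \<and>
     (\<exists>f. (\<forall>n. f n \<in> H1 \<Omega> \<and> (\<exists>L. L-lipschitz_on (closure \<Omega>) (f n))) \<and>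
          (\<lambda>n. H1_norm \<Omega> (\<lambda>x. f n x - v x)) \<longlonglongrightarrow> 0 \<and>
          (\<lambda>n. L2_norm (surface_measure \<Omega>) (\<lambda>x. f n x - h x)) \<longlonglongrightarrow> 0)"

definition is_normal_deriv ::
    "'a::euclidean_space set \<Rightarrow> ('a \<Rightarrow> real) \<Rightarrow> ('a \<Rightarrow> real) \<Rightarrow> bool" where
  "is_normal_deriv \<Omega> u g \<longleftrightarrow> g \<in> L2 (surface_measure \<Omega>) \<and>
     (\<forall>v\<in>H1 \<Omega>. \<forall>h. is_trace \<Omega> v h \<longrightarrow>
        (\<integral>x. h x * g x \<partial>surface_measure \<Omega>)
        = (\<integral>x. weak_grad \<Omega> u x \<bullet> weak_grad \<Omega> v x + v x * weak_lap \<Omega> u x \<partial>lebesgue_on \<Omega>))"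

definition normal_deriv :: "'a::euclidean_space set \<Rightarrow> ('a \<Rightarrow> real) \<Rightarrow> 'a \<Rightarrow> real" where
  "normal_deriv \<Omega> u = (SOME g. is_normal_deriv \<Omega> u g)"

text \<open>
  The first clause says that the normal derivative maps all of \<open>H\<^sub>0(\<Delta>,\<Omega>)\<close> into \<open>L\<^sup>2(\<partial>\<Omega>,d\<sigma>)\<close>,
  the second that this map is compact.
\<close>

definition compact_normal_deriv :: "'a::euclidean_space set \<Rightarrow> bool" where
  "compact_normal_deriv \<Omega> \<longleftrightarrow>
     (\<forall>u\<in>H0_Lap \<Omega>. \<exists>g. is_normal_deriv \<Omega> u g) \<and>
     (\<forall>u. (\<forall>n. u n \<in> H0_Lap \<Omega>) \<and> (\<exists>K. \<forall>n::nat. lap_norm \<Omega> (u n) \<le> K) \<longrightarrow>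
        (\<exists>r g. strict_mono r \<and> g \<in> L2 (surface_measure \<Omega>) \<and>
           (\<lambda>n. L2_norm (surface_measure \<Omega>) (\<lambda>x. normal_deriv \<Omega> (u (r n)) x - g x)) \<longlonglongrightarrow> 0))"

definition B2 :: "'a::euclidean_space set \<Rightarrow> bool" where
  "B2 \<Omega> \<longleftrightarrow> B1 \<Omega> \<and> compact_normal_deriv \<Omega>"


section \<open>Dirichlet biharmonic Steklov eigenfunctions\<close>

definition DBS_eigenpair :: "'a::euclidean_space set \<Rightarrow> real \<Rightarrow> ('a \<Rightarrow> real) \<Rightarrow> bool" where
  "DBS_eigenpair \<Omega> q b \<longleftrightarrow> b \<in> H0_Lap \<Omega> \<and> \<not> (AE x in lebesgue_on \<Omega>. b x = 0) \<and>
     (\<forall>v\<in>H0_Lap \<Omega>. lap_inner \<Omega> b v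
        = q * L2_inner (surface_measure \<Omega>) (normal_deriv \<Omega> b) (normal_deriv \<Omega> v))"

definition steklov_form :: "'a::euclidean_space set \<Rightarrow> ('a \<Rightarrow> real) \<Rightarrow> real" where
  "steklov_form \<Omega> u = (\<integral>x. \<bar>normal_deriv \<Omega> u x\<bar>\<^sup>2 \<partial>surface_measure \<Omega>)"

text \<open>Sequences are indexed from \<open>0\<close>: \<open>b k\<close> is the usual \<open>b\<^sub>k\<^sub>+\<^sub>1\<close>.\<close>

definition admissible ::
    "'a::euclidean_space set \<Rightarrow> (nat \<Rightarrow> 'a \<Rightarrow> real) \<Rightarrow> nat \<Rightarrow> ('a \<Rightarrow> real) set" where
  "admissible \<Omega> b k = {u \<in> H0_Lap \<Omega>. lap_norm \<Omega> u \<le> 1 \<and> (\<forall>j<k. lap_inner \<Omega> u (b j) = 0)}"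

definition dbs_sequence :: "'a::euclidean_space set \<Rightarrow> (nat \<Rightarrow> 'a \<Rightarrow> real) \<Rightarrow> bool" where
  "dbs_sequence \<Omega> b \<longleftrightarrow>
     (\<forall>k. b k \<in> admissible \<Omega> b k \<and>
          (\<forall>u\<in>admissible \<Omega> b k. steklov_form \<Omega> u \<le> steklov_form \<Omega> (b k))) \<and>
     (\<forall>j k. lap_inner \<Omega> (b j) (b k) = (if j = k then 1 else 0)) \<and>
     (\<forall>k. DBS_eigenpair \<Omega> (1 / (SUP u\<in>admissible \<Omega> b k. steklov_form \<Omega> u)) (b k))"


section \<open>The harmonic Bergman space\<close>

definition L2H :: "'a::euclidean_space set \<Rightarrow> ('a \<Rightarrow> real) set" where
  "L2H \<Omega> = {u \<in> L2 (lebesgue_on \<Omega>).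
              \<forall>v\<in>Cc 2 \<Omega>. (\<integral>x. u x * laplacian v x \<partial>lebesgue_on \<Omega>) = 0}"

text \<open>
  The \<open>C\<^sup>\<infinity>\<close> version on \<open>\<Omega>\<close>, set to \<open>0\<close> off \<open>\<Omega>\<close> to make it unique as a total function.
\<close>

definition Cinf_version :: "'a::euclidean_space set \<Rightarrow> ('a \<Rightarrow> real) \<Rightarrow> 'a \<Rightarrow> real" where
  "Cinf_version \<Omega> u =
     (THE f. Cinf_on \<Omega> f \<and> (\<forall>x. x \<notin> \<Omega> \<longrightarrow> f x = 0) \<and> (AE x in lebesgue_on \<Omega>. f x = u x))"

definition harmonic_bergman :: "'a::euclidean_space set \<Rightarrow> ('a \<Rightarrow> real) set" where
  "harmonic_bergman \<Omega> = Cinf_version \<Omega> ` L2H \<Omega>"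

definition lap_version ::
    "'a::euclidean_space set \<Rightarrow> ('a \<Rightarrow> real) \<Rightarrow> 'a \<Rightarrow> real" where
  "lap_version \<Omega> u = Cinf_version \<Omega> (weak_lap \<Omega> u)"


section \<open>Reproducing kernel Hilbert spaces\<close>

text \<open>
  A real vector space \<open>F\<close> of functions on \<open>X\<close> (extended by \<open>0\<close> off \<open>X\<close>), complete for the inner
  product \<open>ip\<close>, with bounded point evaluations and reproducing kernel \<open>K\<close>.
\<close>

definition hilbert_function_space ::
    "'x set \<Rightarrow> ('x \<Rightarrow> real) set \<Rightarrow> (('x \<Rightarrow> real) \<Rightarrow> ('x \<Rightarrow> real) \<Rightarrow> real) \<Rightarrow> bool" where
  "hilbert_function_space X F ip \<longleftrightarrow>
     (\<forall>f\<in>F. \<forall>x. x \<notin> X \<longrightarrow> f x = 0) \<and>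
     (\<lambda>x. 0) \<in> F \<and>
     (\<forall>f\<in>F. \<forall>g\<in>F. (\<lambda>x. f x + g x) \<in> F) \<and>
     (\<forall>c. \<forall>f\<in>F. (\<lambda>x. c * f x) \<in> F) \<and>
     (\<forall>f\<in>F. \<forall>g\<in>F. ip f g = ip g f) \<and>
     (\<forall>f\<in>F. \<forall>g\<in>F. \<forall>h\<in>F. ip (\<lambda>x. f x + g x) h = ip f h + ip g h) \<and>
     (\<forall>c. \<forall>f\<in>F. \<forall>g\<in>F. ip (\<lambda>x. c * f x) g = c * ip f g) \<and>
     (\<forall>f\<in>F. ip f f \<ge> 0 \<and> (ip f f = 0 \<longrightarrow> f = (\<lambda>x. 0))) \<and>
     (\<forall>s. (\<forall>n. s n \<in> F) \<and>
          (\<forall>e>0. \<exists>M. \<forall>m\<ge>M. \<forall>n\<ge>M.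
             sqrt (ip (\<lambda>x. s m x - s n x) (\<lambda>x. s m x - s n x)) < e) \<longrightarrow>
          (\<exists>f\<in>F. (\<lambda>n::nat. sqrt (ip (\<lambda>x. s n x - f x) (\<lambda>x. s n x - f x))) \<longlonglongrightarrow> 0))"

definition rkhs_with_kernel ::
    "'x set \<Rightarrow> ('x \<Rightarrow> real) set \<Rightarrow> (('x \<Rightarrow> real) \<Rightarrow> ('x \<Rightarrow> real) \<Rightarrow> real) \<Rightarrow>
     ('x \<Rightarrow> 'x \<Rightarrow> real) \<Rightarrow> bool" where
  "rkhs_with_kernel X F ip K \<longleftrightarrow>
     hilbert_function_space X F ip \<and>
     (\<forall>x\<in>X. \<exists>B. \<forall>f\<in>F. \<bar>f x\<bar> \<le> B * sqrt (ip f f)) \<and>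
     (\<forall>x\<in>X. K x \<in> F \<and> (\<forall>f\<in>F. f x = ip (K x) f))"

end

theory Submission
  imports Defs "HOL-Computational_Algebra.Polynomial"
begin

text \<open>
  The functions \<open>e\<^sub>j\<close>, the smooth versions of \<open>\<Delta> b\<^sub>j\<close>, form an orthonormal basis of the harmonic
  Bergman space, and point evaluations on that space are bounded. Every Hilbert space of functions
  with bounded evaluations and an orthonormal basis \<open>e\<^sub>j\<close> has reproducing kernel
  \<open>\<Sum>\<^sub>j e\<^sub>j(x) e\<^sub>j(y)\<close> (lemma \<open>hilbert_function_space_bounded_evaluation_kernel\<close>). The work lies in
  three facts about the space.

  Smoothness and bounded evaluation come from Weyl's lemma (\<open>Weyl_lemma\<close>). The mollifier is chosen
  as the radial profile of the gradient of a smooth bump. Its derivative in the radius \<open>\<delta>\<close> is then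
  the Laplacian of a rescaled bump, so the averages \<open>u * moll \<delta>\<close> of a weakly harmonic \<open>u\<close> do not
  depend on \<open>\<delta>\<close>. They are smooth, they are bounded by the \<open>L\<^sup>2\<close> norm of \<open>u\<close>, and they tend weakly
  to \<open>u\<close> as \<open>\<delta>\<close> tends to \<open>0\<close>.

  The functions \<open>\<Delta> b\<^sub>j\<close> belong to the space (\<open>weakly_harmonic_DBS\<close>): the eigenvalue equation, tested
  with a test function \<open>v\<close> on \<open>\<Omega>\<close>, has no boundary term, because the normal derivative of \<open>v\<close> is
  orthogonal to all polynomials on the compact boundary.

  They are total (\<open>DBS_Laplacians_total\<close>). Let \<open>u\<close> be harmonic and orthogonal to all of them, and
  solve \<open>\<Delta> w = u\<close> with \<open>w\<close> in \<open>H\<^sub>0\<^sup>1\<close> (\<open>Dirichlet_problem\<close>). After normalisation \<open>w\<close> is a competitor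
  in every maximum problem that defines some \<open>b\<^sub>k\<close>, and compactness of the normal derivative makes
  the maxima arbitrarily small (\<open>steklov_form_eigenfunctions_small\<close>). Therefore \<open>w\<close> has zero normal
  derivative, and its extension by zero has weak Laplacian \<open>u\<close> (extended by zero) on the whole
  space. It remains to approximate \<open>u\<close> weakly by Laplacians of test functions on \<open>\<Omega>\<close>, to which \<open>u\<close> is
  orthogonal. These are obtained by cutting \<open>w\<close> off near a point, pushing the piece into \<open>\<Omega>\<close> along
  the direction in which the boundary is a Lipschitz graph, and mollifying
  (\<open>harmonic_orthogonal_to_compact_Laplacian\<close>). Finitely many cut-offs suffice
  (\<open>harmonic_zero_if_potential_zero_Cauchy_data\<close>).
\<close>

section \<open>Calculus of \<open>C\<^sup>k\<close> functions\<close>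

lemma partial_eqI: "(f has_derivative D) (at x) \<Longrightarrow> partial i f x = D i"
  unfolding partial_def using frechet_derivative_at by metis

lemma has_derivative_partial:
  assumes "f differentiable (at x)"
  shows "(f has_derivative (\<lambda>h. \<Sum>i\<in>Basis. (h \<bullet> i) * partial i f x)) (at x)"
proof -
  let ?D = "frechet_derivative f (at x)"
  have D: "(f has_derivative ?D) (at x)"
    using assms frechet_derivative_works by blast
  have "?D = (\<lambda>h. \<Sum>i\<in>Basis. (h \<bullet> i) * partial i f x)"
  proof
    fix h
    have lin: "linear ?D" using D has_derivative_linear by blast
    have "?D h = ?D (\<Sum>i\<in>Basis. (h \<bullet> i) *\<^sub>R i)" by (simp add: euclidean_representation)
    also have "\<dots> = (\<Sum>i\<in>Basis. (h \<bullet> i) * ?D i)"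
      by (simp add: linear_sum[OF lin] linear_cmul[OF lin])
    finally show "?D h = (\<Sum>i\<in>Basis. (h \<bullet> i) * partial i f x)" by (simp add: partial_def)
  qed
  then show ?thesis using D by simp
qed

lemma has_derivative_cong_open:
  assumes "open S" "x \<in> S" "\<And>y. y \<in> S \<Longrightarrow> f y = g y"
  shows "(f has_derivative D) (at x) \<longleftrightarrow> (g has_derivative D) (at x)"
  using assms has_derivative_transform_within_open[of f D x UNIV S g]
    has_derivative_transform_within_open[of g D x UNIV S f] by auto

lemma partial_cong_open:
  assumes "open S" "x \<in> S" "\<And>y. y \<in> S \<Longrightarrow> f y = g y"
  shows "partial i f x = partial i g x"
  unfolding partial_def frechet_derivative_def using has_derivative_cong_open[OF assms] by simp

lemma Ck_on_cong:
  assumes "open S" "\<And>y. y \<in> S \<Longrightarrow> f y = g y"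
  shows "Ck_on k S f \<longleftrightarrow> Ck_on k S g"
  using assms(2)
proof (induction k arbitrary: f g)
  case 0
  then show ?case using continuous_on_cong by (metis Ck_on.simps(1))
next
  case (Suc k)
  have "(\<forall>x\<in>S. f differentiable (at x)) \<longleftrightarrow> (\<forall>x\<in>S. g differentiable (at x))"
    unfolding differentiable_def using has_derivative_cong_open[OF assms(1)] Suc.prems by metis
  moreover have "Ck_on k S (partial i f) \<longleftrightarrow> Ck_on k S (partial i g)" for i
    by (rule Suc.IH) (rule partial_cong_open[OF assms(1)], use Suc.prems in auto)
  ultimately show ?case by simp
qed

lemma Ck_on_subset: "Ck_on k T f \<Longrightarrow> S \<subseteq> T \<Longrightarrow> Ck_on k S f"
  by (induction k arbitrary: f) (auto intro: continuous_on_subset)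

lemma Ck_on_continuous: "Ck_on k S f \<Longrightarrow> continuous_on S f"
  by (cases k) (auto intro!: continuous_at_imp_continuous_on differentiable_imp_continuous_within)

lemma Ck_on_Suc_imp: "Ck_on (Suc k) S f \<Longrightarrow> Ck_on k S f"
proof (induction k arbitrary: f)
  case 0
  then show ?case using Ck_on_continuous by (metis Ck_on.simps(1))
next
  case (Suc k)
  then show ?case by simp
qed

lemma Ck_on_mono: "Ck_on k S f \<Longrightarrow> j \<le> k \<Longrightarrow> Ck_on j S f"
  by (induction k) (auto simp: le_Suc_eq dest: Ck_on_Suc_imp simp del: Ck_on.simps(2))

lemma Ck_on_local:
  assumes "\<And>x. x \<in> S \<Longrightarrow> \<exists>T. open T \<and> x \<in> T \<and> Ck_on k T f"
  shows "Ck_on k S f"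
  using assms
proof (induction k arbitrary: f)
  case 0
  have "isCont f x" if "x \<in> S" for x
    using 0[OF that] by (auto simp: continuous_on_eq_continuous_at)
  then show ?case by (simp add: continuous_at_imp_continuous_on)
next
  case (Suc k)
  have "f differentiable (at x)" if "x \<in> S" for x
    using Suc.prems[OF that] by auto
  moreover have "Ck_on k S (partial i f)" if "i \<in> Basis" for i
    by (rule Suc.IH) (use Suc.prems that in fastforce)
  ultimately show ?case by simp
qed

lemma Ck_on_const: "Ck_on k S (\<lambda>x. c)"
proof (induction k arbitrary: c)
  case (Suc k)
  have "partial i (\<lambda>x. c) = (\<lambda>x. 0)" for i :: 'a
    by (rule ext, rule partial_eqI[THEN trans]) (auto intro: has_derivative_const)
  then show ?case using Suc by simp
qed auto

lemma partial_linear: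
  assumes "bounded_linear f" shows "partial i f x = f i"
  using partial_eqI[OF bounded_linear.has_derivative[OF assms has_derivative_ident]] by simp

lemma Ck_on_linear:
  assumes "bounded_linear f" shows "Ck_on k S f"
proof (cases k)
  case 0
  then show ?thesis using assms by (simp add: linear_continuous_on)
next
  case (Suc l)
  have "partial i f = (\<lambda>x. f i)" for i
    using partial_linear[OF assms] by auto
  moreover have "f differentiable (at x)" for x
    using bounded_linear_imp_differentiable[OF assms] by blast
  ultimately show ?thesis unfolding Suc by (simp add: Ck_on_const)
qed

lemma partial_add:
  assumes "f differentiable (at x)" "g differentiable (at x)"
  shows "partial i (\<lambda>x. f x + g x) x = partial i f x + partial i g x"
  using partial_eqI[OF has_derivative_add[OF assms[unfolded frechet_derivative_works]]]
  by (simp add: partial_def)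

lemma partial_mult:
  fixes f g :: "'a::euclidean_space \<Rightarrow> real"
  assumes "f differentiable (at x)" "g differentiable (at x)"
  shows "partial i (\<lambda>x. f x * g x) x = f x * partial i g x + partial i f x * g x"
  using partial_eqI[OF has_derivative_mult[OF assms[unfolded frechet_derivative_works]]]
  by (simp add: partial_def)

lemma partial_cmult:
  fixes f :: "'a::euclidean_space \<Rightarrow> real"
  assumes "f differentiable (at x)"
  shows "partial i (\<lambda>x. c * f x) x = c * partial i f x"
  using partial_mult[of "\<lambda>x. c" x f i] assms partial_eqI[OF has_derivative_const[of c "at x"]] by simp

lemma Ck_on_add:
  assumes "open S" "Ck_on k S f" "Ck_on k S g"
  shows "Ck_on k S (\<lambda>x. f x + g x)"
  using assms(2-)
proof (induction k arbitrary: f g)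
  case (Suc k)
  have "Ck_on k S (partial i (\<lambda>x. f x + g x))" if i: "i \<in> Basis" for i
  proof -
    have "Ck_on k S (\<lambda>x. partial i f x + partial i g x)" using Suc.IH Suc.prems i by auto
    then show ?thesis
      by (rule Ck_on_cong[OF assms(1), THEN iffD2, rotated]) (use Suc.prems in \<open>auto intro!: partial_add\<close>)
  qed
  then show ?case using Suc.prems by (auto intro: derivative_intros)
qed (auto intro: continuous_intros)

lemma Ck_on_mult:
  fixes f g :: "'a::euclidean_space \<Rightarrow> real"
  assumes "open S" "Ck_on k S f" "Ck_on k S g"
  shows "Ck_on k S (\<lambda>x. f x * g x)"
  using assms(2-)
proof (induction k arbitrary: f g)
  case (Suc k)
  have fg: "Ck_on k S f" "Ck_on k S g" using Suc Ck_on_Suc_imp by blast+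
  have "Ck_on k S (partial i (\<lambda>x. f x * g x))" if i: "i \<in> Basis" for i
  proof -
    have "Ck_on k S (\<lambda>x. f x * partial i g x + partial i f x * g x)"
      using Suc.prems i fg by (intro Ck_on_add assms(1) Suc.IH) auto
    then show ?thesis
      by (rule Ck_on_cong[OF assms(1), THEN iffD2, rotated]) (use Suc.prems in \<open>auto intro!: partial_mult\<close>)
  qed
  then show ?case using Suc.prems by (auto intro: derivative_intros)
qed (auto intro: continuous_intros)

lemma Ck_on_sum:
  assumes "open S" "\<And>i. i \<in> I \<Longrightarrow> Ck_on k S (f i)"
  shows "Ck_on k S (\<lambda>x. \<Sum>i\<in>I. f i x)"
  using assms by (induction I rule: infinite_finite_induct) (auto intro: Ck_on_add Ck_on_const)

lemma partial_affine:
  fixes f :: "'a::euclidean_space \<Rightarrow> real"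
  assumes "f differentiable (at (a + c *\<^sub>R x))"
  shows "partial i (\<lambda>x. f (a + c *\<^sub>R x)) x = c * partial i f (a + c *\<^sub>R x)"
    and "(\<lambda>x. f (a + c *\<^sub>R x)) differentiable (at x)"
proof -
  let ?D = "frechet_derivative f (at (a + c *\<^sub>R x))"
  have D: "(f has_derivative ?D) (at (a + c *\<^sub>R x))"
    using assms frechet_derivative_works by blast
  have "((\<lambda>x. a + c *\<^sub>R x) has_derivative (\<lambda>h. c *\<^sub>R h)) (at x)"
    by (auto intro!: derivative_eq_intros)
  from diff_chain_at[OF this, of f ?D] D
  have 1: "((\<lambda>x. f (a + c *\<^sub>R x)) has_derivative (\<lambda>h. ?D (c *\<^sub>R h))) (at x)"
    by (simp add: o_def)
  then show "(\<lambda>x. f (a + c *\<^sub>R x)) differentiable (at x)" unfolding differentiable_def by blast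
  have "linear ?D" using D has_derivative_linear by blast
  then show "partial i (\<lambda>x. f (a + c *\<^sub>R x)) x = c * partial i f (a + c *\<^sub>R x)"
    using partial_eqI[OF 1] by (simp add: partial_def linear_cmul)
qed

lemma Ck_on_affine:
  fixes f :: "'a::euclidean_space \<Rightarrow> real"
  assumes "Ck_on k UNIV f"
  shows "Ck_on k UNIV (\<lambda>x. f (a + c *\<^sub>R x))"
  using assms
proof (induction k arbitrary: f)
  case 0
  then show ?case by (auto intro!: continuous_on_compose2[of UNIV f] continuous_intros)
next
  case (Suc k)
  have "Ck_on k UNIV (partial i (\<lambda>x. f (a + c *\<^sub>R x)))" if i: "i \<in> Basis" for i
  proof -
    have "Ck_on k UNIV (\<lambda>x. c * partial i f (a + c *\<^sub>R x))"
      using Suc i by (intro Ck_on_mult Ck_on_const) auto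
    moreover have "partial i (\<lambda>x. f (a + c *\<^sub>R x)) = (\<lambda>x. c * partial i f (a + c *\<^sub>R x))"
      using Suc.prems by (auto intro!: partial_affine)
    ultimately show ?thesis by simp
  qed
  then show ?case using Suc.prems by (auto intro!: partial_affine(2))
qed

lemma Cinf_on_differentiable: "Cinf_on S f \<Longrightarrow> x \<in> S \<Longrightarrow> f differentiable (at x)"
  unfolding Cinf_on_def using Ck_on.simps(2)[of 0 S f] by blast

lemma Cinf_on_partial: "Cinf_on S f \<Longrightarrow> i \<in> Basis \<Longrightarrow> Cinf_on S (partial i f)"
  unfolding Cinf_on_def using Ck_on.simps(2) by blast

lemma Cinf_on_continuous: "Cinf_on S f \<Longrightarrow> continuous_on S f"
  unfolding Cinf_on_def using Ck_on_continuous by blast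

lemma Cinf_on_const: "Cinf_on S (\<lambda>x. c)"
  unfolding Cinf_on_def using Ck_on_const by blast

lemma Cinf_on_linear: "bounded_linear f \<Longrightarrow> Cinf_on S f"
  unfolding Cinf_on_def using Ck_on_linear by blast

lemma Cinf_on_add: "open S \<Longrightarrow> Cinf_on S f \<Longrightarrow> Cinf_on S g \<Longrightarrow> Cinf_on S (\<lambda>x. f x + g x)"
  unfolding Cinf_on_def using Ck_on_add by blast

lemma Cinf_on_mult:
  "open S \<Longrightarrow> Cinf_on S f \<Longrightarrow> Cinf_on S g \<Longrightarrow> Cinf_on S (\<lambda>x. f x * g x)"
  unfolding Cinf_on_def using Ck_on_mult by blast

lemma Cinf_on_diff: "open S \<Longrightarrow> Cinf_on S f \<Longrightarrow> Cinf_on S g \<Longrightarrow> Cinf_on S (\<lambda>x. f x - g x)"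
  using Cinf_on_add[of S f "\<lambda>x. (-1) * g x"] Cinf_on_mult[of S "\<lambda>x. -1" g] Cinf_on_const[of S "-1"]
  by simp

lemma Cinf_on_sum:
  "open S \<Longrightarrow> (\<And>i. i \<in> I \<Longrightarrow> Cinf_on S (f i)) \<Longrightarrow> Cinf_on S (\<lambda>x. \<Sum>i\<in>I. f i x)"
  unfolding Cinf_on_def by (simp add: Ck_on_sum)

lemma Cinf_on_affine: "Cinf_on UNIV f \<Longrightarrow> Cinf_on UNIV (\<lambda>x. f (a + c *\<^sub>R x))"
  unfolding Cinf_on_def using Ck_on_affine by blast

lemma Cinf_on_laplacian: "Cinf_on UNIV f \<Longrightarrow> Cinf_on UNIV (laplacian f)"
proof -
  assume "Cinf_on UNIV f"
  then have "Cinf_on UNIV (\<lambda>x. \<Sum>i\<in>Basis. partial i (partial i f) x)"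
    by (intro Cinf_on_sum) (auto intro: Cinf_on_partial)
  then show ?thesis by (simp add: laplacian_def[abs_def])
qed

lemma Cinf_on_polynomial: "real_polynomial_function p \<Longrightarrow> Cinf_on UNIV p"
  by (induction rule: real_polynomial_function.induct)
    (auto intro: Cinf_on_linear Cinf_on_const Cinf_on_add Cinf_on_mult)

lemma laplacian_mult:
  assumes f: "Cinf_on UNIV f" and g: "Cinf_on UNIV g"
  shows "laplacian (\<lambda>x. f x * g x) x =
    f x * laplacian g x + 2 * (\<Sum>i\<in>Basis. partial i f x * partial i g x) + laplacian f x * g x"
proof -
  have "partial i (partial i (\<lambda>x. f x * g x)) x = f x * partial i (partial i g) x
      + 2 * (partial i f x * partial i g x) + partial i (partial i f) x * g x" if i: "i \<in> Basis" for i
  proof -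
    note d = Cinf_on_differentiable[OF f] Cinf_on_differentiable[OF g]
      Cinf_on_differentiable[OF Cinf_on_partial[OF f i]]
      Cinf_on_differentiable[OF Cinf_on_partial[OF g i]]
    have "partial i (\<lambda>x. f x * g x) = (\<lambda>x. f x * partial i g x + partial i f x * g x)"
      by (rule ext, rule partial_mult) (use d in auto)
    then show ?thesis using d
      by (simp add: partial_add partial_mult differentiable_mult)
  qed
  then show ?thesis
    by (simp add: laplacian_def sum.distrib sum_distrib_left sum_distrib_right)
qed

lemma partial_zero_outside:
  assumes "closed K" "\<And>x. x \<notin> K \<Longrightarrow> f x = 0" "x \<notin> K"
  shows "partial i f x = 0"
proof -
  have "partial i f x = partial i (\<lambda>x. 0) x"
    by (rule partial_cong_open[of "- K"]) (use assms in auto)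
  also have "\<dots> = 0" using partial_eqI[OF has_derivative_const] by metis
  finally show ?thesis .
qed

lemma laplacian_zero_outside:
  assumes "closed K" "\<And>x. x \<notin> K \<Longrightarrow> f x = 0" "x \<notin> K"
  shows "laplacian f x = 0"
  unfolding laplacian_def
  by (intro sum.neutral ballI partial_zero_outside[OF assms(1) _ assms(3)]
      partial_zero_outside[OF assms(1,2)])

lemma laplacian_affine:
  fixes f :: "'a::euclidean_space \<Rightarrow> real"
  assumes "Cinf_on UNIV f"
  shows "laplacian (\<lambda>x. f (a + c *\<^sub>R x)) x = c\<^sup>2 * laplacian f (a + c *\<^sub>R x)"
proof -
  have "partial i (partial i (\<lambda>x. f (a + c *\<^sub>R x))) x = c\<^sup>2 * partial i (partial i f) (a + c *\<^sub>R x)"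
    if i: "i \<in> Basis" for i
  proof -
    note d = Cinf_on_differentiable[OF assms] Cinf_on_differentiable[OF Cinf_on_partial[OF assms i]]
    have "partial i (\<lambda>x. f (a + c *\<^sub>R x)) = (\<lambda>x. c * partial i f (a + c *\<^sub>R x))"
      by (rule ext, rule partial_affine) (use d in auto)
    then show ?thesis
      by (simp add: partial_cmult partial_affine d power2_eq_square)
  qed
  then show ?thesis by (simp add: laplacian_def sum_distrib_left)
qed


section \<open>Test functions\<close>

lemma Cc_infI:
  assumes "Cinf_on UNIV f" "compact K" "K \<subseteq> \<Omega>" "\<And>x. x \<notin> K \<Longrightarrow> f x = 0"
  shows "f \<in> Cc_inf \<Omega>"
proof -
  have "{x. f x \<noteq> 0} \<subseteq> K" using assms(4) by auto
  then have "closure {x. f x \<noteq> 0} \<subseteq> K"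
    using assms(2) by (simp add: closure_minimal compact_imp_closed)
  moreover from this have "compact (closure {x. f x \<noteq> 0})"
    using assms(2) closed_Int_compact[of "closure {x. f x \<noteq> 0}" K] by (simp add: Int_absorb2)
  ultimately show ?thesis using assms(1,3) unfolding Cc_inf_def Cc_def Cinf_on_def by auto
qed

lemma Cc_inf_Cinf: "f \<in> Cc_inf \<Omega> \<Longrightarrow> Cinf_on UNIV f"
  unfolding Cc_inf_def Cc_def Cinf_on_def by auto

lemma Cc_inf_support:
  assumes "f \<in> Cc_inf \<Omega>"
  obtains K where "compact K" "K \<subseteq> \<Omega>" "\<And>x. x \<notin> K \<Longrightarrow> f x = 0"
proof
  have "f \<in> Cc 0 \<Omega>" using assms unfolding Cc_inf_def by blast
  then show "compact (closure {x. f x \<noteq> 0})" "closure {x. f x \<noteq> 0} \<subseteq> \<Omega>"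
    unfolding Cc_def by blast+
  show "f x = 0" if "x \<notin> closure {x. f x \<noteq> 0}" for x
    using that closure_subset[of "{x. f x \<noteq> 0}"] by auto
qed

lemma Cc_inf_zero: "(\<lambda>x. 0) \<in> Cc_inf \<Omega>"
  by (rule Cc_infI[of _ "{}"]) (auto intro: Cinf_on_const)

lemma Cc_inf_mult:
  assumes f: "f \<in> Cc_inf \<Omega>" and g: "Cinf_on UNIV g"
  shows "(\<lambda>x. f x * g x) \<in> Cc_inf \<Omega>" "(\<lambda>x. g x * f x) \<in> Cc_inf \<Omega>"
proof -
  obtain K where K: "compact K" "K \<subseteq> \<Omega>" "\<And>x. x \<notin> K \<Longrightarrow> f x = 0" using Cc_inf_support[OF f] by blast
  show 1: "(\<lambda>x. f x * g x) \<in> Cc_inf \<Omega>"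
    by (rule Cc_infI[OF _ K(1,2)]) (use K(3) Cc_inf_Cinf[OF f] g in \<open>auto intro!: Cinf_on_mult\<close>)
  then show "(\<lambda>x. g x * f x) \<in> Cc_inf \<Omega>" by (simp add: mult.commute)
qed

lemma Cc_inf_cmult: "f \<in> Cc_inf \<Omega> \<Longrightarrow> (\<lambda>x. c * f x) \<in> Cc_inf \<Omega>"
  using Cc_inf_mult(2) Cinf_on_const by blast

lemma Cc_inf_add:
  assumes f: "f \<in> Cc_inf \<Omega>" and g: "g \<in> Cc_inf \<Omega>"
  shows "(\<lambda>x. f x + g x) \<in> Cc_inf \<Omega>"
proof -
  obtain K where K: "compact K" "K \<subseteq> \<Omega>" "\<And>x. x \<notin> K \<Longrightarrow> f x = 0" using Cc_inf_support[OF f] by blast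
  obtain L where L: "compact L" "L \<subseteq> \<Omega>" "\<And>x. x \<notin> L \<Longrightarrow> g x = 0" using Cc_inf_support[OF g] by blast
  show ?thesis
    by (rule Cc_infI[of _ "K \<union> L"])
      (use K L Cc_inf_Cinf[OF f] Cc_inf_Cinf[OF g] in \<open>auto intro!: Cinf_on_add\<close>)
qed

lemma Cc_inf_partial:
  assumes f: "f \<in> Cc_inf \<Omega>" and "i \<in> Basis"
  shows "partial i f \<in> Cc_inf \<Omega>"
proof -
  obtain K where K: "compact K" "K \<subseteq> \<Omega>" "\<And>x. x \<notin> K \<Longrightarrow> f x = 0" using Cc_inf_support[OF f] by blast
  show ?thesis
    by (rule Cc_infI[OF _ K(1,2)])
      (use K Cc_inf_Cinf[OF f] assms(2) partial_zero_outside[of K f] in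
        \<open>auto intro!: Cinf_on_partial compact_imp_closed\<close>)
qed

lemma Cc_inf_laplacian:
  assumes f: "f \<in> Cc_inf \<Omega>"
  shows "laplacian f \<in> Cc_inf \<Omega>"
proof -
  obtain K where K: "compact K" "K \<subseteq> \<Omega>" "\<And>x. x \<notin> K \<Longrightarrow> f x = 0" using Cc_inf_support[OF f] by blast
  show ?thesis
    by (rule Cc_infI[OF _ K(1,2)])
      (use K Cc_inf_Cinf[OF f] laplacian_zero_outside[of K f] in
        \<open>auto intro!: Cinf_on_laplacian compact_imp_closed\<close>)
qed


section \<open>A smooth bump and its mollifier\<close>

text \<open>The functions \<open>p(1/t) exp(-1/t)\<close> on \<open>t > 0\<close>, extended by zero, with \<open>p\<close> a polynomial:
  the family is closed under differentiation, so all its members are smooth.\<close>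

definition flat :: "real poly \<Rightarrow> real \<Rightarrow> real" where
  "flat p t = (if t > 0 then poly p (1 / t) * exp (- (1 / t)) else 0)"

definition flat_deriv :: "real poly \<Rightarrow> real poly" where
  "flat_deriv p = [:0, 0, 1:] * (p - pderiv p)"

text \<open>With \<open>x = 1 / t\<close> this is the decay of \<open>p(x) exp(-x)\<close> at infinity. It makes all
  derivatives of the family vanish at the origin.\<close>

lemma flat_tendsto_0: "((\<lambda>t. poly p (1 / t) * exp (- (1 / t))) \<longlongrightarrow> 0) (at_right (0::real))"
proof -
  have *: "((\<lambda>x::real. poly p x * exp (- x)) \<longlongrightarrow> 0) at_top"
  proof (induction p rule: pCons_induct)
    case (pCons a p)
    have 1: "((\<lambda>x::real. coeff (pCons a p) i * (x ^ i / exp x)) \<longlongrightarrow> 0) at_top" for i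
      using tendsto_mult_right_zero[OF tendsto_power_div_exp_0] by blast
    have "((\<lambda>x::real. \<Sum>i\<le>degree (pCons a p). coeff (pCons a p) i * (x ^ i / exp x)) \<longlongrightarrow> 0) at_top"
      using tendsto_sum[of "{..degree (pCons a p)}", OF 1] by simp
    then show ?case
      by (simp only: poly_altdef sum_distrib_right exp_minus) (simp add: field_simps)
  qed simp
  have "filterlim (\<lambda>t::real. 1 / t) at_top (at_right 0)"
    using filterlim_inverse_at_top_right by (simp add: inverse_eq_divide)
  from filterlim_compose[OF * this] show ?thesis by simp
qed

lemma flat_has_derivative: "(flat p has_real_derivative flat (flat_deriv p) t) (at t)"
proof -
  consider "t > 0" | "t < 0" | "t = 0" by linarith
  then show ?thesis
  proof cases
    case 1
    have "((\<lambda>t. poly p (1 / t) * exp (- (1 / t))) has_real_derivative flat (flat_deriv p) t) (at t)"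
      using 1 unfolding flat_def flat_deriv_def
      by (auto intro!: derivative_eq_intros simp: field_simps power2_eq_square)
    then show ?thesis
      by (rule has_field_derivative_transform_within_open[of _ _ _ "{0<..}"])
        (use 1 in \<open>auto simp: flat_def\<close>)
  next
    case 2
    have "((\<lambda>t. 0) has_real_derivative flat (flat_deriv p) t) (at t)"
      using 2 by (auto simp: flat_def)
    then show ?thesis
      by (rule has_field_derivative_transform_within_open[of _ _ _ "{..<0}"])
        (use 2 in \<open>auto simp: flat_def\<close>)
  next
    case 3
    have "((\<lambda>y. flat p y / y) \<longlongrightarrow> 0) (at_right 0)"
    proof (rule Lim_transform_eventually[OF flat_tendsto_0[of "pCons 0 p"]])
      show "\<forall>\<^sub>F x in at_right 0. poly (pCons 0 p) (1 / x) * exp (- (1 / x)) = flat p x / x"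
        by (auto simp: flat_def eventually_at_filter intro!: always_eventually)
    qed
    moreover have "((\<lambda>y. flat p y / y) \<longlongrightarrow> 0) (at_left 0)"
      by (rule Lim_transform_eventually[OF tendsto_const])
        (auto simp: flat_def eventually_at_filter intro!: always_eventually)
    ultimately have "((\<lambda>y. flat p y / y) \<longlongrightarrow> 0) (at 0)"
      by (simp add: filterlim_at_split)
    then show ?thesis using 3 by (simp add: has_field_derivative_iff flat_def)
  qed
qed

lemma partial_flat_compose:
  fixes q :: "'a::euclidean_space \<Rightarrow> real"
  assumes "q differentiable (at x)"
  shows "partial i (\<lambda>x. flat p (q x)) x = flat (flat_deriv p) (q x) * partial i q x"
    and "(\<lambda>x. flat p (q x)) differentiable (at x)"
proof -
  have 1: "((\<lambda>x. flat p (q x)) has_derivative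
      (\<lambda>h. flat (flat_deriv p) (q x) * frechet_derivative q (at x) h)) (at x)"
    using diff_chain_at[OF assms[unfolded frechet_derivative_works]
        flat_has_derivative[of p "q x", unfolded has_field_derivative_def]] by (simp add: o_def)
  show "partial i (\<lambda>x. flat p (q x)) x = flat (flat_deriv p) (q x) * partial i q x"
    using partial_eqI[OF 1] by (simp add: partial_def)
  show "(\<lambda>x. flat p (q x)) differentiable (at x)" using 1 differentiable_def by blast
qed

lemma Cinf_on_flat_compose:
  fixes q :: "'a::euclidean_space \<Rightarrow> real"
  assumes "Cinf_on UNIV q"
  shows "Cinf_on UNIV (\<lambda>x. flat p (q x))"
proof -
  note d = Cinf_on_differentiable[OF assms]
  have "Ck_on k UNIV (\<lambda>x. flat p (q x))" for k
  proof (induction k arbitrary: p)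
    case 0
    show ?case
      using partial_flat_compose(2)[OF d, of _ p]
      by (auto intro!: continuous_at_imp_continuous_on differentiable_imp_continuous_within)
  next
    case (Suc k)
    have "Ck_on k UNIV (partial i (\<lambda>x. flat p (q x)))" if i: "i \<in> Basis" for i
    proof -
      have "Ck_on k UNIV (\<lambda>x. flat (flat_deriv p) (q x) * partial i q x)"
        using Suc Cinf_on_partial[OF assms i] by (intro Ck_on_mult) (auto simp: Cinf_on_def)
      moreover have "partial i (\<lambda>x. flat p (q x)) = (\<lambda>x. flat (flat_deriv p) (q x) * partial i q x)"
        using partial_flat_compose(1)[OF d] by auto
      ultimately show ?thesis by simp
    qed
    then show ?case using partial_flat_compose(2)[OF d] by simp
  qed
  then show ?thesis by (simp add: Cinf_on_def)
qed

definition bump :: "'a::euclidean_space \<Rightarrow> real" where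
  "bump z = flat 1 (1 - z \<bullet> z)"

definition radial :: "'a::euclidean_space \<Rightarrow> real" where
  "radial z = flat (flat_deriv 1) (1 - z \<bullet> z)"

lemma has_derivative_one_minus_sq:
  "((\<lambda>z::'a::euclidean_space. 1 - z \<bullet> z) has_derivative (\<lambda>h. - 2 * (x \<bullet> h))) (at x)"
  by (auto intro!: derivative_eq_intros simp: inner_commute)

lemma Cinf_on_one_minus_sq: "Cinf_on UNIV (\<lambda>z::'a::euclidean_space. 1 - z \<bullet> z)"
proof -
  have "Cinf_on UNIV (\<lambda>z::'a. 1 - (\<Sum>i\<in>Basis. (z \<bullet> i) * (z \<bullet> i)))"
    by (intro Cinf_on_diff Cinf_on_sum Cinf_on_mult Cinf_on_const Cinf_on_linear)
      (auto intro: bounded_linear_inner_left)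
  then show ?thesis by (simp add: euclidean_inner[symmetric])
qed

lemma Cinf_on_bump: "Cinf_on UNIV bump"
  unfolding bump_def[abs_def] by (rule Cinf_on_flat_compose[OF Cinf_on_one_minus_sq])

lemma Cinf_on_radial: "Cinf_on UNIV radial"
  unfolding radial_def[abs_def] by (rule Cinf_on_flat_compose[OF Cinf_on_one_minus_sq])

lemma bump_radial_outside:
  assumes "norm z \<ge> 1" shows "bump z = 0" "radial z = 0"
proof -
  have "1 - z \<bullet> z \<le> 0" using assms by (simp add: dot_square_norm)
  then show "bump z = 0" "radial z = 0" by (auto simp: bump_def radial_def flat_def)
qed

lemma radial_nonneg: "radial z \<ge> 0"
  by (auto simp: radial_def flat_def flat_deriv_def)

lemma radial_pos: "norm z < 1 \<Longrightarrow> radial z > 0"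
  by (auto simp: radial_def flat_def flat_deriv_def dot_square_norm power_less_one_iff abs_square_less_1)

text \<open>The gradient of the bump is the radial field \<open>-2 z radial z\<close>. Hence its Laplacian is a
  divergence of the same radial field that appears when \<open>radial\<close> is rescaled.\<close>

lemma partial_bump:
  assumes "i \<in> Basis" shows "partial i bump (z::'a::euclidean_space) = - 2 * (z \<bullet> i) * radial z"
proof -
  have "partial i bump z = flat (flat_deriv 1) (1 - z \<bullet> z) * partial i (\<lambda>z. 1 - z \<bullet> z) z"
    unfolding bump_def[abs_def]
    by (rule partial_flat_compose(1)) (rule Cinf_on_differentiable[OF Cinf_on_one_minus_sq], simp)
  also have "partial i (\<lambda>z. 1 - z \<bullet> z) z = - 2 * (z \<bullet> i)"
    by (rule partial_eqI[OF has_derivative_one_minus_sq])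
  finally show ?thesis by (simp add: radial_def)
qed

lemma laplacian_bump:
  "laplacian bump (z::'a::euclidean_space) =
     - 2 * (DIM('a) * radial z + (\<Sum>i\<in>Basis. (z \<bullet> i) * partial i radial z))"
proof -
  have d: "radial differentiable (at z)" using Cinf_on_differentiable[OF Cinf_on_radial] by blast
  have "partial i (partial i bump) z = - 2 * (radial z + (z \<bullet> i) * partial i radial z)"
    if i: "i \<in> Basis" for i :: 'a
  proof -
    have l: "bounded_linear (\<lambda>z. - 2 * (z \<bullet> i))"
      by (intro bounded_linear_const_mult bounded_linear_inner_left)
    have "partial i bump = (\<lambda>z. (- 2 * (z \<bullet> i)) * radial z)" using partial_bump[OF i] by auto
    then have "partial i (partial i bump) z
        = (- 2 * (z \<bullet> i)) * partial i radial z + (- 2 * (i \<bullet> i)) * radial z"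
      using partial_mult[of "\<lambda>z. - 2 * (z \<bullet> i)" z radial i] partial_linear[OF l]
        bounded_linear_imp_differentiable[OF l] d by simp
    then show ?thesis using i by simp
  qed
  then have "laplacian bump z = (\<Sum>i\<in>Basis. - 2 * (radial z + (z \<bullet> i) * partial i radial z))"
    by (simp add: laplacian_def)
  also have "\<dots> = - 2 * (DIM('a) * radial z + (\<Sum>i\<in>Basis. (z \<bullet> i) * partial i radial z))"
    by (simp add: sum_distrib_left sum.distrib sum_subtractf sum_negf algebra_simps)
  finally show ?thesis .
qed

section \<open>Square-integrable functions\<close>

lemma quadratic_nonneg_imp_discriminant:
  fixes a b c :: real
  assumes "\<And>t. 0 \<le> a + 2 * t * b + t\<^sup>2 * c" "c \<ge> 0"
  shows "b\<^sup>2 \<le> a * c"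
proof (cases "c = 0")
  case True
  have "b = 0"
  proof (rule ccontr)
    assume "b \<noteq> 0"
    then show False using assms(1)[of "- (a + 1) / (2 * b)"] True by (simp add: field_simps)
  qed
  then show ?thesis using True by simp
next
  case False
  then have "c > 0" using assms by simp
  have "0 \<le> a + 2 * (- b / c) * b + (- b / c)\<^sup>2 * c" by (rule assms)
  also have "\<dots> = a - b\<^sup>2 / c" using \<open>c > 0\<close> by (simp add: field_simps power2_eq_square)
  finally have "b\<^sup>2 / c \<le> a" by simp
  then show ?thesis using \<open>c > 0\<close> by (simp add: pos_divide_le_eq)
qed

lemma L2_measurable: "f \<in> L2 M \<Longrightarrow> f \<in> borel_measurable M"
  and L2_sq_integrable: "f \<in> L2 M \<Longrightarrow> integrable M (\<lambda>x. (f x)\<^sup>2)"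
  by (auto simp: L2_def)

lemma L2_mult_integrable:
  assumes "f \<in> L2 M" "g \<in> L2 M"
  shows "integrable M (\<lambda>x. f x * g x)"
proof (rule Bochner_Integration.integrable_bound)
  show "integrable M (\<lambda>x. (f x)\<^sup>2 + (g x)\<^sup>2)"
    using assms by (simp add: L2_sq_integrable)
  show "(\<lambda>x. f x * g x) \<in> borel_measurable M"
    using assms[THEN L2_measurable] by simp
  have "\<bar>a * b\<bar> \<le> a\<^sup>2 + b\<^sup>2" for a b :: real
  proof -
    have "2 * \<bar>a * b\<bar> \<le> a\<^sup>2 + b\<^sup>2"
      using sum_squares_bound[of "\<bar>a\<bar>" "\<bar>b\<bar>"] by (simp add: abs_mult)
    then show ?thesis by linarith
  qed
  then show "AE x in M. norm (f x * g x) \<le> norm ((f x)\<^sup>2 + (g x)\<^sup>2)" by simp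
qed

lemma L2_zero: "(\<lambda>x. 0) \<in> L2 M"
  by (simp add: L2_def)

lemma L2_cmult: "f \<in> L2 M \<Longrightarrow> (\<lambda>x. c * f x) \<in> L2 M"
  by (auto simp: L2_def power_mult_distrib)

lemma L2_add:
  assumes "f \<in> L2 M" "g \<in> L2 M" shows "(\<lambda>x. f x + g x) \<in> L2 M"
  using assms L2_measurable[OF assms(1)] L2_measurable[OF assms(2)] L2_sq_integrable[OF assms(1)]
    L2_sq_integrable[OF assms(2)] L2_mult_integrable[OF assms]
  by (simp add: L2_def power2_sum mult.assoc)

lemma L2_diff:
  assumes "f \<in> L2 M" "g \<in> L2 M" shows "(\<lambda>x. f x - g x) \<in> L2 M"
  using L2_add[OF assms(1) L2_cmult[OF assms(2), of "-1"]] by simp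

lemma L2_inner_add:
  "f \<in> L2 M \<Longrightarrow> g \<in> L2 M \<Longrightarrow> h \<in> L2 M \<Longrightarrow>
   L2_inner M (\<lambda>x. f x + g x) h = L2_inner M f h + L2_inner M g h"
  by (simp add: L2_inner_def distrib_right L2_mult_integrable)

lemma L2_inner_cmult: "L2_inner M (\<lambda>x. c * f x) h = c * L2_inner M f h"
  by (simp add: L2_inner_def mult.assoc)

lemma L2_inner_commute: "L2_inner M f g = L2_inner M g f"
  by (simp add: L2_inner_def mult.commute)

lemma L2_inner_diff:
  "f \<in> L2 M \<Longrightarrow> g \<in> L2 M \<Longrightarrow> h \<in> L2 M \<Longrightarrow>
   L2_inner M (\<lambda>x. f x - g x) h = L2_inner M f h - L2_inner M g h"
  by (simp add: L2_inner_def left_diff_distrib L2_mult_integrable)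

lemma L2_inner_self_nonneg: "L2_inner M f f \<ge> 0"
  by (simp add: L2_inner_def)

lemma L2_norm_nonneg: "L2_norm M f \<ge> 0"
  by (simp add: L2_norm_def L2_inner_self_nonneg)

lemma L2_norm_power2: "(L2_norm M f)\<^sup>2 = L2_inner M f f"
  by (simp add: L2_norm_def L2_inner_self_nonneg)

lemma (in finite_measure) bounded_L2:
  assumes f: "f \<in> borel_measurable M" and B: "\<And>x. x \<in> space M \<Longrightarrow> \<bar>f x\<bar> \<le> B"
  shows "f \<in> L2 M"
proof -
  have "integrable M (\<lambda>x. (f x)\<^sup>2)"
  proof (rule integrable_const_bound[where B = "B\<^sup>2"])
    show "AE x in M. norm ((f x)\<^sup>2) \<le> B\<^sup>2"
    proof (rule AE_I2)
      fix x assume "x \<in> space M"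
      then have "\<bar>f x\<bar>\<^sup>2 \<le> B\<^sup>2" using B by (intro power_mono) auto
      then show "norm ((f x)\<^sup>2) \<le> B\<^sup>2" by simp
    qed
  qed (use f in simp)
  then show ?thesis using f by (simp add: L2_def)
qed

lemma L2_inner_cong_AE:
  assumes "f \<in> borel_measurable M" "f' \<in> borel_measurable M"
    "g \<in> borel_measurable M" "g' \<in> borel_measurable M"
    "AE x in M. f x = f' x" "AE x in M. g x = g' x"
  shows "L2_inner M f g = L2_inner M f' g'"
  unfolding L2_inner_def
  by (rule integral_cong_AE) (use assms in \<open>auto elim!: eventually_elim2\<close>)

lemma L2_inner_add_scaled:
  assumes f: "f \<in> L2 M" and g: "g \<in> L2 M"
  shows "L2_inner M (\<lambda>x. f x + t * g x) (\<lambda>x. f x + t * g x)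
    = L2_inner M f f + 2 * t * L2_inner M f g + t\<^sup>2 * L2_inner M g g"
proof -
  note tg = L2_cmult[OF g, of t]
  have *: "L2_inner M (\<lambda>x. f x + t * g x) h = L2_inner M f h + t * L2_inner M g h" if "h \<in> L2 M" for h
    using L2_inner_add[OF f tg that] L2_inner_cmult[of M t g h] by simp
  have "L2_inner M (\<lambda>x. f x + t * g x) (\<lambda>x. f x + t * g x)
      = L2_inner M (\<lambda>x. f x + t * g x) f + t * L2_inner M (\<lambda>x. f x + t * g x) g"
    using *[OF L2_add[OF f tg]] by (simp only: L2_inner_commute[of M f] L2_inner_commute[of M g "\<lambda>x. f x + t * g x"])
  also have "L2_inner M (\<lambda>x. f x + t * g x) f = L2_inner M f f + t * L2_inner M f g"
    using *[OF f] by (simp only: L2_inner_commute[of M g f])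
  also have "L2_inner M (\<lambda>x. f x + t * g x) g = L2_inner M f g + t * L2_inner M g g"
    by (rule *[OF g])
  finally show ?thesis by (simp add: algebra_simps power2_eq_square)
qed

lemma L2_Cauchy_Schwarz:
  assumes f: "f \<in> L2 M" and g: "g \<in> L2 M"
  shows "\<bar>L2_inner M f g\<bar> \<le> L2_norm M f * L2_norm M g"
proof -
  have "(L2_inner M f g)\<^sup>2 \<le> L2_inner M f f * L2_inner M g g"
    by (rule quadratic_nonneg_imp_discriminant)
      (simp_all add: L2_inner_add_scaled[OF f g, symmetric] L2_inner_self_nonneg)
  then have "(L2_inner M f g)\<^sup>2 \<le> (L2_norm M f * L2_norm M g)\<^sup>2"
    by (simp add: power_mult_distrib L2_norm_power2)
  then show ?thesis
    by (rule abs_le_square_iff[THEN iffD2, THEN order_trans]) (simp add: L2_norm_nonneg)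
qed

lemma L2_norm_triangle:
  assumes f: "f \<in> L2 M" and g: "g \<in> L2 M"
  shows "L2_norm M (\<lambda>x. f x + g x) \<le> L2_norm M f + L2_norm M g"
proof (rule power2_le_imp_le)
  have "(L2_norm M (\<lambda>x. f x + g x))\<^sup>2 = L2_inner M f f + 2 * L2_inner M f g + L2_inner M g g"
    using L2_inner_add_scaled[OF f g, of 1] by (simp add: L2_norm_power2)
  also have "\<dots> \<le> L2_inner M f f + 2 * (L2_norm M f * L2_norm M g) + L2_inner M g g"
    using L2_Cauchy_Schwarz[OF f g] by simp
  also have "\<dots> = (L2_norm M f + L2_norm M g)\<^sup>2"
    by (simp add: power2_sum L2_norm_power2)
  finally show "(L2_norm M (\<lambda>x. f x + g x))\<^sup>2 \<le> (L2_norm M f + L2_norm M g)\<^sup>2" .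
qed (simp add: L2_norm_nonneg)

lemma L2_norm_triangle_diff:
  assumes "f \<in> L2 M" "g \<in> L2 M" "h \<in> L2 M"
  shows "L2_norm M (\<lambda>x. f x - h x) \<le> L2_norm M (\<lambda>x. f x - g x) + L2_norm M (\<lambda>x. g x - h x)"
  using L2_norm_triangle[OF L2_diff[OF assms(1,2)] L2_diff[OF assms(2,3)]] by simp

lemma L2_norm_minus_commute: "L2_norm M (\<lambda>x. f x - g x) = L2_norm M (\<lambda>x. g x - f x)"
  by (simp add: L2_norm_def L2_inner_def power2_eq_square[symmetric] power2_commute)

lemma L2_inner_self_eq_0:
  assumes "f \<in> L2 M" "L2_inner M f f = 0" shows "AE x in M. f x = 0"
  using assms integral_nonneg_eq_0_iff_AE[OF L2_sq_integrable[OF assms(1)]]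
  by (simp add: L2_inner_def power2_eq_square)

lemma L2_inner_tendsto:
  assumes f: "\<And>n. f n \<in> L2 M" "g \<in> L2 M" and h: "h \<in> L2 M"
    and lim: "(\<lambda>n. L2_norm M (\<lambda>x. f n x - g x)) \<longlonglongrightarrow> 0"
  shows "(\<lambda>n. L2_inner M (f n) h) \<longlonglongrightarrow> L2_inner M g h"
proof -
  have "(\<lambda>n. L2_inner M (f n) h - L2_inner M g h) \<longlonglongrightarrow> 0"
  proof (rule Lim_null_comparison)
    show "\<forall>\<^sub>F n in sequentially. norm (L2_inner M (f n) h - L2_inner M g h)
        \<le> L2_norm M (\<lambda>x. f n x - g x) * L2_norm M h"
      using L2_Cauchy_Schwarz[OF L2_diff[OF f] h] L2_inner_diff[OF f h] by simp
    show "(\<lambda>n. L2_norm M (\<lambda>x. f n x - g x) * L2_norm M h) \<longlonglongrightarrow> 0"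
      using tendsto_mult_right[OF lim, of "L2_norm M h"] by simp
  qed
  then show ?thesis using LIM_zero_iff by blast
qed

text \<open>On a finite measure space \<open>L\<^sup>2\<close> norms control \<open>L\<^sup>1\<close> norms. Along a subsequence whose
  successive differences have norms below \<open>2\<^sup>-\<^sup>k\<close> the functions therefore converge almost
  everywhere, and Fatou's lemma turns the pointwise limit into a limit in \<open>L\<^sup>2\<close>.\<close>

lemma (in finite_measure) L2_complete:
  assumes f: "\<And>n. f n \<in> L2 M"
    and cauchy: "\<And>e. e > 0 \<Longrightarrow> \<exists>N. \<forall>m\<ge>N. \<forall>n\<ge>N. L2_norm M (\<lambda>x. f m x - f n x) < e"
  shows "\<exists>g\<in>L2 M. (\<lambda>n. L2_norm M (\<lambda>x. f n x - g x)) \<longlonglongrightarrow> 0"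
proof -
  note [measurable] = L2_measurable[OF f]
  obtain N where N: "\<And>k m n. m \<ge> N k \<Longrightarrow> n \<ge> N k \<Longrightarrow> L2_norm M (\<lambda>x. f m x - f n x) < (1/2)^k"
    using cauchy[of "(1/2)^_"] by (metis half_gt_zero zero_less_one zero_less_power)
  \<comment> \<open>The summand \<open>k\<close> keeps the subsequence cofinal even if \<open>N\<close> is bounded.\<close>
  define r where "r k = k + (\<Sum>j\<le>k. N j)" for k
  have rN: "r k \<ge> N k" for k unfolding r_def by (rule trans_le_add2, rule member_le_sum) auto
  have rk: "r k \<ge> k" for k unfolding r_def by simp
  have r_mono: "r k \<le> r (Suc k)" for k unfolding r_def by simp
  define d where "d k x = f (r (Suc k)) x - f (r k) x" for k x
  have d2: "d k \<in> L2 M" for k unfolding d_def[abs_def] by (rule L2_diff[OF f f])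
  note [measurable] = L2_measurable[OF d2]
  have one: "(\<lambda>x. 1) \<in> L2 M" by (simp add: L2_def)
  have dabs: "(\<lambda>x. \<bar>d k x\<bar>) \<in> L2 M" for k using d2[of k] by (simp add: L2_def)
  have dint: "integrable M (\<lambda>x. \<bar>d k x\<bar>)" for k
    using L2_mult_integrable[OF dabs one] by simp
  have dbound: "(\<integral>x. \<bar>d k x\<bar> \<partial>M) \<le> (1/2)^k * L2_norm M (\<lambda>x. 1)" for k
  proof -
    have "(\<integral>x. \<bar>d k x\<bar> \<partial>M) \<le> L2_norm M (\<lambda>x. \<bar>d k x\<bar>) * L2_norm M (\<lambda>x. 1)"
      using L2_Cauchy_Schwarz[OF dabs[of k] one] by (simp add: L2_inner_def)
    also have "L2_norm M (\<lambda>x. \<bar>d k x\<bar>) = L2_norm M (d k)"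
      by (simp add: L2_norm_def L2_inner_def)
    also have "\<dots> \<le> (1/2)^k"
      using N[of k "r (Suc k)" "r k"] rN[of k] r_mono[of k] by (simp add: d_def[abs_def])
    finally show ?thesis by (simp add: mult_right_mono L2_norm_nonneg)
  qed
  have sumfin: "(\<Sum>k. \<integral>\<^sup>+x. ennreal \<bar>d k x\<bar> \<partial>M) \<noteq> top"
  proof -
    have "(\<Sum>k. \<integral>\<^sup>+x. ennreal \<bar>d k x\<bar> \<partial>M) \<le> (\<Sum>k. ennreal ((1/2)^k * L2_norm M (\<lambda>x. 1)))"
      by (intro suminf_le) (auto simp: nn_integral_eq_integral[OF dint] intro!: ennreal_leI dbound)
    also have "\<dots> = ennreal (\<Sum>k. (1/2)^k * L2_norm M (\<lambda>x. 1))"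
      by (intro suminf_ennreal2) (auto simp: L2_norm_nonneg intro!: summable_mult2 summable_geometric)
    finally show ?thesis by (metis ennreal_less_top leD top.not_eq_extremum)
  qed
  have "AE x in M. (\<Sum>k. ennreal \<bar>d k x\<bar>) \<noteq> \<infinity>"
    by (rule nn_integral_PInf_AE) (use sumfin in \<open>auto simp: nn_integral_suminf\<close>)
  then have conv: "AE x in M. convergent (\<lambda>k. f (r k) x)"
  proof eventually_elim
    case (elim x)
    then have "summable (\<lambda>k. \<bar>d k x\<bar>)" by (intro summable_suminf_not_top) auto
    then have "summable (\<lambda>k. d k x)" by (rule summable_rabs_cancel)
    then have "convergent (\<lambda>n. \<Sum>k<n. d k x)" by (simp add: summable_iff_convergent)
    moreover have "(\<Sum>k<n. d k x) = f (r n) x - f (r 0) x" for n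
      unfolding d_def using sum_lessThan_telescope[of "\<lambda>k. f (r k) x" n] by simp
    ultimately show ?case by (simp add: convergent_diff_const_right_iff)
  qed
  define g where "g x = lim (\<lambda>k. f (r k) x)" for x
  have [measurable]: "g \<in> borel_measurable M" unfolding g_def[abs_def] by measurable
  have main: "(\<lambda>x. f m x - g x) \<in> L2 M \<and> L2_norm M (\<lambda>x. f m x - g x) \<le> e"
    if e: "e > 0" and K: "\<forall>m\<ge>K. \<forall>n\<ge>K. L2_norm M (\<lambda>x. f m x - f n x) < e" and m: "m \<ge> K" for e K m
  proof -
    note [measurable] = L2_measurable[OF L2_diff[OF f[of m] f]]
    have "(\<integral>\<^sup>+x. ennreal ((f m x - g x)\<^sup>2) \<partial>M)
        = (\<integral>\<^sup>+x. liminf (\<lambda>k. ennreal ((f m x - f (r k) x)\<^sup>2)) \<partial>M)"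
    proof (rule nn_integral_cong_AE, use conv in eventually_elim)
      case (elim x)
      then have "(\<lambda>k. ennreal ((f m x - f (r k) x)\<^sup>2)) \<longlonglongrightarrow> ennreal ((f m x - g x)\<^sup>2)"
        unfolding g_def by (intro tendsto_ennrealI tendsto_intros) (simp add: convergent_LIMSEQ_iff)
      then show ?case using lim_imp_Liminf[OF sequentially_bot] by metis
    qed
    also have "\<dots> \<le> liminf (\<lambda>k. \<integral>\<^sup>+x. ennreal ((f m x - f (r k) x)\<^sup>2) \<partial>M)"
      by (rule nn_integral_liminf) measurable
    also have "\<dots> \<le> liminf (\<lambda>k::nat. ennreal (e\<^sup>2))"
    proof (rule Liminf_mono, rule eventually_sequentiallyI)
      fix k assume "K \<le> k"
      have "(\<integral>\<^sup>+x. ennreal ((f m x - f (r k) x)\<^sup>2) \<partial>M)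
          = ennreal ((L2_norm M (\<lambda>x. f m x - f (r k) x))\<^sup>2)"
        by (simp add: nn_integral_eq_integral[OF L2_sq_integrable[OF L2_diff[OF f f]]]
            L2_norm_power2 L2_inner_def power2_eq_square[symmetric])
      also have "\<dots> \<le> ennreal (e\<^sup>2)"
        using K m rk[of k] \<open>K \<le> k\<close>
        by (intro ennreal_leI power_mono L2_norm_nonneg) (simp add: less_imp_le)
      finally show "(\<integral>\<^sup>+x. ennreal ((f m x - f (r k) x)\<^sup>2) \<partial>M) \<le> ennreal (e\<^sup>2)" .
    qed
    also have "\<dots> = ennreal (e\<^sup>2)" by (simp add: Liminf_const)
    finally have le: "(\<integral>\<^sup>+x. ennreal ((f m x - g x)\<^sup>2) \<partial>M) \<le> ennreal (e\<^sup>2)" .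
    then have int: "integrable M (\<lambda>x. (f m x - g x)\<^sup>2)"
      by (intro integrableI_bounded) (auto intro: le_less_trans)
    then have "ennreal (\<integral>x. (f m x - g x)\<^sup>2 \<partial>M) \<le> ennreal (e\<^sup>2)"
      using le by (simp add: nn_integral_eq_integral[OF int])
    then have "(L2_norm M (\<lambda>x. f m x - g x))\<^sup>2 \<le> e\<^sup>2"
      by (simp add: L2_norm_power2 L2_inner_def power2_eq_square[symmetric] ennreal_le_iff)
    then have "L2_norm M (\<lambda>x. f m x - g x) \<le> e"
      by (rule power2_le_imp_le) (use e in simp)
    then show ?thesis using int by (simp add: L2_def)
  qed
  have "g \<in> L2 M"
  proof -
    obtain K where "\<forall>m\<ge>K. \<forall>n\<ge>K. L2_norm M (\<lambda>x. f m x - f n x) < 1" using cauchy[of 1] by auto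
    then have "(\<lambda>x. f K x - g x) \<in> L2 M" using main[of 1 K K] by simp
    from L2_diff[OF f[of K] this] show ?thesis by simp
  qed
  moreover have "(\<lambda>n. L2_norm M (\<lambda>x. f n x - g x)) \<longlonglongrightarrow> 0"
  proof (rule LIMSEQ_I)
    fix e :: real assume "e > 0"
    then obtain K where "\<forall>m\<ge>K. \<forall>n\<ge>K. L2_norm M (\<lambda>x. f m x - f n x) < e / 2"
      using cauchy[of "e / 2"] by auto
    then have "L2_norm M (\<lambda>x. f n x - g x) \<le> e / 2" if "n \<ge> K" for n
      using main[of "e / 2" K n] that \<open>e > 0\<close> by simp
    then have "norm (L2_norm M (\<lambda>x. f n x - g x) - 0) < e" if "n \<ge> K" for n
      using that \<open>e > 0\<close> L2_norm_nonneg[of M "\<lambda>x. f n x - g x"] by fastforce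
    then show "\<exists>no. \<forall>n\<ge>no. norm (L2_norm M (\<lambda>x. f n x - g x) - 0) < e" by blast
  qed
  ultimately show ?thesis by blast
qed

text \<open>For every \<open>\<lambda> > 0\<close> the
  product \<open>|Z f|\<close> is at most \<open>|Z| min(|f|, \<lambda> |Z|) + f\<^sup>2 / \<lambda>\<close>: the first term is dominated by
  \<open>\<lambda> Z\<^sup>2\<close> and the second is uniformly small in the mean for large \<open>\<lambda>\<close>.\<close>

lemma L2_bounded_pointwise_imp_weak:
  assumes f: "\<And>n. f n \<in> L2 M" and Z: "Z \<in> L2 M"
    and bd: "\<And>n. L2_inner M (f n) (f n) \<le> C"
    and lim: "\<And>x. x \<in> space M \<Longrightarrow> (\<lambda>n. f n x) \<longlonglongrightarrow> 0"
  shows "(\<lambda>n. L2_inner M Z (f n)) \<longlonglongrightarrow> 0"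
proof (rule LIMSEQ_I)
  fix e :: real assume e: "e > 0"
  note [measurable] = L2_measurable[OF f] L2_measurable[OF Z]
  have C: "C \<ge> 0" using bd[of 0] L2_inner_self_nonneg order_trans by blast
  \<comment> \<open>The threshold \<open>\<lambda>\<close>, chosen so that \<open>C / \<lambda> < e / 2\<close>.\<close>
  define l where "l = 2 * (C + 1) / e"
  have l: "l > 0" using C e by (simp add: l_def)
  define s where "s n x = \<bar>Z x\<bar> * min \<bar>f n x\<bar> (l * \<bar>Z x\<bar>)" for n x
  have [measurable]: "s n \<in> borel_measurable M" for n unfolding s_def[abs_def] by measurable
  have dom: "integrable M (\<lambda>x. l * (Z x)\<^sup>2)" using L2_sq_integrable[OF Z] by simp
  have sle: "norm (s n x) \<le> l * (Z x)\<^sup>2" for n x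
  proof -
    have "s n x \<le> \<bar>Z x\<bar> * (l * \<bar>Z x\<bar>)" unfolding s_def by (intro mult_left_mono) auto
    then show ?thesis using l by (simp add: s_def power2_eq_square algebra_simps)
  qed
  have sint: "integrable M (s n)" for n
    by (rule Bochner_Integration.integrable_bound[OF dom])
      (use l sle in \<open>auto simp: abs_mult\<close>)
  have "(\<lambda>n. \<integral>x. s n x \<partial>M) \<longlonglongrightarrow> (\<integral>x. 0 \<partial>M)"
  proof (rule integral_dominated_convergence[OF _ _ dom])
    show "AE x in M. (\<lambda>n. s n x) \<longlonglongrightarrow> 0"
    proof (rule AE_I2)
      fix x assume "x \<in> space M"
      then have "(\<lambda>n. \<bar>f n x\<bar>) \<longlonglongrightarrow> 0" using lim tendsto_rabs_zero by blast
      then have "(\<lambda>n. min \<bar>f n x\<bar> (l * \<bar>Z x\<bar>)) \<longlonglongrightarrow> min 0 (l * \<bar>Z x\<bar>)"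
        by (intro tendsto_min tendsto_const)
      then have "(\<lambda>n. \<bar>Z x\<bar> * min \<bar>f n x\<bar> (l * \<bar>Z x\<bar>)) \<longlonglongrightarrow> \<bar>Z x\<bar> * min 0 (l * \<bar>Z x\<bar>)"
        by (intro tendsto_mult tendsto_const)
      then show "(\<lambda>n. s n x) \<longlonglongrightarrow> 0" using l by (simp add: s_def min_def)
    qed
  qed (use sle in auto)
  then obtain no where no: "\<And>n. n \<ge> no \<Longrightarrow> \<bar>\<integral>x. s n x \<partial>M\<bar> < e / 2"
    using LIMSEQ_D[of _ "0::real" "e / 2"] e by auto
  have "\<bar>L2_inner M Z (f n)\<bar> < e" if "n \<ge> no" for n
  proof -
    have pt: "\<bar>Z x * f n x\<bar> \<le> s n x + (1 / l) * (f n x * f n x)" for x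
    proof (cases "\<bar>f n x\<bar> \<le> l * \<bar>Z x\<bar>")
      case True
      then show ?thesis using l by (simp add: s_def abs_mult min_def)
    next
      case False
      then have "\<bar>Z x\<bar> \<le> (1 / l) * \<bar>f n x\<bar>" using l by (simp add: field_simps)
      then have "\<bar>Z x\<bar> * \<bar>f n x\<bar> \<le> (1 / l) * \<bar>f n x\<bar> * \<bar>f n x\<bar>" by (rule mult_right_mono) simp
      moreover have "s n x \<ge> 0" using l by (simp add: s_def)
      ultimately show ?thesis by (simp add: abs_mult mult.assoc)
    qed
    have "\<bar>L2_inner M Z (f n)\<bar> \<le> (\<integral>x. \<bar>Z x * f n x\<bar> \<partial>M)"
      unfolding L2_inner_def by (rule integral_abs_bound)
    also have "\<dots> \<le> (\<integral>x. s n x + (1 / l) * (f n x * f n x) \<partial>M)"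
      by (rule integral_mono) (use pt L2_mult_integrable[OF Z f] L2_mult_integrable[OF f f] sint in auto)
    also have "\<dots> = (\<integral>x. s n x \<partial>M) + (1 / l) * L2_inner M (f n) (f n)"
      using L2_mult_integrable[OF f f] sint by (simp add: L2_inner_def)
    also have "\<dots> \<le> (\<integral>x. s n x \<partial>M) + (1 / l) * C"
      using bd l by (simp add: mult_left_mono divide_right_mono)
    also have "(1 / l) * C < e / 2" using C e by (simp add: l_def field_simps)
    finally show ?thesis using no[OF that] by simp
  qed
  then show "\<exists>no. \<forall>n\<ge>no. norm (L2_inner M Z (f n) - 0) < e" by auto
qed

section \<open>Integrals with smooth kernels\<close>

lemma integrable_mult_bounded:
  fixes u f :: "'y \<Rightarrow> real"
  assumes u: "integrable M u" and f[measurable]: "f \<in> borel_measurable M"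
    and B: "\<And>y. y \<in> space M \<Longrightarrow> \<bar>f y\<bar> \<le> B"
  shows "integrable M (\<lambda>y. u y * f y)"
proof (rule Bochner_Integration.integrable_bound)
  show "integrable M (\<lambda>y. B * u y)" using u by simp
  have [measurable]: "u \<in> borel_measurable M" using u by simp
  show "(\<lambda>y. u y * f y) \<in> borel_measurable M" by measurable
  show "AE y in M. norm (u y * f y) \<le> norm (B * u y)"
  proof (rule AE_I2)
    fix y assume "y \<in> space M"
    then have "\<bar>f y\<bar> \<le> \<bar>B\<bar>" using B by fastforce
    then show "norm (u y * f y) \<le> norm (B * u y)"
      by (simp add: abs_mult mult.commute mult_right_mono)
  qed
qed

text \<open>The mean value inequality bounds the difference quotients of the kernel uniformly, so dominated
  convergence applies along every sequence of parameters tending to \<open>x0\<close>.\<close>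

lemma has_derivative_integral:
  fixes k :: "'p::real_normed_vector \<Rightarrow> 'y \<Rightarrow> real"
  assumes u: "integrable M u" and r: "0 < r"
    and D: "\<And>x y. x \<in> ball x0 r \<Longrightarrow> y \<in> space M \<Longrightarrow> ((\<lambda>x. k x y) has_derivative D x y) (at x)"
    and B: "\<And>x y h. x \<in> ball x0 r \<Longrightarrow> y \<in> space M \<Longrightarrow> \<bar>D x y h\<bar> \<le> B * norm h"
    and mk: "\<And>x. x \<in> ball x0 r \<Longrightarrow> k x \<in> borel_measurable M"
    and mD: "\<And>h. (\<lambda>y. D x0 y h) \<in> borel_measurable M"
    and C: "\<And>y. y \<in> space M \<Longrightarrow> \<bar>k x0 y\<bar> \<le> C"
  shows "((\<lambda>x. \<integral>y. u y * k x y \<partial>M) has_derivative (\<lambda>h. \<integral>y. u y * D x0 y h \<partial>M)) (at x0)"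
proof -
  have x0: "x0 \<in> ball x0 r" using r by simp
  have [measurable]: "u \<in> borel_measurable M" using u by simp
  note [measurable] = mD
  have B': "\<bar>D x y h\<bar> \<le> \<bar>B\<bar> * norm h" if "x \<in> ball x0 r" "y \<in> space M" for x y h
    using B[OF that] by (rule order_trans) (simp add: mult_right_mono)
  have lip: "\<bar>k x y - k x0 y\<bar> \<le> \<bar>B\<bar> * norm (x - x0)" if x: "x \<in> ball x0 r" and y: "y \<in> space M" for x y
  proof -
    have "norm (k x y - k x0 y) \<le> \<bar>B\<bar> * norm (x - x0)"
    proof (rule differentiable_bound[of "ball x0 r" "\<lambda>x. k x y" "\<lambda>x. D x y"])
      fix z assume z: "z \<in> ball x0 r"
      show "((\<lambda>x. k x y) has_derivative D z y) (at z within ball x0 r)"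
        using D[OF z y] has_derivative_at_withinI by blast
      show "onorm (D z y) \<le> \<bar>B\<bar>"
        by (rule onorm_bound) (use B'[OF z y] in auto)
    qed (use x x0 in auto)
    then show ?thesis by simp
  qed
  have intk: "integrable M (\<lambda>y. u y * k x y)" if x: "x \<in> ball x0 r" for x
  proof (rule integrable_mult_bounded[OF u mk[OF x]])
    fix y assume y: "y \<in> space M"
    show "\<bar>k x y\<bar> \<le> C + \<bar>B\<bar> * norm (x - x0)" using lip[OF x y] C[OF y] by linarith
  qed
  have intD: "integrable M (\<lambda>y. u y * D x0 y h)" for h
    by (rule integrable_mult_bounded[OF u mD]) (rule B'[OF x0])
  have lin: "linear (D x0 y)" if "y \<in> space M" for y
    using D[OF x0 that] has_derivative_linear by blast
  have "bounded_linear (\<lambda>h. \<integral>y. u y * D x0 y h \<partial>M)"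
  proof (rule bounded_linear_intro)
    fix h h' :: 'p
    have "(\<integral>y. u y * D x0 y (h + h') \<partial>M) = (\<integral>y. u y * D x0 y h + u y * D x0 y h' \<partial>M)"
      by (rule Bochner_Integration.integral_cong) (auto simp: linear_add[OF lin] distrib_left)
    then show "(\<integral>y. u y * D x0 y (h + h') \<partial>M) = (\<integral>y. u y * D x0 y h \<partial>M) + (\<integral>y. u y * D x0 y h' \<partial>M)"
      using intD by simp
  next
    fix c :: real and h :: 'p
    have "(\<integral>y. u y * D x0 y (c *\<^sub>R h) \<partial>M) = (\<integral>y. c * (u y * D x0 y h) \<partial>M)"
      by (rule Bochner_Integration.integral_cong) (auto simp: linear_cmul[OF lin])
    then show "(\<integral>y. u y * D x0 y (c *\<^sub>R h) \<partial>M) = c *\<^sub>R (\<integral>y. u y * D x0 y h \<partial>M)" by simp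
  next
    fix h :: 'p
    have "norm (\<integral>y. u y * D x0 y h \<partial>M) \<le> (\<integral>y. norm (u y * D x0 y h) \<partial>M)"
      by (rule integral_norm_bound)
    also have "\<dots> \<le> (\<integral>y. \<bar>u y\<bar> * (\<bar>B\<bar> * norm h) \<partial>M)"
      by (rule integral_mono)
        (use integrable_norm[OF intD] u B'[OF x0] in \<open>auto simp: abs_mult intro!: mult_left_mono\<close>)
    finally show "norm (\<integral>y. u y * D x0 y h \<partial>M) \<le> norm h * ((\<integral>y. \<bar>u y\<bar> \<partial>M) * \<bar>B\<bar>)"
      by (simp add: ac_simps)
  qed
  moreover have "((\<lambda>x. norm ((\<integral>y. u y * k x y \<partial>M) - (\<integral>y. u y * k x0 y \<partial>M)
      - (\<integral>y. u y * D x0 y (x - x0) \<partial>M)) / norm (x - x0)) \<longlongrightarrow> 0) (at x0)"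
    unfolding tendsto_at_iff_sequentially comp_def
  proof (intro allI impI)
    fix X :: "nat \<Rightarrow> 'p"
    assume X: "\<forall>i. X i \<in> UNIV - {x0}" and lim: "X \<longlonglongrightarrow> x0"
    have "\<forall>\<^sub>F n in sequentially. X n \<in> ball x0 r"
      using lim r by (simp add: tendsto_iff dist_commute)
    then obtain N where N: "\<And>n. n \<ge> N \<Longrightarrow> X n \<in> ball x0 r"
      unfolding eventually_sequentially by blast
    define Y where "Y n = X (n + N)" for n
    have Yb: "Y n \<in> ball x0 r" and Yn: "Y n \<noteq> x0" for n using N X by (auto simp: Y_def)
    have Ylim: "Y \<longlonglongrightarrow> x0" unfolding Y_def[abs_def] using LIMSEQ_ignore_initial_segment[OF lim] .
    define q where "q n y = (k (Y n) y - k x0 y - D x0 y (Y n - x0)) / norm (Y n - x0)" for n y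
    have [measurable]: "q n \<in> borel_measurable M" for n
      unfolding q_def[abs_def] using mk[OF Yb[of n]] mk[OF x0] by measurable
    have qb: "\<bar>q n y\<bar> \<le> 2 * \<bar>B\<bar>" if y: "y \<in> space M" for n y
    proof -
      have "\<bar>k (Y n) y - k x0 y - D x0 y (Y n - x0)\<bar> \<le> 2 * \<bar>B\<bar> * norm (Y n - x0)"
        using lip[OF Yb y, of n] B'[OF x0 y, of "Y n - x0"] by linarith
      then show ?thesis using Yn[of n] by (simp add: q_def field_simps abs_divide)
    qed
    have q0: "(\<lambda>n. q n y) \<longlonglongrightarrow> 0" if y: "y \<in> space M" for y
    proof -
      have "((\<lambda>x. norm (k x y - k x0 y - D x0 y (x - x0)) / norm (x - x0)) \<longlongrightarrow> 0) (at x0)"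
        using D[OF x0 y] unfolding has_derivative_iff_norm by blast
      then have "(\<lambda>n. norm (k (Y n) y - k x0 y - D x0 y (Y n - x0)) / norm (Y n - x0)) \<longlonglongrightarrow> 0"
        unfolding tendsto_at_iff_sequentially comp_def using Yn Ylim by simp
      then have "(\<lambda>n. norm (q n y)) \<longlonglongrightarrow> 0" by (simp add: q_def)
      then show ?thesis using tendsto_norm_zero_iff by blast
    qed
    have "(\<lambda>n. \<integral>y. u y * q n y \<partial>M) \<longlonglongrightarrow> (\<integral>y. 0 \<partial>M)"
    proof (rule integral_dominated_convergence[where w = "\<lambda>y. \<bar>u y\<bar> * (2 * \<bar>B\<bar>)"])
      show "AE y in M. (\<lambda>n. u y * q n y) \<longlonglongrightarrow> 0"
        by (rule AE_I2) (use q0 tendsto_mult_right_zero in blast)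
      show "AE y in M. norm (u y * q n y) \<le> \<bar>u y\<bar> * (2 * \<bar>B\<bar>)" for n
        by (rule AE_I2) (use qb in \<open>auto simp: abs_mult intro!: mult_left_mono\<close>)
    qed (use u in auto)
    moreover have "(\<integral>y. u y * q n y \<partial>M) = ((\<integral>y. u y * k (Y n) y \<partial>M) - (\<integral>y. u y * k x0 y \<partial>M)
      - (\<integral>y. u y * D x0 y (Y n - x0) \<partial>M)) / norm (Y n - x0)" for n
    proof -
      have "(\<integral>y. u y * q n y \<partial>M)
          = (\<integral>y. (u y * k (Y n) y - u y * k x0 y - u y * D x0 y (Y n - x0)) / norm (Y n - x0) \<partial>M)"
        by (rule Bochner_Integration.integral_cong) (auto simp: q_def right_diff_distrib)
      also have "\<dots> = ((\<integral>y. u y * k (Y n) y \<partial>M) - (\<integral>y. u y * k x0 y \<partial>M)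
          - (\<integral>y. u y * D x0 y (Y n - x0) \<partial>M)) / norm (Y n - x0)"
        using intk[OF Yb] intk[OF x0] intD by simp
      finally show ?thesis .
    qed
    ultimately have "(\<lambda>n. norm (((\<integral>y. u y * k (Y n) y \<partial>M) - (\<integral>y. u y * k x0 y \<partial>M)
      - (\<integral>y. u y * D x0 y (Y n - x0) \<partial>M)) / norm (Y n - x0))) \<longlonglongrightarrow> 0"
      using tendsto_norm_zero by fastforce
    then have "(\<lambda>n. norm ((\<integral>y. u y * k (X (n + N)) y \<partial>M) - (\<integral>y. u y * k x0 y \<partial>M)
      - (\<integral>y. u y * D x0 y (X (n + N) - x0) \<partial>M)) / norm (X (n + N) - x0)) \<longlonglongrightarrow> 0"
      by (simp add: Y_def)
    then show "(\<lambda>n. norm ((\<integral>y. u y * k (X n) y \<partial>M) - (\<integral>y. u y * k x0 y \<partial>M)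
      - (\<integral>y. u y * D x0 y (X n - x0) \<partial>M)) / norm (X n - x0)) \<longlonglongrightarrow> 0"
      by (rule LIMSEQ_offset)
  qed
  ultimately show ?thesis unfolding has_derivative_iff_norm by blast
qed

lemma compact_support_bounded:
  fixes f :: "'a::euclidean_space \<Rightarrow> real"
  assumes "continuous_on UNIV f" "compact K" "\<And>x. x \<notin> K \<Longrightarrow> f x = 0"
  obtains B where "B \<ge> 0" "\<And>x. \<bar>f x\<bar> \<le> B"
proof -
  have "compact (f ` K)" using assms compact_continuous_image continuous_on_subset by blast
  then have "bounded (f ` K)" by (rule compact_imp_bounded)
  then obtain B where B: "\<And>x. x \<in> K \<Longrightarrow> \<bar>f x\<bar> \<le> B" by (auto simp: bounded_iff)
  have "\<bar>f x\<bar> \<le> \<bar>B\<bar>" for x using B[of x] assms(3)[of x] by (cases "x \<in> K") auto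
  then show ?thesis using that[of "\<bar>B\<bar>"] by auto
qed

lemma compact_support_integrable:
  fixes f :: "'a::euclidean_space \<Rightarrow> real"
  assumes "continuous_on UNIV f" "compact K" "\<And>x. x \<notin> K \<Longrightarrow> f x = 0"
  shows "integrable lborel f"
proof -
  have "integrable lborel (\<lambda>x. indicator K x *\<^sub>R f x)"
    by (rule borel_integrable_compact[OF assms(2) continuous_on_subset[OF assms(1)]]) simp
  moreover have "(\<lambda>x. indicator K x *\<^sub>R f x) = f"
    by (rule ext) (use assms(3) in \<open>auto simp: indicator_def\<close>)
  ultimately show ?thesis by simp
qed

lemma integral_translate:
  fixes f :: "'a::euclidean_space \<Rightarrow> real"
  assumes [measurable]: "f \<in> borel_measurable borel"
  shows "(\<integral>x. f (x + c) \<partial>lborel) = (\<integral>x. f x \<partial>lborel)"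
proof -
  have "(\<integral>x. f x \<partial>lborel) = (\<integral>x. f x \<partial>distr lborel borel ((+) c))"
    by (simp add: lborel_distr_plus)
  also have "\<dots> = (\<integral>x. f (c + x) \<partial>lborel)" by (rule integral_distr) auto
  finally show ?thesis by (simp add: add.commute)
qed

lemma integral_reflect:
  fixes f :: "'a::euclidean_space \<Rightarrow> real"
  assumes [measurable]: "f \<in> borel_measurable borel"
  shows "(\<integral>x. f (c - x) \<partial>lborel) = (\<integral>x. f x \<partial>lborel)"
proof -
  have "(lborel :: 'a measure) = density (distr lborel borel (\<lambda>x. c + (-1) *\<^sub>R x)) (\<lambda>_. ennreal (\<bar>-1\<bar> ^ DIM('a)))"
    by (rule lborel_affine) simp
  then have "(lborel :: 'a measure) = density (distr lborel borel (\<lambda>x. c - x)) (\<lambda>_. 1)"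
    by simp
  then have e: "(lborel :: 'a measure) = distr lborel borel (\<lambda>x. c - x)"
    using density_1 by metis
  have "(\<integral>x. f x \<partial>lborel) = (\<integral>x. f x \<partial>distr lborel borel (\<lambda>x. c - x))"
    using e by simp
  also have "\<dots> = (\<integral>x. f (c - x) \<partial>lborel)" by (rule integral_distr) auto
  finally show ?thesis by simp
qed

lemma integral_scale:
  fixes f :: "'a::euclidean_space \<Rightarrow> real"
  assumes [measurable]: "f \<in> borel_measurable borel" and c: "c > 0"
  shows "(\<integral>x. f x \<partial>lborel) = c ^ DIM('a) * (\<integral>x. f (c *\<^sub>R x) \<partial>lborel)"
proof -
  have e: "(lborel :: 'a measure) = density (distr lborel borel (\<lambda>x. 0 + c *\<^sub>R x)) (\<lambda>_. ennreal (c ^ DIM('a)))"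
    using lborel_affine[of c 0] c by (simp add: ennreal_power)
  have "(\<integral>x. f x \<partial>lborel)
      = (\<integral>x. f x \<partial>density (distr lborel borel (\<lambda>x. 0 + c *\<^sub>R x)) (\<lambda>_. ennreal (c ^ DIM('a))))"
    using e by simp
  also have "\<dots> = (\<integral>x. c ^ DIM('a) * f x \<partial>distr lborel borel (\<lambda>x. 0 + c *\<^sub>R x))"
    using c by (subst integral_density) auto
  also have "\<dots> = (\<integral>x. c ^ DIM('a) * f (c *\<^sub>R x) \<partial>lborel)" by (subst integral_distr) auto
  finally show ?thesis by simp
qed

lemma Ck_on_1_D:
  assumes "Ck_on 1 UNIV f"
  shows "f differentiable (at x)" "i \<in> Basis \<Longrightarrow> continuous_on UNIV (partial i f)"
  using assms by auto

lemma Cinf_on_imp_Ck_on: "Cinf_on S f \<Longrightarrow> Ck_on k S f"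
  by (simp add: Cinf_on_def)

text \<open>The integral is the derivative at \<open>0\<close> of the integral of \<open>f\<close> translated by \<open>t i\<close>, which is
  constant in \<open>t\<close>.\<close>

lemma integral_partial_eq_0:
  fixes f :: "'a::euclidean_space \<Rightarrow> real"
  assumes f: "Ck_on 1 UNIV f" and K: "compact K" "\<And>x. x \<notin> K \<Longrightarrow> f x = 0" and i: "i \<in> Basis"
  shows "(\<integral>x. partial i f x \<partial>lborel) = 0"
proof -
  have df: "f differentiable (at x)" for x using Ck_on_1_D(1)[OF f] .
  have cf: "continuous_on UNIV f" using f Ck_on_continuous by blast
  have cp: "continuous_on UNIV (partial i f)" using Ck_on_1_D(2)[OF f i] .
  have [measurable]: "f \<in> borel_measurable borel" "partial i f \<in> borel_measurable borel"
    using cf cp borel_measurable_continuous_onI by auto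
  have p0: "partial i f x = 0" if "x \<notin> K" for x
    by (rule partial_zero_outside[OF compact_imp_closed[OF K(1)]]) (use K that in auto)
  obtain R where R: "\<And>x. x \<in> K \<Longrightarrow> norm x \<le> R"
    using compact_imp_bounded[OF K(1)] by (auto simp: bounded_iff)
  obtain B where B: "B \<ge> 0" "\<And>x. \<bar>partial i f x\<bar> \<le> B"
    using compact_support_bounded[OF cp K(1) p0] by blast
  have B2: "\<bar>h * partial i f x\<bar> \<le> B * \<bar>h\<bar>" for h x
    using mult_right_mono[OF B(2), of "\<bar>h\<bar>"] by (simp add: abs_mult mult.commute)
  obtain C where C: "C \<ge> 0" "\<And>x. \<bar>f x\<bar> \<le> C"
    using compact_support_bounded[OF cf K] by blast
  \<comment> \<open>For \<open>|t| < 1\<close> all translates by \<open>t i\<close> are supported in one ball, whose indicator serves as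
    the integrable weight.\<close>
  let ?u = "indicator (cball 0 (R + 1)) :: 'a \<Rightarrow> real"
  have "((\<lambda>t::real. \<integral>x. ?u x * f (x + t *\<^sub>R i) \<partial>lborel) has_derivative
      (\<lambda>h. \<integral>x. ?u x * (h * partial i f (x + 0 *\<^sub>R i)) \<partial>lborel)) (at 0)"
  proof (rule has_derivative_integral[where r = 1 and B = B and C = C
        and D = "\<lambda>t x h. h * partial i f (x + t *\<^sub>R i)"])
    show "integrable lborel ?u" using emeasure_bounded_finite[of "cball (0::'a) (R + 1)"] by (simp add: integrable_indicator_iff)
    fix t x
    have 1: "((\<lambda>t. x + t *\<^sub>R i) has_derivative (\<lambda>h. h *\<^sub>R i)) (at t)"
      by (auto intro!: derivative_eq_intros)
    have "linear (frechet_derivative f (at (x + t *\<^sub>R i)))"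
      using df[of "x + t *\<^sub>R i"] linear_frechet_derivative by blast
    then show "((\<lambda>t. f (x + t *\<^sub>R i)) has_derivative (\<lambda>h. h * partial i f (x + t *\<^sub>R i))) (at t)"
      using diff_chain_at[OF 1 df[unfolded frechet_derivative_works]]
      by (simp add: o_def partial_def linear_cmul)
  qed (use B2 C in auto)
  moreover have "(\<lambda>h. \<integral>x. ?u x * (h * partial i f (x + 0 *\<^sub>R i)) \<partial>lborel)
      = (\<lambda>h. h * (\<integral>x. partial i f x \<partial>lborel))"
  proof
    fix h
    have "(\<integral>x. ?u x * (h * partial i f (x + 0 *\<^sub>R i)) \<partial>lborel) = (\<integral>x. h * partial i f x \<partial>lborel)"
      by (rule Bochner_Integration.integral_cong) (use p0 R in \<open>force simp: indicator_def\<close>)+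
    then show "(\<integral>x. ?u x * (h * partial i f (x + 0 *\<^sub>R i)) \<partial>lborel) = h * (\<integral>x. partial i f x \<partial>lborel)"
      by simp
  qed
  moreover have "(\<integral>x. ?u x * f (x + t *\<^sub>R i) \<partial>lborel) = (\<integral>x. f x \<partial>lborel)" if "t \<in> ball 0 1" for t :: real
  proof -
    have "(\<integral>x. ?u x * f (x + t *\<^sub>R i) \<partial>lborel) = (\<integral>x. f (x + t *\<^sub>R i) \<partial>lborel)"
    proof (rule Bochner_Integration.integral_cong)
      fix x
      show "?u x * f (x + t *\<^sub>R i) = f (x + t *\<^sub>R i)"
      proof (cases "x + t *\<^sub>R i \<in> K")
        case True
        have "norm x \<le> norm (x + t *\<^sub>R i) + norm (t *\<^sub>R i)"
          using norm_triangle_ineq4[of "x + t *\<^sub>R i" "t *\<^sub>R i"] by simp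
        also have "\<dots> \<le> R + 1" using R[OF True] that i by simp
        finally show ?thesis by (simp add: indicator_def)
      qed (use K in auto)
    qed simp
    then show ?thesis by (simp add: integral_translate)
  qed
  ultimately have "((\<lambda>t::real. \<integral>x. f x \<partial>lborel) has_derivative (\<lambda>h. h * (\<integral>x. partial i f x \<partial>lborel))) (at 0)"
    using has_derivative_transform_within_open[of "\<lambda>t::real. \<integral>x. ?u x * f (x + t *\<^sub>R i) \<partial>lborel" _ 0 UNIV "ball 0 1"]
    by simp
  moreover have "((\<lambda>t::real. \<integral>x. f x \<partial>lborel) has_derivative (\<lambda>h. 0)) (at 0)" by simp
  ultimately have "(\<lambda>h. h * (\<integral>x. partial i f x \<partial>lborel)) = (\<lambda>h. 0)" by (rule has_derivative_unique)
  from fun_cong[OF this, of 1] show ?thesis by simp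
qed

lemma integration_by_parts:
  fixes f g :: "'a::euclidean_space \<Rightarrow> real"
  assumes f: "Ck_on 1 UNIV f" and g: "Ck_on 1 UNIV g" and K: "compact K" "\<And>x. x \<notin> K \<Longrightarrow> g x = 0"
    and i: "i \<in> Basis"
  shows "(\<integral>x. f x * partial i g x \<partial>lborel) = - (\<integral>x. partial i f x * g x \<partial>lborel)"
proof -
  have p0: "partial i g x = 0" if "x \<notin> K" for x
    by (rule partial_zero_outside[OF compact_imp_closed[OF K(1)]]) (use K that in auto)
  note c = Ck_on_continuous[OF f] Ck_on_continuous[OF g] Ck_on_1_D(2)[OF f i] Ck_on_1_D(2)[OF g i]
  have int: "integrable lborel (\<lambda>x. f x * partial i g x)" "integrable lborel (\<lambda>x. partial i f x * g x)"
    by (rule compact_support_integrable[OF _ K(1)]; use c p0 K in \<open>auto intro!: continuous_intros\<close>)+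
  have "partial i (\<lambda>x. f x * g x) = (\<lambda>x. f x * partial i g x + partial i f x * g x)"
    using partial_mult[OF Ck_on_1_D(1)[OF f] Ck_on_1_D(1)[OF g]] by blast
  moreover have "(\<integral>x. partial i (\<lambda>x. f x * g x) x \<partial>lborel) = 0"
    by (rule integral_partial_eq_0[OF _ K(1) _ i]) (use K Ck_on_mult[OF open_UNIV f g] in auto)
  ultimately show ?thesis using int by simp
qed


lemma Green_identity:
  fixes f g :: "'a::euclidean_space \<Rightarrow> real"
  assumes f: "Ck_on 2 UNIV f" and g: "Ck_on 2 UNIV g"
    and K: "compact K" "\<And>x. x \<notin> K \<Longrightarrow> g x = 0"
  shows "(\<integral>x. f x * laplacian g x \<partial>lborel) = (\<integral>x. laplacian f x * g x \<partial>lborel)"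
proof -
  have 1: "Ck_on 1 UNIV f" "Ck_on 1 UNIV g"
    by (rule Ck_on_mono[OF f], simp) (rule Ck_on_mono[OF g], simp)
  have 2: "Ck_on 1 UNIV (partial i f)" "Ck_on 1 UNIV (partial i g)" if "i \<in> Basis" for i
    using f g that unfolding numeral_2_eq_2 One_nat_def by (auto simp only: Ck_on.simps(2))
  have c: "continuous_on UNIV f" "continuous_on UNIV g"
    using Ck_on_continuous f g by blast+
  have c2: "continuous_on UNIV (partial i (partial i f))" "continuous_on UNIV (partial i (partial i g))"
    if "i \<in> Basis" for i
    using Ck_on_1_D(2)[OF 2(1)] Ck_on_1_D(2)[OF 2(2)] that by auto
  have p0: "partial i g x = 0" if "x \<notin> K" for x i
    by (rule partial_zero_outside[OF compact_imp_closed[OF K(1)]]) (use K that in auto)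
  have p1: "partial i (partial i g) x = 0" if "x \<notin> K" for x i
    by (rule partial_zero_outside[OF compact_imp_closed[OF K(1)]]) (use p0 that in auto)
  have int: "integrable lborel (\<lambda>x. f x * partial i (partial i g) x)"
    "integrable lborel (\<lambda>x. partial i (partial i f) x * g x)" if "i \<in> Basis" for i
    by (rule compact_support_integrable[OF _ K(1)];
        use c c2 p1 K that in \<open>auto intro!: continuous_intros\<close>)+
  have eq: "(\<integral>x. f x * partial i (partial i g) x \<partial>lborel) = (\<integral>x. partial i (partial i f) x * g x \<partial>lborel)"
    if i: "i \<in> Basis" for i
    using integration_by_parts[OF 1(1) 2(2)[OF i] K(1) p0 i]
      integration_by_parts[OF 2(1)[OF i] 1(2) K i] by simp
  have "(\<integral>x. f x * laplacian g x \<partial>lborel) = (\<Sum>i\<in>Basis. \<integral>x. f x * partial i (partial i g) x \<partial>lborel)"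
    unfolding laplacian_def sum_distrib_left using int by (intro Bochner_Integration.integral_sum) auto
  also have "\<dots> = (\<Sum>i\<in>Basis. \<integral>x. partial i (partial i f) x * g x \<partial>lborel)"
    using eq by simp
  also have "\<dots> = (\<integral>x. laplacian f x * g x \<partial>lborel)"
    unfolding laplacian_def sum_distrib_right
    using int by (intro Bochner_Integration.integral_sum[symmetric]) auto
  finally show ?thesis .
qed

definition conv :: "('a::euclidean_space \<Rightarrow> real) \<Rightarrow> ('a \<Rightarrow> real) \<Rightarrow> 'a \<Rightarrow> real" where
  "conv u \<kappa> x = (\<integral>y. u y * \<kappa> (x - y) \<partial>lborel)"

lemma Cc_inf_bounded:
  assumes "\<kappa> \<in> Cc_inf \<Omega>" obtains B where "B \<ge> 0" "\<And>x. \<bar>\<kappa> x\<bar> \<le> B"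
  using Cc_inf_support[OF assms] compact_support_bounded[OF Cinf_on_continuous[OF Cc_inf_Cinf[OF assms]]]
  by metis

lemma Cc_inf_borel[measurable_dest]: "\<kappa> \<in> Cc_inf \<Omega> \<Longrightarrow> \<kappa> \<in> borel_measurable borel"
  by (intro borel_measurable_continuous_onI Cinf_on_continuous Cc_inf_Cinf)

lemma Cc_inf_integrable: "\<kappa> \<in> Cc_inf \<Omega> \<Longrightarrow> integrable lborel \<kappa>"
  using Cc_inf_support compact_support_integrable[OF Cinf_on_continuous[OF Cc_inf_Cinf]] by metis

lemma integrable_mult_Cc_inf:
  assumes u: "integrable lborel u" and k: "\<kappa> \<in> Cc_inf \<Omega>"
  shows "integrable lborel (\<lambda>y. u y * \<kappa> y)" "integrable lborel (\<lambda>y. u y * \<kappa> (x - y))"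
proof -
  obtain B where B: "\<And>x. \<bar>\<kappa> x\<bar> \<le> B" using Cc_inf_bounded[OF k] by blast
  note [measurable] = Cc_inf_borel[OF k]
  show "integrable lborel (\<lambda>y. u y * \<kappa> y)" "integrable lborel (\<lambda>y. u y * \<kappa> (x - y))"
    by (rule integrable_mult_bounded[OF u, where B = B]; use B in simp)+
qed

lemma conv_has_derivative:
  assumes u: "integrable lborel u" and k: "\<kappa> \<in> Cc_inf (UNIV :: 'a::euclidean_space set)"
  shows "(conv u \<kappa> has_derivative (\<lambda>h. \<Sum>i\<in>Basis. (h \<bullet> i) * conv u (partial i \<kappa>) x)) (at x)"
proof -
  note d = Cinf_on_differentiable[OF Cc_inf_Cinf[OF k]]
  have kp: "partial i \<kappa> \<in> Cc_inf UNIV" if "i \<in> Basis" for i using Cc_inf_partial[OF k that] .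
  have [measurable]: "\<kappa> \<in> borel_measurable borel" by (rule Cc_inf_borel[OF k])
  have [measurable]: "(\<lambda>y. partial i \<kappa> (x - y)) \<in> borel_measurable borel" if "i \<in> Basis" for i x
    using Cc_inf_borel[OF kp[OF that]] by simp
  have "\<exists>B\<ge>0. \<forall>x. \<bar>partial i \<kappa> x\<bar> \<le> B" if "i \<in> Basis" for i
    using Cc_inf_bounded[OF kp[OF that]] by metis
  then obtain B where B: "\<And>i x. i \<in> Basis \<Longrightarrow> B i \<ge> 0 \<and> \<bar>partial i \<kappa> x\<bar> \<le> B i" by metis
  obtain C where C: "\<And>x. \<bar>\<kappa> x\<bar> \<le> C" using Cc_inf_bounded[OF k] by blast
  have "((\<lambda>x. \<integral>y. u y * \<kappa> (x - y) \<partial>lborel) has_derivative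
      (\<lambda>h. \<integral>y. u y * (\<Sum>i\<in>Basis. (h \<bullet> i) * partial i \<kappa> (x - y)) \<partial>lborel)) (at x)"
  proof (rule has_derivative_integral[OF u zero_less_one,
        where B = "\<Sum>i\<in>Basis. B i" and C = C
        and D = "\<lambda>x y h. \<Sum>i\<in>Basis. (h \<bullet> i) * partial i \<kappa> (x - y)"])
    fix x y h :: 'a
    have 1: "((\<lambda>x. x - y) has_derivative (\<lambda>h. h)) (at x)"
      by (auto intro!: derivative_eq_intros)
    show "((\<lambda>x. \<kappa> (x - y)) has_derivative (\<lambda>h. \<Sum>i\<in>Basis. (h \<bullet> i) * partial i \<kappa> (x - y))) (at x)"
      using diff_chain_at[OF 1 has_derivative_partial[OF d]] by (simp add: o_def)
    have "\<bar>\<Sum>i\<in>Basis. (h \<bullet> i) * partial i \<kappa> (x - y)\<bar> \<le> (\<Sum>i\<in>Basis. \<bar>(h \<bullet> i) * partial i \<kappa> (x - y)\<bar>)"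
      by (rule sum_abs)
    also have "\<dots> \<le> (\<Sum>i\<in>Basis. norm h * B i)"
      by (rule sum_mono) (use B Basis_le_norm in \<open>auto simp: abs_mult intro!: mult_mono\<close>)
    finally show "\<bar>\<Sum>i\<in>Basis. (h \<bullet> i) * partial i \<kappa> (x - y)\<bar> \<le> (\<Sum>i\<in>Basis. B i) * norm h"
      by (simp add: sum_distrib_left mult.commute)
  qed (use C in auto)
  moreover have "(\<integral>y. u y * (\<Sum>i\<in>Basis. (h \<bullet> i) * partial i \<kappa> (x - y)) \<partial>lborel)
      = (\<Sum>i\<in>Basis. (h \<bullet> i) * conv u (partial i \<kappa>) x)" for h
  proof -
    have "(\<integral>y. u y * (\<Sum>i\<in>Basis. (h \<bullet> i) * partial i \<kappa> (x - y)) \<partial>lborel)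
        = (\<integral>y. (\<Sum>i\<in>Basis. (h \<bullet> i) * (u y * partial i \<kappa> (x - y))) \<partial>lborel)"
      by (simp add: sum_distrib_left mult.left_commute)
    also have "\<dots> = (\<Sum>i\<in>Basis. \<integral>y. (h \<bullet> i) * (u y * partial i \<kappa> (x - y)) \<partial>lborel)"
      by (rule Bochner_Integration.integral_sum)
        (use integrable_mult_Cc_inf(2)[OF u kp] in auto)
    finally show ?thesis by (simp add: conv_def)
  qed
  ultimately show ?thesis by (simp add: conv_def[abs_def])
qed

lemma partial_conv:
  assumes "integrable lborel u" "\<kappa> \<in> Cc_inf UNIV" "i \<in> Basis"
  shows "partial i (conv u \<kappa>) = conv u (partial i \<kappa>)"
  using partial_eqI[OF conv_has_derivative[OF assms(1,2)]] assms(3)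
  by (auto simp: inner_Basis if_distrib if_distribR cong: if_cong)

lemma Cinf_on_conv:
  assumes u: "integrable lborel u" and k: "\<kappa> \<in> Cc_inf UNIV"
  shows "Cinf_on UNIV (conv u \<kappa>)"
proof -
  have d: "conv u \<kappa> differentiable (at x)" if "\<kappa> \<in> Cc_inf UNIV" for \<kappa> x
    using conv_has_derivative[OF u that] unfolding differentiable_def by blast
  have "Ck_on n UNIV (conv u \<kappa>)" for n
    using k
  proof (induction n arbitrary: \<kappa>)
    case 0
    then show ?case
      using d by (auto intro!: continuous_at_imp_continuous_on differentiable_imp_continuous_within)
  next
    case (Suc n)
    have "Ck_on n UNIV (partial i (conv u \<kappa>))" if "i \<in> Basis" for i
      using Suc.IH[OF Cc_inf_partial[OF Suc.prems that]] partial_conv[OF u Suc.prems that] by simp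
    then show ?case using d[OF Suc.prems] by simp
  qed
  then show ?thesis by (simp add: Cinf_on_def)
qed

lemma laplacian_conv:
  assumes u: "integrable lborel u" and k: "\<kappa> \<in> Cc_inf UNIV"
  shows "laplacian (conv u \<kappa>) x = conv u (laplacian \<kappa>) x"
proof -
  have "laplacian (conv u \<kappa>) x = (\<Sum>i\<in>Basis. conv u (partial i (partial i \<kappa>)) x)"
    unfolding laplacian_def
    by (intro sum.cong) (auto simp: partial_conv[OF u] k Cc_inf_partial[OF k])
  also have "\<dots> = (\<integral>y. (\<Sum>i\<in>Basis. u y * partial i (partial i \<kappa>) (x - y)) \<partial>lborel)"
    unfolding conv_def
    by (rule Bochner_Integration.integral_sum[symmetric])
      (auto intro!: integrable_mult_Cc_inf(2)[OF u] Cc_inf_partial k)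
  finally show ?thesis by (simp add: conv_def laplacian_def sum_distrib_left)
qed

lemma integral_swap_kernel:
  fixes F G :: "'a::euclidean_space \<Rightarrow> real"
  assumes F: "integrable lborel F" and G: "integrable lborel G"
    and k[measurable]: "\<kappa> \<in> borel_measurable borel" and B: "\<And>x. \<bar>\<kappa> x\<bar> \<le> B"
  shows "(\<integral>x. F x * (\<integral>y. G y * \<kappa> (x - y) \<partial>lborel) \<partial>lborel)
    = (\<integral>y. G y * (\<integral>x. F x * \<kappa> (x - y) \<partial>lborel) \<partial>lborel)"
proof -
  have [measurable]: "F \<in> borel_measurable borel" "G \<in> borel_measurable borel" using F G by auto
  have FG: "integrable (lborel \<Otimes>\<^sub>M lborel) (\<lambda>p. F (fst p) * G (snd p))"
    by (rule lborel_pair.Fubini_integrable) (use F G in \<open>auto simp: abs_mult\<close>)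
  have m: "(\<lambda>p. \<kappa> (fst p - snd p)) \<in> borel_measurable (lborel \<Otimes>\<^sub>M lborel :: ('a \<times> 'a) measure)"
    by measurable
  have int: "integrable (lborel \<Otimes>\<^sub>M lborel) (\<lambda>p. (F (fst p) * G (snd p)) * \<kappa> (fst p - snd p))"
    by (rule integrable_mult_bounded[OF FG m]) (rule B)
  have "(\<integral>x. F x * (\<integral>y. G y * \<kappa> (x - y) \<partial>lborel) \<partial>lborel)
      = (\<integral>x. (\<integral>y. F x * G y * \<kappa> (x - y) \<partial>lborel) \<partial>lborel)"
    by (simp add: mult.assoc)
  also have "\<dots> = (\<integral>y. (\<integral>x. F x * G y * \<kappa> (x - y) \<partial>lborel) \<partial>lborel)"
    by (rule lborel_pair.Fubini_integral[symmetric]) (use int in \<open>simp add: case_prod_beta'\<close>)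
  also have "\<dots> = (\<integral>y. G y * (\<integral>x. F x * \<kappa> (x - y) \<partial>lborel) \<partial>lborel)"
    by (simp add: mult.assoc mult.left_commute[of _ "G _"])
  finally show ?thesis .
qed

section \<open>Mollifiers\<close>

definition bump_mass :: "'a::euclidean_space itself \<Rightarrow> real" where
  "bump_mass _ = (\<integral>z. radial (z::'a) \<partial>lborel)"

definition moll :: "real \<Rightarrow> 'a::euclidean_space \<Rightarrow> real" where
  "moll \<delta> z = radial ((1 / \<delta>) *\<^sub>R z) / (\<delta> ^ DIM('a) * bump_mass TYPE('a))"

lemma radial_Cc_inf: "radial \<in> Cc_inf UNIV"
  by (rule Cc_infI[OF Cinf_on_radial compact_cball[of 0 1]]) (auto simp: bump_radial_outside)

lemma bump_Cc_inf: "bump \<in> Cc_inf UNIV"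
  by (rule Cc_infI[OF Cinf_on_bump compact_cball[of 0 1]]) (auto simp: bump_radial_outside)

lemma bump_mass_pos: "bump_mass TYPE('a::euclidean_space) > 0"
proof -
  have int: "integrable lborel (radial :: 'a \<Rightarrow> real)" by (rule Cc_inf_integrable[OF radial_Cc_inf])
  have "bump_mass TYPE('a) \<noteq> 0"
  proof
    assume "bump_mass TYPE('a) = 0"
    then have "AE z in lborel. radial (z::'a) = 0"
      using integral_nonneg_eq_0_iff_AE[OF int] by (simp add: bump_mass_def radial_nonneg)
    then have "AE z in lborel. z \<notin> (ball 0 1 :: 'a set)"
      by eventually_elim (use radial_pos in force)
    then have "ball 0 1 \<in> null_sets (lborel :: 'a measure)" by (simp add: AE_iff_null_sets)
    then have "negligible (ball 0 1 :: 'a set)" 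
      using null_sets_completionI negligible_iff_null_sets by blast
    then show False using open_not_negligible[of "ball 0 1 :: 'a set"] by simp
  qed
  moreover have "bump_mass TYPE('a) \<ge> 0" by (simp add: bump_mass_def radial_nonneg)
  ultimately show ?thesis by simp
qed

lemma moll_nonneg: "\<delta> > 0 \<Longrightarrow> moll \<delta> (z::'a::euclidean_space) \<ge> 0"
  using bump_mass_pos[where 'a='a] by (simp add: moll_def radial_nonneg)

lemma moll_outside: "\<delta> > 0 \<Longrightarrow> norm z \<ge> \<delta> \<Longrightarrow> moll \<delta> z = 0"
  by (simp add: moll_def bump_radial_outside)

lemma moll_minus: "moll \<delta> (- z) = moll \<delta> z"
  by (simp add: moll_def radial_def)

lemma Cinf_on_moll: "Cinf_on UNIV (moll \<delta> :: 'a::euclidean_space \<Rightarrow> real)"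
proof -
  have "Cinf_on UNIV (\<lambda>z::'a. (1 / (\<delta> ^ DIM('a) * bump_mass TYPE('a))) * radial (0 + (1 / \<delta>) *\<^sub>R z))"
    by (intro Cinf_on_mult Cinf_on_const open_UNIV Cinf_on_affine[OF Cinf_on_radial])
  then show ?thesis by (simp add: moll_def[abs_def])
qed

lemma moll_Cc_inf: "\<delta> > 0 \<Longrightarrow> moll \<delta> \<in> Cc_inf UNIV"
  by (rule Cc_infI[OF Cinf_on_moll compact_cball[of 0 \<delta>]]) (auto simp: moll_outside)

lemma integral_moll:
  assumes "\<delta> > 0" shows "(\<integral>z. moll \<delta> (z::'a::euclidean_space) \<partial>lborel) = 1"
proof -
  have "(\<integral>z. moll \<delta> (z::'a) \<partial>lborel) = \<delta> ^ DIM('a) * (\<integral>z. moll \<delta> (\<delta> *\<^sub>R (z::'a)) \<partial>lborel)"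
    by (rule integral_scale[OF Cc_inf_borel[OF moll_Cc_inf] assms]) (rule assms)
  also have "(\<integral>z. moll \<delta> (\<delta> *\<^sub>R (z::'a)) \<partial>lborel) = bump_mass TYPE('a) / (\<delta> ^ DIM('a) * bump_mass TYPE('a))"
    using assms by (simp add: moll_def bump_mass_def)
  finally show ?thesis using assms bump_mass_pos[where 'a='a] by simp
qed

lemma integral_moll_shift:
  assumes "\<delta> > 0"
  shows "(\<integral>y. moll \<delta> (x - y) \<partial>lborel) = 1" "(\<integral>x. moll \<delta> (x - y) \<partial>lborel) = 1"
  using integral_reflect[OF Cc_inf_borel[OF moll_Cc_inf[OF assms]], of x]
    integral_translate[OF Cc_inf_borel[OF moll_Cc_inf[OF assms]], of "- y"] integral_moll[OF assms]
  by simp_all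

section \<open>Functions orthogonal to polynomials or to test functions\<close>

text \<open>By the theorem of Stone and Weierstrass \<open>g\<close> is orthogonal to all continuous functions, hence, by
  dominated convergence, to the indicators of closed sets. These generate the Borel sets and are
  closed under intersections.\<close>

lemma AE_zero_if_orthogonal_to_polynomials:
  fixes g :: "'a::euclidean_space \<Rightarrow> real"
  assumes M: "finite_measure M" "sets M = sets (restrict_space borel K)" and K: "compact K"
    and g: "integrable M g"
    and orth: "\<And>p. real_polynomial_function p \<Longrightarrow> (\<integral>x. g x * p x \<partial>M) = 0"
  shows "AE x in M. g x = 0"
proof -
  interpret finite_measure M by fact
  have sp: "space M = K"
    using sets_eq_imp_space_eq[OF M(2)] by (simp add: space_restrict_space)
  have meas: "f \<in> borel_measurable M" if "f \<in> borel_measurable borel" for f :: "'a \<Rightarrow> real"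
    using measurable_restrict_space1[OF that, of K] measurable_cong_sets[OF M(2) refl] by blast
  note [measurable] = borel_measurable_integrable[OF g]
  have cont: "(\<integral>x. g x * h x \<partial>M) = 0" if h: "continuous_on UNIV h" for h :: "'a \<Rightarrow> real"
  proof -
    have hm: "h \<in> borel_measurable M" using meas borel_measurable_continuous_onI[OF h] by blast
    have hK: "continuous_on K h" using h continuous_on_subset by blast
    then have "bounded (h ` K)" using compact_continuous_image K compact_imp_bounded by blast
    then obtain B where B: "\<And>x. x \<in> K \<Longrightarrow> \<bar>h x\<bar> \<le> B" by (auto simp: bounded_iff)
    have gh: "integrable M (\<lambda>x. g x * h x)"
      by (rule integrable_mult_bounded[OF g hm, of B]) (use B sp in auto)
    have "\<bar>\<integral>x. g x * h x \<partial>M\<bar> \<le> e * (\<integral>x. \<bar>g x\<bar> \<partial>M)" if e: "e > 0" for e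
    proof -
      obtain p where p: "real_polynomial_function p" "\<And>x. x \<in> K \<Longrightarrow> \<bar>h x - p x\<bar> < e"
        using Stone_Weierstrass_real_polynomial_function[OF K hK e] by blast
      have pm: "p \<in> borel_measurable M"
        using meas borel_measurable_continuous_onI[OF Cinf_on_continuous[OF Cinf_on_polynomial[OF p(1)]]]
        by blast
      have d: "integrable M (\<lambda>x. g x * (h x - p x))"
        by (rule integrable_mult_bounded[OF g, of _ e]) (use hm pm p(2) sp less_imp_le in auto)
      have "integrable M (\<lambda>x. g x * h x - g x * (h x - p x))" using gh d by simp
      then have gp: "integrable M (\<lambda>x. g x * p x)" by (simp add: algebra_simps)
      have "(\<integral>x. g x * h x \<partial>M) = (\<integral>x. g x * (h x - p x) + g x * p x \<partial>M)"
        by (simp add: algebra_simps)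
      also have "\<dots> = (\<integral>x. g x * (h x - p x) \<partial>M)" using d gp orth[OF p(1)] by simp
      finally have "\<bar>\<integral>x. g x * h x \<partial>M\<bar> = \<bar>\<integral>x. g x * (h x - p x) \<partial>M\<bar>" by simp
      also have "\<dots> \<le> (\<integral>x. \<bar>g x * (h x - p x)\<bar> \<partial>M)" by (rule integral_abs_bound)
      also have "\<dots> \<le> (\<integral>x. e * \<bar>g x\<bar> \<partial>M)"
      proof (rule integral_mono)
        show "integrable M (\<lambda>x. \<bar>g x * (h x - p x)\<bar>)" using d by (rule integrable_abs)
        show "integrable M (\<lambda>x. e * \<bar>g x\<bar>)" using g by simp
        fix x assume "x \<in> space M"
        then have "\<bar>h x - p x\<bar> \<le> e" using p(2) sp less_imp_le by blast
        then show "\<bar>g x * (h x - p x)\<bar> \<le> e * \<bar>g x\<bar>"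
          using mult_right_mono[of "\<bar>h x - p x\<bar>" e "\<bar>g x\<bar>"] by (simp add: abs_mult mult.commute)
      qed
      finally show ?thesis by simp
    qed
    then have "\<bar>\<integral>x. g x * h x \<partial>M\<bar> \<le> 0"
    proof -
      assume *: "\<And>e. e > 0 \<Longrightarrow> \<bar>\<integral>x. g x * h x \<partial>M\<bar> \<le> e * (\<integral>x. \<bar>g x\<bar> \<partial>M)"
      have I: "(\<integral>x. \<bar>g x\<bar> \<partial>M) \<ge> 0" by simp
      show ?thesis
      proof (rule field_le_epsilon)
        fix e :: real assume e: "e > 0"
        have bound: "e / (J + 1) * J \<le> e" if "J \<ge> 0" for J :: real
          using e that by (simp add: field_simps)
        have pos: "e / ((\<integral>x. \<bar>g x\<bar> \<partial>M) + 1) > 0"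
          using e I by (intro divide_pos_pos) linarith+
        show "\<bar>\<integral>x. g x * h x \<partial>M\<bar> \<le> 0 + e" using order_trans[OF *[OF pos] bound[OF I]] by simp
      qed
    qed
    then show ?thesis by simp
  qed
  have indm: "indicat_real B \<in> borel_measurable M" if "B \<in> sets borel" for B :: "'a set"
    using meas[of "indicator B"] that by simp
  have gind: "integrable M (\<lambda>x. g x * indicator B x)" if "B \<in> sets borel" for B
    by (rule integrable_mult_bounded[OF g indm[OF that], of 1]) (auto simp: indicator_def)
  have closed: "(\<integral>x. g x * indicator C x \<partial>M) = 0" if C: "closed C" for C
  proof (cases "C = {}")
    case False
    define h where "h n x = max 0 (1 - real n * infdist x C)" for n x
    have hc: "continuous_on UNIV (h n)" for n
      unfolding h_def by (intro continuous_intros)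
    have lim: "(\<lambda>n. h n x) \<longlonglongrightarrow> indicator C x" for x
    proof (cases "x \<in> C")
      case True
      then show ?thesis by (simp add: h_def)
    next
      case x: False
      then have pos: "infdist x C > 0" using infdist_pos_not_in_closed C False by blast
      obtain N :: nat where N: "1 / infdist x C < real N" using reals_Archimedean2 by blast
      have "h n x = 0" if "n \<ge> N" for n
      proof -
        have "1 / infdist x C \<le> real n" using N that by linarith
        then have "1 \<le> real n * infdist x C" using pos by (simp add: field_simps)
        then show ?thesis by (simp add: h_def)
      qed
      then have "\<forall>\<^sub>F n in sequentially. h n x = 0" by (rule eventually_sequentiallyI)
      then show ?thesis using x by (simp add: tendsto_eventually)
    qed
    have "(\<lambda>n. \<integral>x. g x * h n x \<partial>M) \<longlonglongrightarrow> (\<integral>x. g x * indicator C x \<partial>M)"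
    proof (rule integral_dominated_convergence[where w = "\<lambda>x. \<bar>g x\<bar>"])
      show "(\<lambda>x. g x * indicator C x) \<in> borel_measurable M"
        using gind C by (intro borel_measurable_integrable) simp
      show "(\<lambda>x. g x * h n x) \<in> borel_measurable M" for n
        using meas[OF borel_measurable_continuous_onI[OF hc[of n]]] by simp
      show "AE x in M. (\<lambda>n. g x * h n x) \<longlonglongrightarrow> g x * indicator C x"
        by (intro AE_I2 tendsto_mult tendsto_const lim)
      have "\<bar>h n x\<bar> \<le> 1" for n x by (simp add: h_def infdist_nonneg)
      then show "AE x in M. norm (g x * h n x) \<le> \<bar>g x\<bar>" for n
        by (intro AE_I2) (simp add: abs_mult mult_left_le)
    qed (use g in simp)
    moreover have "(\<integral>x. g x * h n x \<partial>M) = 0" for n by (rule cont[OF hc])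
    ultimately show ?thesis using LIMSEQ_unique[OF _ tendsto_const] by simp
  qed simp
  have all: "(\<integral>x. g x * indicator B x \<partial>M) = 0" if "B \<in> sets borel" for B
  proof -
    have B: "B \<in> sigma_sets UNIV (Collect closed)"
      using that by (simp add: borel_eq_closed)
    have st: "Int_stable (Collect closed :: 'a set set)" by (auto simp: Int_stable_def)
    have sub: "Collect closed \<subseteq> Pow (UNIV :: 'a set)" by simp
    from B show ?thesis
    proof (induction B rule: sigma_sets_induct_disjoint[OF st sub, consumes 1, case_names basic empty compl union])
      case (basic A) then show ?case using closed by simp
    next
      case empty show ?case by simp
    next
      case (compl A)
      have A: "A \<in> sets borel" using compl(1) by (simp add: borel_eq_closed)
      have "(\<integral>x. g x * indicator (UNIV - A) x \<partial>M) = (\<integral>x. g x - g x * indicator A x \<partial>M)"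
        by (rule Bochner_Integration.integral_cong) (auto simp: indicator_def)
      also have "\<dots> = (\<integral>x. g x * indicator UNIV x \<partial>M) - (\<integral>x. g x * indicator A x \<partial>M)"
        using g gind[OF A] by simp
      finally show ?case using compl(2) closed[OF closed_UNIV] by simp
    next
      case (union A)
      have A: "A i \<in> sets borel" for i using union(2) by (auto simp: borel_eq_closed)
      have "(\<lambda>n. \<integral>x. g x * indicator (\<Union>i<n. A i) x \<partial>M) \<longlonglongrightarrow> (\<integral>x. g x * indicator (\<Union>i. A i) x \<partial>M)"
      proof (rule integral_dominated_convergence[where w = "\<lambda>x. \<bar>g x\<bar>"])
        show "AE x in M. (\<lambda>n. g x * indicator (\<Union>i<n. A i) x) \<longlonglongrightarrow> g x * indicator (\<Union>i. A i) x"
          by (intro AE_I2 tendsto_mult tendsto_const LIMSEQ_indicator_UN)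
        show "AE x in M. norm (g x * indicator (\<Union>i<n. A i) x) \<le> \<bar>g x\<bar>" for n
          by (intro AE_I2) (simp add: indicator_def)
        show "(\<lambda>x. g x * indicator (\<Union>i. A i) x) \<in> borel_measurable M"
          using A by (intro borel_measurable_integrable gind) auto
        show "(\<lambda>x. g x * indicator (\<Union>i<n. A i) x) \<in> borel_measurable M" for n
          using A by (intro borel_measurable_integrable gind) auto
      qed (use g in simp)
      moreover have "(\<integral>x. g x * indicator (\<Union>i<n. A i) x \<partial>M) = 0" for n
      proof -
        have "(\<integral>x. g x * indicator (\<Union>i<n. A i) x \<partial>M) = (\<integral>x. (\<Sum>i<n. g x * indicator (A i) x) \<partial>M)"
        proof (rule Bochner_Integration.integral_cong)
          fix x
          have "disjoint_family_on A {..<n}" using union(1) by (auto simp: disjoint_family_on_def)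
          then have "indicat_real (\<Union>i<n. A i) x = (\<Sum>i<n. indicator (A i) x)"
            using indicator_UN_disjoint[of "{..<n}" A x] by simp
          then show "g x * indicator (\<Union>i<n. A i) x = (\<Sum>i<n. g x * indicator (A i) x)"
            by (simp add: sum_distrib_left)
        qed simp
        also have "\<dots> = (\<Sum>i<n. \<integral>x. g x * indicator (A i) x \<partial>M)"
          by (rule Bochner_Integration.integral_sum) (use gind A in auto)
        finally show ?thesis using union(3) by simp
      qed
      ultimately show ?case using LIMSEQ_unique[OF _ tendsto_const] by simp
    qed
  qed
  show ?thesis
  proof (rule density_zero[OF g])
    fix A assume "A \<in> sets M"
    then obtain B where B: "B \<in> sets borel" "A = K \<inter> B"
      by (auto simp: M(2) sets_restrict_space)
    have "set_lebesgue_integral M A g = (\<integral>x. g x * indicator B x \<partial>M)"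
      unfolding set_lebesgue_integral_def
      by (rule Bochner_Integration.integral_cong) (auto simp: B(2) sp indicator_def)
    then show "set_lebesgue_integral M A g = 0" using all[OF B(1)] by simp
  qed
qed

lemma norm_rescale: "r > 0 \<Longrightarrow> norm ((1 / r) *\<^sub>R z) = norm z / r"
  by simp

lemma rescaled_Cc_inf:
  fixes f :: "'a::euclidean_space \<Rightarrow> real"
  assumes f: "f \<in> Cc_inf UNIV" "\<And>z. norm z \<ge> 1 \<Longrightarrow> f z = 0" and r: "0 < r" "cball a r \<subseteq> \<Omega>"
  shows "(\<lambda>x. f ((1 / r) *\<^sub>R (a - x))) \<in> Cc_inf \<Omega>"
proof (rule Cc_infI[OF _ compact_cball r(2)])
  have "Cinf_on UNIV (\<lambda>x. f ((1 / r) *\<^sub>R a + (- (1 / r)) *\<^sub>R x))"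
    by (rule Cinf_on_affine[OF Cc_inf_Cinf[OF f(1)]])
  then show "Cinf_on UNIV (\<lambda>x. f ((1 / r) *\<^sub>R (a - x)))"
    by (simp add: scaleR_diff_right)
  fix x assume "x \<notin> cball a r"
  then have "norm ((1 / r) *\<^sub>R (a - x)) \<ge> 1"
    unfolding norm_rescale[OF r(1)] using r(1) by (simp add: dist_norm)
  then show "f ((1 / r) *\<^sub>R (a - x)) = 0" by (rule f(2))
qed

text \<open>The fundamental lemma of the calculus of variations. Multiplying by a bump that is positive on
  a ball reduces it to orthogonality to all polynomials.\<close>

lemma AE_zero_if_orthogonal_to_test_functions:
  fixes g :: "'a::euclidean_space \<Rightarrow> real"
  assumes \<Omega>: "open \<Omega>"
    and int: "\<And>\<phi>. \<phi> \<in> Cc_inf \<Omega> \<Longrightarrow> integrable lborel (\<lambda>x. g x * \<phi> x)"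
    and orth: "\<And>\<phi>. \<phi> \<in> Cc_inf \<Omega> \<Longrightarrow> (\<integral>x. g x * \<phi> x \<partial>lborel) = 0"
  shows "AE x in lborel. x \<in> \<Omega> \<longrightarrow> g x = 0"
proof -
  have ball: "AE x in lborel. x \<in> ball a r \<longrightarrow> g x = 0" if r: "0 < r" "cball a r \<subseteq> \<Omega>" for a r
  proof -
    define cut where "cut x = radial ((1 / r) *\<^sub>R (a - x))" for x
    have cut: "cut \<in> Cc_inf \<Omega>" unfolding cut_def[abs_def]
      by (rule rescaled_Cc_inf[OF radial_Cc_inf bump_radial_outside(2) r])
    let ?K = "cball a r" let ?M = "restrict_space lborel ?K"
    have out: "cut x = 0" if "x \<notin> ?K" for x
    proof -
      have "norm ((1 / r) *\<^sub>R (a - x)) \<ge> 1"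
        unfolding norm_rescale[OF r(1)] using r(1) that by (simp add: dist_norm)
      then show ?thesis unfolding cut_def by (rule bump_radial_outside)
    qed
    have "AE x in ?M. g x * cut x = 0"
    proof (rule AE_zero_if_orthogonal_to_polynomials[of _ ?K])
      show "finite_measure ?M"
        by (rule finite_measureI)
          (use emeasure_bounded_finite[of ?K] in
            \<open>simp add: emeasure_restrict_space space_restrict_space\<close>)
      show "sets ?M = sets (restrict_space borel ?K)" by (rule sets_restrict_space_cong) simp
      have e: "(\<lambda>x. indicator ?K x *\<^sub>R (g x * cut x * p x)) = (\<lambda>x. g x * (cut x * p x))"
        for p :: "'a \<Rightarrow> real" by (rule ext) (use out in \<open>auto simp: indicator_def\<close>)
      show "integrable ?M (\<lambda>x. g x * cut x)"
        using int[OF cut] e[of "\<lambda>x. 1"] by (subst integrable_restrict_space) auto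
      fix p :: "'a \<Rightarrow> real" assume "real_polynomial_function p"
      then have "(\<lambda>x. cut x * p x) \<in> Cc_inf \<Omega>"
        using Cc_inf_mult(1)[OF cut] Cinf_on_polynomial by blast
      then show "(\<integral>x. g x * cut x * p x \<partial>?M) = 0"
        using orth e[of p] by (subst integral_restrict_space) auto
    qed simp
    then have "AE x in lborel. x \<in> ?K \<longrightarrow> g x * cut x = 0" by (simp add: AE_restrict_space_iff)
    then show ?thesis
    proof eventually_elim
      case (elim x)
      have "cut x > 0" if "x \<in> ball a r"
      proof -
        have "norm ((1 / r) *\<^sub>R (a - x)) < 1"
          unfolding norm_rescale[OF r(1)] using r(1) that by (simp add: dist_norm)
        then show ?thesis unfolding cut_def by (rule radial_pos)
      qed
      then show ?case using elim by force
    qed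
  qed
  define G where "G = {ball a r |a r. 0 < r \<and> cball a r \<subseteq> \<Omega>}"
  have "\<And>S. S \<in> G \<Longrightarrow> open S" by (auto simp: G_def)
  then obtain F where F: "F \<subseteq> G" "countable F" "\<Union>F = \<Union>G" using Lindelof[of G] by metis
  have cover: "\<Omega> \<subseteq> \<Union>F"
  proof
    fix x assume "x \<in> \<Omega>"
    then obtain r where "r > 0" "cball x r \<subseteq> \<Omega>" using \<Omega> open_contains_cball by blast
    then have "ball x r \<in> G" "x \<in> ball x r" by (auto simp: G_def)
    then show "x \<in> \<Union>F" unfolding F(3) by blast
  qed
  have "AE x in lborel. \<forall>S\<in>F. x \<in> S \<longrightarrow> g x = 0"
    unfolding AE_ball_countable[OF F(2)]
  proof
    fix S assume "S \<in> F"
    then obtain a r where "S = ball a r" "0 < r" "cball a r \<subseteq> \<Omega>" using F(1) by (auto simp: G_def)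
    then show "AE x in lborel. x \<in> S \<longrightarrow> g x = 0" using ball by simp
  qed
  then show ?thesis by eventually_elim (use cover in blast)
qed

section \<open>Borel versions of functions on an open set\<close>

text \<open>Passing to Borel versions extended by zero turns integrals over \<open>\<Omega>\<close> of Lebesgue measurable
  functions into integrals over the whole space, where Fubini and translations are available.\<close>

definition borel_version :: "'a::euclidean_space set \<Rightarrow> ('a \<Rightarrow> real) \<Rightarrow> ('a \<Rightarrow> real) \<Rightarrow> bool" where
  "borel_version \<Omega> u U \<longleftrightarrow> U \<in> borel_measurable borel \<and> (\<forall>x. x \<notin> \<Omega> \<longrightarrow> U x = 0) \<and>
     u \<in> borel_measurable (lebesgue_on \<Omega>) \<and> (AE x in lebesgue_on \<Omega>. u x = U x)"

lemma AE_lebesgue_on_iff: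
  "open \<Omega> \<Longrightarrow> (AE x in lebesgue_on \<Omega>. P x) \<longleftrightarrow> (AE x in lborel. x \<in> \<Omega> \<longrightarrow> P x)"
  by (simp add: AE_restrict_space_iff AE_completion_iff)

lemma borel_measurable_lebesgue_onI:
  assumes "open \<Omega>" "U \<in> borel_measurable borel" shows "U \<in> borel_measurable (lebesgue_on \<Omega>)"
  using assms by (simp add: measurable_completion measurable_restrict_space1)

lemma borel_version_exists:
  assumes \<Omega>: "open \<Omega>" and u: "u \<in> borel_measurable (lebesgue_on \<Omega>)"
  obtains U where "borel_version \<Omega> u U"
proof -
  have "(\<lambda>x. if x \<in> \<Omega> then u x else 0) \<in> borel_measurable lebesgue"
    using borel_measurable_if_I[OF u] \<Omega> by simp
  then obtain V where V: "V \<in> borel_measurable lborel"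
    "AE x in lborel. (if x \<in> \<Omega> then u x else 0) = V x"
    using completion_ex_borel_measurable_real by blast
  have [measurable]: "V \<in> borel_measurable borel" "\<Omega> \<in> sets borel" using V \<Omega> by auto
  define U where "U x = indicator \<Omega> x * V x" for x
  have "borel_version \<Omega> u U"
    unfolding borel_version_def
  proof (intro conjI)
    show "U \<in> borel_measurable borel" unfolding U_def[abs_def] by measurable
    show "AE x in lebesgue_on \<Omega>. u x = U x"
      unfolding AE_lebesgue_on_iff[OF \<Omega>] using V(2) by eventually_elim (auto simp: U_def)
  qed (use u in \<open>auto simp: U_def\<close>)
  then show ?thesis using that by blast
qed

lemma borel_version_borel:
  assumes "open \<Omega>" "f \<in> borel_measurable borel"
  shows "borel_version \<Omega> f (\<lambda>x. indicator \<Omega> x * f x)"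
  unfolding borel_version_def
proof (intro conjI)
  have [measurable]: "f \<in> borel_measurable borel" "\<Omega> \<in> sets borel" using assms by auto
  show "(\<lambda>x. indicator \<Omega> x * f x) \<in> borel_measurable borel" by measurable
  show "AE x in lebesgue_on \<Omega>. f x = indicator \<Omega> x * f x"
    by (simp add: AE_lebesgue_on_iff[OF assms(1)])
qed (use borel_measurable_lebesgue_onI assms in auto)

lemma borel_version_mult:
  assumes "borel_version \<Omega> u U" "borel_version \<Omega> v V"
  shows "borel_version \<Omega> (\<lambda>x. u x * v x) (\<lambda>x. U x * V x)"
  using assms unfolding borel_version_def by (auto elim!: eventually_elim2)

lemma borel_version_integral:
  assumes \<Omega>: "open \<Omega>" and u: "borel_version \<Omega> u U"
  shows "(\<integral>x. u x \<partial>lebesgue_on \<Omega>) = (\<integral>x. U x \<partial>lborel)"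
    and "integrable (lebesgue_on \<Omega>) u \<longleftrightarrow> integrable lborel U"
proof -
  have U: "U \<in> borel_measurable borel" "\<And>x. x \<notin> \<Omega> \<Longrightarrow> U x = 0"
    and um: "u \<in> borel_measurable (lebesgue_on \<Omega>)" and ae: "AE x in lebesgue_on \<Omega>. u x = U x"
    using u by (auto simp: borel_version_def)
  have Um: "U \<in> borel_measurable (lebesgue_on \<Omega>)" by (rule borel_measurable_lebesgue_onI[OF \<Omega> U(1)])
  have e: "(\<lambda>x. indicator \<Omega> x *\<^sub>R U x) = U" by (rule ext) (use U(2) in \<open>auto simp: indicator_def\<close>)
  have s: "\<Omega> \<inter> space lebesgue \<in> sets lebesgue" using \<Omega> by simp
  have "(\<integral>x. u x \<partial>lebesgue_on \<Omega>) = (\<integral>x. U x \<partial>lebesgue_on \<Omega>)"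
    by (rule integral_cong_AE[OF um Um ae])
  also have "\<dots> = (\<integral>x. U x \<partial>lebesgue)" by (simp only: integral_restrict_space[OF s] e)
  also have "\<dots> = (\<integral>x. U x \<partial>lborel)" using U(1) by (intro integral_completion) simp
  finally show "(\<integral>x. u x \<partial>lebesgue_on \<Omega>) = (\<integral>x. U x \<partial>lborel)" .
  have "integrable (lebesgue_on \<Omega>) u \<longleftrightarrow> integrable (lebesgue_on \<Omega>) U"
    by (rule integrable_cong_AE[OF um Um ae])
  also have "\<dots> \<longleftrightarrow> integrable lebesgue U" by (simp only: integrable_restrict_space[OF s] e)
  also have "\<dots> \<longleftrightarrow> integrable lborel U" using U(1) by (intro integrable_completion) simp
  finally show "integrable (lebesgue_on \<Omega>) u \<longleftrightarrow> integrable lborel U" .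
qed

lemma borel_version_L2:
  assumes \<Omega>: "open \<Omega>" and u: "borel_version \<Omega> u U"
  shows "u \<in> L2 (lebesgue_on \<Omega>) \<longleftrightarrow> U \<in> L2 lborel"
  using borel_version_integral(2)[OF \<Omega> borel_version_mult[OF u u]] u
  by (simp add: L2_def power2_eq_square borel_version_def)

lemma borel_version_L2_inner:
  assumes \<Omega>: "open \<Omega>" and u: "borel_version \<Omega> u U" and v: "borel_version \<Omega> v V"
  shows "L2_inner (lebesgue_on \<Omega>) u v = L2_inner lborel U V"
  using borel_version_integral(1)[OF \<Omega> borel_version_mult[OF u v]] by (simp add: L2_inner_def)

lemma integral_lebesgue_on_times_borel:
  assumes \<Omega>: "open \<Omega>" and u: "borel_version \<Omega> u U" and f: "f \<in> borel_measurable borel"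
  shows "(\<integral>x. u x * f x \<partial>lebesgue_on \<Omega>) = (\<integral>x. U x * f x \<partial>lborel)"
proof -
  have "(\<integral>x. u x * f x \<partial>lebesgue_on \<Omega>) = (\<integral>x. U x * (indicator \<Omega> x * f x) \<partial>lborel)"
    by (rule borel_version_integral(1)[OF \<Omega> borel_version_mult[OF u borel_version_borel[OF \<Omega> f]]])
  also have "\<dots> = (\<integral>x. U x * f x \<partial>lborel)"
    by (rule Bochner_Integration.integral_cong) (use u in \<open>auto simp: borel_version_def indicator_def\<close>)
  finally show ?thesis .
qed

lemma L2_bounded_set_integrable:
  assumes b: "bounded S" and U: "U \<in> L2 lborel" "\<And>x. x \<notin> S \<Longrightarrow> U x = 0"
  shows "integrable lborel (U :: 'a::euclidean_space \<Rightarrow> real)"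
proof -
  obtain r where r: "\<And>x. x \<in> S \<Longrightarrow> norm x \<le> r" using b by (auto simp: bounded_iff)
  let ?i = "indicat_real (cball (0::'a) r)"
  have "(\<lambda>x. (?i x)\<^sup>2) = ?i" by (rule ext) (simp add: indicator_def)
  then have i: "?i \<in> L2 lborel"
    using emeasure_bounded_finite[of "cball (0::'a) r"]
    by (auto simp: L2_def integrable_indicator_iff intro!: borel_measurable_indicator)
  have "(\<lambda>x. U x * indicator (cball 0 r) x) = U"
    by (rule ext) (use U(2) r in \<open>auto simp: indicator_def\<close>)
  then show ?thesis using L2_mult_integrable[OF U(1) i] by simp
qed

lemma L2_extension:
  assumes \<Omega>: "open \<Omega>" "bounded \<Omega>" and u: "u \<in> L2 (lebesgue_on \<Omega>)"
  obtains U where "borel_version \<Omega> u U" "U \<in> L2 lborel" "integrable lborel U"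
proof -
  obtain U where U: "borel_version \<Omega> u U" using borel_version_exists[OF \<Omega>(1) L2_measurable[OF u]] .
  have U2: "U \<in> L2 lborel" using borel_version_L2[OF \<Omega>(1) U] u by simp
  moreover have "integrable lborel U"
    by (rule L2_bounded_set_integrable[OF \<Omega>(2) U2]) (use U in \<open>auto simp: borel_version_def\<close>)
  ultimately show ?thesis using that U by blast
qed

section \<open>Weyl's lemma\<close>

lemma Cc_inf_affine:
  assumes k: "\<kappa> \<in> Cc_inf UNIV" and c: "c \<noteq> 0"
  shows "(\<lambda>x. \<kappa> (a + c *\<^sub>R x)) \<in> Cc_inf UNIV"
proof -
  obtain K where K: "compact K" "\<And>x. x \<notin> K \<Longrightarrow> \<kappa> x = 0" using Cc_inf_support[OF k] by metis
  show ?thesis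
  proof (rule Cc_infI[OF Cinf_on_affine[OF Cc_inf_Cinf[OF k]]])
    show "compact ((\<lambda>y. (1 / c) *\<^sub>R (y - a)) ` K)"
      by (intro compact_continuous_image K(1) continuous_intros)
    fix x assume x: "x \<notin> (\<lambda>y. (1 / c) *\<^sub>R (y - a)) ` K"
    have "x = (1 / c) *\<^sub>R ((a + c *\<^sub>R x) - a)" using c by simp
    then have "a + c *\<^sub>R x \<notin> K" using x by blast
    then show "\<kappa> (a + c *\<^sub>R x) = 0" by (rule K(2))
  qed simp
qed

lemma average_close:
  fixes F \<kappa> :: "'a::euclidean_space \<Rightarrow> real"
  assumes \<kappa>: "integrable lborel \<kappa>" "\<And>x. \<kappa> x \<ge> 0" "(\<integral>x. \<kappa> x \<partial>lborel) = 1"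
    and F: "integrable lborel (\<lambda>x. F x * \<kappa> x)"
    and close: "\<And>x. \<kappa> x \<noteq> 0 \<Longrightarrow> \<bar>F x - c\<bar> \<le> e"
  shows "\<bar>(\<integral>x. F x * \<kappa> x \<partial>lborel) - c\<bar> \<le> e"
proof -
  have int: "integrable lborel (\<lambda>x. F x * \<kappa> x - c * \<kappa> x)" using \<kappa>(1) F by simp
  have "(\<integral>x. F x * \<kappa> x \<partial>lborel) - c = (\<integral>x. F x * \<kappa> x - c * \<kappa> x \<partial>lborel)"
    using \<kappa> F by simp
  also have "\<bar>\<dots>\<bar> \<le> (\<integral>x. \<bar>F x * \<kappa> x - c * \<kappa> x\<bar> \<partial>lborel)" by (rule integral_abs_bound)
  also have "\<dots> \<le> (\<integral>x. e * \<kappa> x \<partial>lborel)"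
  proof (rule integral_mono)
    show "integrable lborel (\<lambda>x. \<bar>F x * \<kappa> x - c * \<kappa> x\<bar>)" using int by (rule integrable_abs)
    show "integrable lborel (\<lambda>x. e * \<kappa> x)" using \<kappa>(1) by simp
    fix x
    show "\<bar>F x * \<kappa> x - c * \<kappa> x\<bar> \<le> e * \<kappa> x"
    proof (cases "\<kappa> x = 0")
      case False
      have "\<bar>F x * \<kappa> x - c * \<kappa> x\<bar> = \<bar>F x - c\<bar> * \<kappa> x"
        using \<kappa>(2)[of x] by (simp add: left_diff_distrib[symmetric] abs_mult)
      then show ?thesis using close[OF False] \<kappa>(2)[of x] by (simp add: mult_right_mono)
    qed simp
  qed
  also have "\<dots> = e" using \<kappa> by simp
  finally show ?thesis .
qed

text \<open>The reason for choosing the mollifier as the radial part of the gradient of a bump: its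
  derivative in the radius is a divergence of the radial field \<open>z radial z\<close>, hence a multiple of the
  divergence of that gradient.\<close>

lemma moll_has_derivative:
  fixes z :: "'a::euclidean_space"
  assumes "\<delta> > 0"
  shows "((\<lambda>\<delta>. moll \<delta> z) has_derivative
    (\<lambda>h. h * (laplacian bump ((1 / \<delta>) *\<^sub>R z) / (2 * bump_mass TYPE('a) * \<delta> ^ (DIM('a) + 1))))) (at \<delta>)"
proof -
  define I where "I = bump_mass TYPE('a)"
  have I: "I > 0" unfolding I_def by (rule bump_mass_pos)
  define w where "w = (1 / \<delta>) *\<^sub>R z"
  define S where "S = (\<Sum>i\<in>Basis. (w \<bullet> i) * partial i radial w)"
  have d: "radial differentiable (at w)" using Cinf_on_differentiable[OF Cinf_on_radial] by blast
  have 1: "((\<lambda>\<delta>. (1 / \<delta>) *\<^sub>R z) has_derivative (\<lambda>h. - (h / \<delta>\<^sup>2) *\<^sub>R z)) (at \<delta>)"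
    using assms by (auto intro!: derivative_eq_intros simp: power2_eq_square divide_inverse)
  have "((\<lambda>\<delta>. radial ((1 / \<delta>) *\<^sub>R z)) has_derivative
      (\<lambda>h. \<Sum>i\<in>Basis. ((- (h / \<delta>\<^sup>2) *\<^sub>R z) \<bullet> i) * partial i radial w)) (at \<delta>)"
    using diff_chain_at[OF 1 has_derivative_partial[OF d[unfolded w_def]]] by (simp add: o_def w_def)
  moreover have "(\<Sum>i\<in>Basis. ((- (h / \<delta>\<^sup>2) *\<^sub>R z) \<bullet> i) * partial i radial w) = - (h / \<delta>) * S" for h
    using assms unfolding S_def sum_distrib_left
    by (intro sum.cong) (auto simp: w_def power2_eq_square field_simps)
  moreover have eq: "(\<lambda>h. - (h / \<delta>) * S) = (*) (- (1 / \<delta>) * S)" by auto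
  ultimately have 2: "((\<lambda>\<delta>. radial ((1 / \<delta>) *\<^sub>R z)) has_real_derivative - (1 / \<delta>) * S) (at \<delta>)"
    unfolding has_field_derivative_def using eq by (simp only:)
  have der: "((\<lambda>\<delta>. radial ((1 / \<delta>) *\<^sub>R z) / (\<delta> ^ DIM('a) * I)) has_real_derivative
      ((- (1 / \<delta>) * S) * (\<delta> ^ DIM('a) * I) - radial ((1 / \<delta>) *\<^sub>R z) * (DIM('a) * \<delta> ^ (DIM('a) - 1) * I))
        / ((\<delta> ^ DIM('a) * I) * (\<delta> ^ DIM('a) * I))) (at \<delta>)"
    by (rule DERIV_divide[OF 2]) (use assms I in \<open>auto intro!: derivative_eq_intros\<close>)
  have eqv: "((- (1 / \<delta>) * S) * (\<delta> ^ DIM('a) * I) - radial ((1 / \<delta>) *\<^sub>R z) * (DIM('a) * \<delta> ^ (DIM('a) - 1) * I))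
        / ((\<delta> ^ DIM('a) * I) * (\<delta> ^ DIM('a) * I))
      = laplacian bump w / (2 * I * \<delta> ^ (DIM('a) + 1))"
  proof -
    obtain n where n: "DIM('a) = Suc n" using DIM_positive[where 'a='a] gr0_implies_Suc by blast
    have lw: "laplacian bump w = - 2 * (Suc n * radial w + S)"
      using laplacian_bump[of w] n by (simp add: S_def)
    show ?thesis using assms I unfolding n w_def[symmetric] lw
      by (simp add: field_simps)
  qed
  have eq2: "(\<lambda>h. h * c) = (*) c" for c :: real by (auto simp: mult.commute)
  show ?thesis
    using der[unfolded eqv]
    unfolding has_field_derivative_def moll_def I_def[symmetric] w_def[symmetric] eq2 .
qed

text \<open>The derivative of the average in its radius is the integral of \<open>U\<close> against the Laplacian of a test
  function that is supported in a ball around \<open>x\<close>.\<close>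

lemma conv_moll_constant:
  fixes U :: "'a::euclidean_space \<Rightarrow> real"
  assumes U: "integrable lborel U"
    and harm: "\<And>\<phi>. \<phi> \<in> Cc_inf \<Omega> \<Longrightarrow> (\<integral>y. U y * laplacian \<phi> y \<partial>lborel) = 0"
    and R: "ball x R \<subseteq> \<Omega>" and e: "0 < \<epsilon>" "\<epsilon> < R" "0 < \<delta>" "\<delta> < R"
  shows "conv U (moll \<epsilon>) x = conv U (moll \<delta>) x"
proof -
  define I where "I = bump_mass TYPE('a)"
  have I: "I > 0" unfolding I_def by (rule bump_mass_pos)
  have lb: "laplacian bump \<in> Cc_inf (UNIV :: 'a set)" by (rule Cc_inf_laplacian[OF bump_Cc_inf])
  obtain B where B: "B \<ge> 0" "\<And>w::'a. \<bar>laplacian bump w\<bar> \<le> B" using Cc_inf_bounded[OF lb] by blast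
  have [measurable]: "laplacian (bump :: 'a \<Rightarrow> real) \<in> borel_measurable borel" by (rule Cc_inf_borel[OF lb])
  have vanish: "(\<integral>y. U y * laplacian bump ((1 / s) *\<^sub>R (x - y)) \<partial>lborel) = 0" if s: "0 < s" "s < R" for s
  proof -
    have "cball x s \<subseteq> \<Omega>" using s by (intro order_trans[OF _ R]) (simp add: cball_subset_ball_iff)
    from rescaled_Cc_inf[OF bump_Cc_inf bump_radial_outside(1) s(1) this]
    have "(\<integral>y. U y * laplacian (\<lambda>y. bump ((1 / s) *\<^sub>R (x - y))) y \<partial>lborel) = 0" by (intro harm) simp
    moreover have "laplacian (\<lambda>y. bump ((1 / s) *\<^sub>R (x - y))) y = (1 / s)\<^sup>2 * laplacian bump ((1 / s) *\<^sub>R (x - y))" for y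
      using laplacian_affine[OF Cinf_on_bump, of "(1 / s) *\<^sub>R x" "- (1 / s)" y]
      by (simp add: scaleR_diff_right)
    ultimately show ?thesis using s by (simp add: mult.left_commute[of "U _"])
  qed
  have der: "((\<lambda>s. conv U (moll s) x) has_real_derivative 0) (at s)" if s: "s \<in> {0<..<R}" for s
  proof -
    have s0: "0 < s" "s < R" using s by auto
    have m: "(\<lambda>y. moll t (x - y)) \<in> borel_measurable lborel" if "t > 0" for t
    proof -
      note [measurable] = Cc_inf_borel[OF moll_Cc_inf[OF that]]
      show ?thesis by measurable
    qed
    have pos: "t > s / 2" if "t \<in> ball s (s / 2)" for t :: real
      using that by (auto simp: dist_real_def abs_real_def split: if_splits)
    obtain C where C: "\<And>z::'a. \<bar>moll s z\<bar> \<le> C" using Cc_inf_bounded[OF moll_Cc_inf[OF s0(1)]] by blast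
    have "((\<lambda>s. \<integral>y. U y * moll s (x - y) \<partial>lborel) has_derivative
        (\<lambda>h. \<integral>y. U y * (h * (laplacian bump ((1 / s) *\<^sub>R (x - y)) / (2 * I * s ^ (DIM('a) + 1)))) \<partial>lborel)) (at s)"
    proof (rule has_derivative_integral[OF U, where r = "s / 2" and C = C
          and B = "B / (2 * I * (s / 2) ^ (DIM('a) + 1))"
          and D = "\<lambda>t y h. h * (laplacian bump ((1 / t) *\<^sub>R (x - y)) / (2 * I * t ^ (DIM('a) + 1)))"])
      fix t y h assume t: "t \<in> ball s (s / 2)"
      then have t0: "t > s / 2" "t > 0" using pos s0 by force+
      show "((\<lambda>t. moll t (x - y)) has_derivative
          (\<lambda>h. h * (laplacian bump ((1 / t) *\<^sub>R (x - y)) / (2 * I * t ^ (DIM('a) + 1))))) (at t)"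
        using moll_has_derivative[OF t0(2), of "x - y"] by (simp add: I_def)
      show "(\<lambda>y. moll t (x - y)) \<in> borel_measurable lborel" by (rule m[OF t0(2)])
      have "\<bar>laplacian bump ((1 / t) *\<^sub>R (x - y)) / (2 * I * t ^ (DIM('a) + 1))\<bar>
          \<le> B / (2 * I * (s / 2) ^ (DIM('a) + 1))"
      proof -
        have "(s / 2) ^ (DIM('a) + 1) \<le> t ^ (DIM('a) + 1)" using t0 s0 by (intro power_mono) auto
        then have "2 * I * (s / 2) ^ (DIM('a) + 1) \<le> \<bar>2 * I * t ^ (DIM('a) + 1)\<bar>"
          using I t0 by (simp add: abs_mult)
        then show ?thesis
          unfolding abs_divide using B I s0 by (intro frac_le) auto
      qed
      from mult_right_mono[OF this, of "\<bar>h\<bar>"]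
      show "\<bar>h * (laplacian bump ((1 / t) *\<^sub>R (x - y)) / (2 * I * t ^ (DIM('a) + 1)))\<bar>
          \<le> B / (2 * I * (s / 2) ^ (DIM('a) + 1)) * norm h"
        by (simp add: abs_mult mult.commute)
    qed (use s0 C in auto)
    moreover have "(\<integral>y. U y * (h * (laplacian bump ((1 / s) *\<^sub>R (x - y)) / (2 * I * s ^ (DIM('a) + 1)))) \<partial>lborel) = 0"
      for h
    proof -
      have "(\<integral>y. U y * (h * (laplacian bump ((1 / s) *\<^sub>R (x - y)) / (2 * I * s ^ (DIM('a) + 1)))) \<partial>lborel)
        = (\<integral>y. (h / (2 * I * s ^ (DIM('a) + 1))) * (U y * laplacian bump ((1 / s) *\<^sub>R (x - y))) \<partial>lborel)"
        by (rule Bochner_Integration.integral_cong) auto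
      then show ?thesis using vanish[OF s0] by simp
    qed
    moreover have "(*) (0::real) = (\<lambda>h. 0)" by auto
    ultimately show ?thesis by (simp only: conv_def has_field_derivative_def)
  qed
  have "\<exists>c. \<forall>s\<in>{0<..<R}. conv U (moll s) x = c"
    by (rule has_field_derivative_zero_constant)
      (auto intro: convex_real_interval has_field_derivative_at_within[OF der])
  then show ?thesis using e by fastforce
qed

text \<open>A radius for which balls stay inside \<open>\<Omega>\<close>; by the preceding lemma any smaller radius gives the
  same averages of a harmonic function.\<close>

definition inner_radius :: "'a::euclidean_space set \<Rightarrow> 'a \<Rightarrow> real" where
  "inner_radius \<Omega> x = infdist x (- \<Omega>) / 2"

definition harmonic_version :: "'a::euclidean_space set \<Rightarrow> ('a \<Rightarrow> real) \<Rightarrow> 'a \<Rightarrow> real" where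
  "harmonic_version \<Omega> U x = (if x \<in> \<Omega> then conv U (moll (inner_radius \<Omega> x)) x else 0)"

lemma inner_radius:
  assumes \<Omega>: "open \<Omega>" "bounded \<Omega>" and x: "x \<in> \<Omega>"
  shows "inner_radius \<Omega> x > 0" "ball x (2 * inner_radius \<Omega> x) \<subseteq> \<Omega>"
proof -
  have ne: "- \<Omega> \<noteq> {}" using \<Omega>(2) not_bounded_UNIV by (metis Compl_UNIV_eq double_compl)
  show "inner_radius \<Omega> x > 0"
    using infdist_pos_not_in_closed[of "- \<Omega>" x] \<Omega>(1) ne x by (simp add: inner_radius_def closed_Compl)
  show "ball x (2 * inner_radius \<Omega> x) \<subseteq> \<Omega>"
  proof
    fix y assume y: "y \<in> ball x (2 * inner_radius \<Omega> x)"
    show "y \<in> \<Omega>"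
    proof (rule ccontr)
      assume "y \<notin> \<Omega>"
      then have "infdist x (- \<Omega>) \<le> dist x y" by (intro infdist_le) simp
      then show False using y by (simp add: inner_radius_def)
    qed
  qed
qed

lemma harmonic_version_eq:
  assumes \<Omega>: "open \<Omega>" "bounded \<Omega>" and U: "integrable lborel U"
    and harm: "\<And>\<phi>. \<phi> \<in> Cc_inf \<Omega> \<Longrightarrow> (\<integral>y. U y * laplacian \<phi> y \<partial>lborel) = 0"
    and R: "ball x R \<subseteq> \<Omega>" and e: "0 < \<epsilon>" "\<epsilon> < R"
  shows "harmonic_version \<Omega> U x = conv U (moll \<epsilon>) x"
proof -
  have x: "x \<in> \<Omega>" using R e by auto
  note r = inner_radius[OF \<Omega> x]
  have "ball x (max R (2 * inner_radius \<Omega> x)) \<subseteq> \<Omega>" using R r(2) by (simp add: max_def)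
  from conv_moll_constant[OF U harm this, of "inner_radius \<Omega> x" \<epsilon>] show ?thesis
    using r(1) e x by (simp add: harmonic_version_def)
qed

lemma Cinf_on_harmonic_version:
  assumes \<Omega>: "open \<Omega>" "bounded \<Omega>" and U: "integrable lborel U"
    and harm: "\<And>\<phi>. \<phi> \<in> Cc_inf \<Omega> \<Longrightarrow> (\<integral>y. U y * laplacian \<phi> y \<partial>lborel) = 0"
  shows "Cinf_on \<Omega> (harmonic_version \<Omega> U)"
  unfolding Cinf_on_def
proof (intro allI Ck_on_local)
  fix k x assume x: "x \<in> \<Omega>"
  define r where "r = inner_radius \<Omega> x"
  note r = inner_radius[OF \<Omega> x, folded r_def]
  have "harmonic_version \<Omega> U y = conv U (moll (r / 2)) y" if y: "y \<in> ball x r" for y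
  proof (rule harmonic_version_eq[OF \<Omega> U harm, where R = r])
    have "ball y r \<subseteq> ball x (2 * r)"
      using y by (auto intro!: ball_subset_ball_iff[THEN iffD2] simp: dist_commute)
    then show "ball y r \<subseteq> \<Omega>" using r(2) by blast
  qed (use r in auto)
  moreover have "Ck_on k (ball x r) (conv U (moll (r / 2)))"
    by (rule Ck_on_subset[OF Cinf_on_imp_Ck_on[OF Cinf_on_conv[OF U moll_Cc_inf]]]) (use r(1) in auto)
  ultimately have "Ck_on k (ball x r) (harmonic_version \<Omega> U)"
    using Ck_on_cong[OF open_ball, of x r "harmonic_version \<Omega> U"] by blast
  then show "\<exists>T. open T \<and> x \<in> T \<and> Ck_on k T (harmonic_version \<Omega> U)"
    using r(1) by (intro exI[of _ "ball x r"]) simp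
qed

lemma moll_conv_pointwise:
  fixes F :: "'a::euclidean_space \<Rightarrow> real"
  assumes F: "\<And>n. integrable lborel (\<lambda>x. F x * moll (r n) (x - y))" and c: "isCont F y"
    and r: "\<And>n. r n > 0" "r \<longlonglongrightarrow> 0"
  shows "(\<lambda>n. \<integral>x. F x * moll (r n) (x - y) \<partial>lborel) \<longlonglongrightarrow> F y"
proof (rule LIMSEQ_I)
  fix e :: real assume e: "e > 0"
  then obtain d where d: "d > 0" "\<And>x. dist x y < d \<Longrightarrow> \<bar>F x - F y\<bar> < e / 2"
    using c unfolding continuous_at_eps_delta by (metis dist_real_def half_gt_zero)
  have "\<forall>\<^sub>F n in sequentially. r n < d" using r(2) d(1) order_tendstoD(2) by blast
  then obtain N where N: "\<And>n. n \<ge> N \<Longrightarrow> r n < d" unfolding eventually_sequentially by blast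
  have "norm ((\<integral>x. F x * moll (r n) (x - y) \<partial>lborel) - F y) < e" if "n \<ge> N" for n
  proof -
    have m: "integrable lborel (\<lambda>x. moll (r n) (x - y))"
      using Cc_inf_integrable[OF Cc_inf_affine[OF moll_Cc_inf[OF r(1)], of 1 n "- y"]] by simp
    have "\<bar>(\<integral>x. F x * moll (r n) (x - y) \<partial>lborel) - F y\<bar> \<le> e / 2"
    proof (rule average_close[OF m _ integral_moll_shift(2)[OF r(1)] F])
      show "moll (r n) (x - y) \<ge> 0" for x by (rule moll_nonneg[OF r(1)])
      fix x assume "moll (r n) (x - y) \<noteq> 0"
      then have "norm (x - y) < r n" using moll_outside[OF r(1)] by force
      then have "dist x y < d" using N[OF that] by (simp add: dist_norm)
      then show "\<bar>F x - F y\<bar> \<le> e / 2" using d(2) less_imp_le by blast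
    qed
    then show ?thesis using e by simp
  qed
  then show "\<exists>N. \<forall>n\<ge>N. norm ((\<integral>x. F x * moll (r n) (x - y) \<partial>lborel) - F y) < e" by blast
qed

text \<open>On the support of a test function \<open>\<phi>\<close> the smooth version is an average over each small enough
  radius. Fubini moves the averaging to \<open>\<phi>\<close>, and the averages of \<open>\<phi>\<close> tend to \<open>\<phi>\<close> as the radius
  shrinks.\<close>

lemma AE_harmonic_version:
  assumes \<Omega>: "open \<Omega>" "bounded \<Omega>" and U: "integrable lborel U"
    and harm: "\<And>\<phi>. \<phi> \<in> Cc_inf \<Omega> \<Longrightarrow> (\<integral>y. U y * laplacian \<phi> y \<partial>lborel) = 0"
  shows "AE x in lborel. x \<in> \<Omega> \<longrightarrow> harmonic_version \<Omega> U x = U x"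
proof -
  let ?f = "harmonic_version \<Omega> U"
  have "integrable lborel (\<lambda>x. (?f x - U x) * \<phi> x) \<and> (\<integral>x. (?f x - U x) * \<phi> x \<partial>lborel) = 0"
    if \<phi>: "\<phi> \<in> Cc_inf \<Omega>" for \<phi>
  proof -
    obtain K where K: "compact K" "K \<subseteq> \<Omega>" "\<And>x. x \<notin> K \<Longrightarrow> \<phi> x = 0" using Cc_inf_support[OF \<phi>] by blast
    obtain R where R: "R > 0" "(\<Union>x\<in>K. ball x R) \<subseteq> \<Omega>"
      using compact_subset_open_imp_ball_epsilon_subset[OF K(1) \<Omega>(1) K(2)] by blast
    have feq: "?f x * \<phi> x = conv U (moll r) x * \<phi> x" if r: "0 < r" "r < R" for x r
    proof (cases "x \<in> K")
      case True
      then have "ball x R \<subseteq> \<Omega>" using R(2) by blast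
      then show ?thesis using harmonic_version_eq[OF \<Omega> U harm _ r] by simp
    qed (use K(3) in simp)
    define r where "r n = R / (real n + 2)" for n
    have r: "r n > 0" "r n < R" for n
    proof -
      have "R * 1 < R * (real n + 2)" using R(1) by (intro mult_strict_left_mono) auto
      then show "r n > 0" "r n < R" using R(1) by (simp_all add: r_def pos_divide_less_eq)
    qed
    have "(\<lambda>n. R * (1 / real (n + 2))) \<longlonglongrightarrow> R * 0"
      by (intro tendsto_mult tendsto_const LIMSEQ_ignore_initial_segment[OF lim_1_over_n])
    then have r0: "r \<longlonglongrightarrow> 0" by (simp add: r_def[abs_def] add.commute)
    note \<phi>i = Cc_inf_integrable[OF \<phi>]
    have c: "continuous_on UNIV (\<lambda>x. conv U (moll (r 0)) x * \<phi> x)"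
      by (intro continuous_on_mult Cinf_on_continuous Cinf_on_conv[OF U moll_Cc_inf] r
          Cc_inf_Cinf[OF \<phi>])
    have int1: "integrable lborel (\<lambda>x. ?f x * \<phi> x)"
      unfolding feq[OF r[of 0]] by (rule compact_support_integrable[OF c K(1)]) (use K(3) in simp)
    have int2: "integrable lborel (\<lambda>x. U x * \<phi> x)" by (rule integrable_mult_Cc_inf(1)[OF U \<phi>])
    obtain B where B: "B \<ge> 0" "\<And>x. \<bar>\<phi> x\<bar> \<le> B" using Cc_inf_bounded[OF \<phi>] by blast
    define A where "A n y = (\<integral>x. \<phi> x * moll (r n) (x - y) \<partial>lborel)" for n y
    have pint: "integrable lborel (\<lambda>x. \<phi> x * moll (r n) (x - y))" for n y
      using integrable_mult_Cc_inf(1)[OF \<phi>i Cc_inf_affine[OF moll_Cc_inf[OF r(1)], of 1 n "- y"]]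
      by simp
    have Aeq: "A n = conv \<phi> (moll (r n))" for n
    proof
      fix y :: 'a
      have "moll (r n) (x - y) = moll (r n) (y - x)" for x
        using moll_minus[of "r n" "x - y"] by simp
      then show "A n y = conv \<phi> (moll (r n)) y" by (simp add: A_def conv_def)
    qed
    have Am[measurable]: "A n \<in> borel_measurable borel" for n
      unfolding Aeq
      by (intro borel_measurable_continuous_onI Cinf_on_continuous Cinf_on_conv \<phi>i moll_Cc_inf r)
    have AB: "\<bar>A n y\<bar> \<le> B" for n y
    proof -
      have m: "integrable lborel (\<lambda>x. moll (r n) (x - y))"
        using Cc_inf_integrable[OF Cc_inf_affine[OF moll_Cc_inf[OF r(1)], of 1 n "- y"]] by simp
      have "\<bar>(\<integral>x. \<phi> x * moll (r n) (x - y) \<partial>lborel) - 0\<bar> \<le> B"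
        by (rule average_close[OF m moll_nonneg[OF r(1)] integral_moll_shift(2)[OF r(1)] pint])
          (use B in simp)
      then show ?thesis by (simp add: A_def)
    qed
    have const: "(\<integral>x. ?f x * \<phi> x \<partial>lborel) = (\<integral>y. U y * A n y \<partial>lborel)" for n
    proof -
      obtain C where C: "\<And>z. \<bar>moll (r n) (z::'a)\<bar> \<le> C" using Cc_inf_bounded[OF moll_Cc_inf[OF r(1)]] by blast
      have "(\<integral>x. ?f x * \<phi> x \<partial>lborel) = (\<integral>x. \<phi> x * (\<integral>y. U y * moll (r n) (x - y) \<partial>lborel) \<partial>lborel)"
        unfolding feq[OF r[of n]] by (simp add: conv_def mult.commute)
      also have "\<dots> = (\<integral>y. U y * A n y \<partial>lborel)"
        unfolding A_def
        by (rule integral_swap_kernel[OF \<phi>i U Cc_inf_borel[OF moll_Cc_inf[OF r(1)]] C])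
      finally show ?thesis .
    qed
    have "(\<lambda>n. \<integral>y. U y * A n y \<partial>lborel) \<longlonglongrightarrow> (\<integral>y. U y * \<phi> y \<partial>lborel)"
    proof (rule integral_dominated_convergence[where w = "\<lambda>y. \<bar>U y\<bar> * B"])
      show "AE y in lborel. (\<lambda>n. U y * A n y) \<longlonglongrightarrow> U y * \<phi> y"
      proof (intro AE_I2 tendsto_mult tendsto_const)
        fix y
        have "isCont \<phi> y"
          using Cinf_on_continuous[OF Cc_inf_Cinf[OF \<phi>]] continuous_on_eq_continuous_at[OF open_UNIV] by blast
        from moll_conv_pointwise[OF pint this r(1) r0] show "(\<lambda>n. A n y) \<longlonglongrightarrow> \<phi> y" by (simp add: A_def)
      qed
      show "AE y in lborel. norm (U y * A n y) \<le> \<bar>U y\<bar> * B" for n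
        using AB by (intro AE_I2) (simp add: abs_mult mult_left_mono)
      show "(\<lambda>y. U y * A n y) \<in> borel_measurable lborel" for n
        using borel_measurable_integrable[OF U] by simp
    qed (use U int2 in auto)
    moreover have "(\<lambda>n. \<integral>y. U y * A n y \<partial>lborel) = (\<lambda>n. \<integral>x. ?f x * \<phi> x \<partial>lborel)"
      using const by simp
    ultimately have "(\<integral>x. ?f x * \<phi> x \<partial>lborel) = (\<integral>y. U y * \<phi> y \<partial>lborel)"
      using LIMSEQ_unique tendsto_const by metis
    then show ?thesis using int1 int2 by (simp add: left_diff_distrib)
  qed
  then have "AE x in lborel. x \<in> \<Omega> \<longrightarrow> ?f x - U x = 0"
    by (intro AE_zero_if_orthogonal_to_test_functions[OF \<Omega>(1)]) blast+
  then show ?thesis by eventually_elim simp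
qed

lemma harmonic_version_bound:
  assumes \<Omega>: "open \<Omega>" "bounded \<Omega>" and U: "U \<in> L2 lborel" and x: "x \<in> \<Omega>"
  shows "\<bar>harmonic_version \<Omega> U x\<bar> \<le> L2_norm lborel (\<lambda>y. moll (inner_radius \<Omega> x) (x - y)) * L2_norm lborel U"
proof -
  note r = inner_radius(1)[OF \<Omega> x]
  have k: "(\<lambda>y. moll (inner_radius \<Omega> x) (x - y)) \<in> Cc_inf UNIV"
    using Cc_inf_affine[OF moll_Cc_inf[OF r], of "-1" x] by simp
  have "(\<lambda>y. moll (inner_radius \<Omega> x) (x - y)) \<in> L2 lborel"
    using Cc_inf_borel[OF k] integrable_mult_Cc_inf(1)[OF Cc_inf_integrable[OF k] k]
    by (simp add: L2_def power2_eq_square)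
  from L2_Cauchy_Schwarz[OF this U] show ?thesis
    using x by (simp add: harmonic_version_def conv_def L2_inner_def mult.commute)
qed

lemma continuous_AE_eq_imp_eq:
  fixes f g :: "'a::euclidean_space \<Rightarrow> real"
  assumes \<Omega>: "open \<Omega>" and f: "continuous_on \<Omega> f" and g: "continuous_on \<Omega> g"
    and ae: "AE x in lebesgue_on \<Omega>. f x = g x" and x: "x \<in> \<Omega>"
  shows "f x = g x"
proof (rule ccontr)
  assume ne: "f x \<noteq> g x"
  define S where "S = \<Omega> \<inter> (\<lambda>x. f x - g x) -` (- {0})"
  have S: "open S" "x \<in> S" "S \<subseteq> \<Omega>"
    using continuous_open_preimage[OF continuous_on_diff[OF f g] \<Omega>, of "- {0}"] x ne
    by (auto simp: S_def)
  have "AE x in lborel. x \<notin> S"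
    using ae unfolding AE_lebesgue_on_iff[OF \<Omega>] by eventually_elim (auto simp: S_def)
  then have "S \<in> null_sets lborel" using S(1) by (simp add: AE_iff_null_sets)
  then have "negligible S" using null_sets_completionI negligible_iff_null_sets by blast
  then show False using open_not_negligible[OF S(1)] S(2) by blast
qed

text \<open>The condition that defines \<^const>\<open>L2H\<close>, but for smooth test functions only. The two agree on
  bounded open sets (\<open>L2H_iff_weakly_harmonic\<close> below).\<close>

definition weakly_harmonic :: "'a::euclidean_space set \<Rightarrow> ('a \<Rightarrow> real) \<Rightarrow> bool" where
  "weakly_harmonic \<Omega> u \<longleftrightarrow> u \<in> L2 (lebesgue_on \<Omega>) \<and>
     (\<forall>\<phi>\<in>Cc_inf \<Omega>. (\<integral>x. u x * laplacian \<phi> x \<partial>lebesgue_on \<Omega>) = 0)"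

definition evaluation_bound :: "'a::euclidean_space set \<Rightarrow> 'a \<Rightarrow> real" where
  "evaluation_bound \<Omega> x = L2_norm lborel (\<lambda>y. moll (inner_radius \<Omega> x) (x - y))"

text \<open>The bound on point values depends on \<open>u\<close> only through its norm: the value at \<open>x\<close> is the
  \<open>L\<^sup>2\<close> product of \<open>u\<close> with a mollifier centred at \<open>x\<close>.\<close>

theorem Weyl_lemma:
  assumes \<Omega>: "open \<Omega>" "bounded \<Omega>" and u: "weakly_harmonic \<Omega> u"
  shows "Cinf_on \<Omega> (Cinf_version \<Omega> u)" "\<And>x. x \<notin> \<Omega> \<Longrightarrow> Cinf_version \<Omega> u x = 0"
    "AE x in lebesgue_on \<Omega>. Cinf_version \<Omega> u x = u x"
    "\<And>x. x \<in> \<Omega> \<Longrightarrow> \<bar>Cinf_version \<Omega> u x\<bar> \<le> evaluation_bound \<Omega> x * L2_norm (lebesgue_on \<Omega>) u"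
    and Cinf_version_unique:
    "\<And>f. \<lbrakk>Cinf_on \<Omega> f; \<And>x. x \<notin> \<Omega> \<Longrightarrow> f x = 0; AE x in lebesgue_on \<Omega>. f x = u x\<rbrakk> \<Longrightarrow> Cinf_version \<Omega> u = f"
proof -
  have u2: "u \<in> L2 (lebesgue_on \<Omega>)" using u by (simp add: weakly_harmonic_def)
  obtain U where U: "borel_version \<Omega> u U" "U \<in> L2 lborel" "integrable lborel U"
    using L2_extension[OF \<Omega> u2] by blast
  have harm: "(\<integral>y. U y * laplacian \<phi> y \<partial>lborel) = 0" if "\<phi> \<in> Cc_inf \<Omega>" for \<phi>
    using u that integral_lebesgue_on_times_borel[OF \<Omega>(1) U(1) Cc_inf_borel[OF Cc_inf_laplacian[OF that]]]
    by (simp add: weakly_harmonic_def)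
  let ?f = "harmonic_version \<Omega> U"
  have f1: "Cinf_on \<Omega> ?f" by (rule Cinf_on_harmonic_version[OF \<Omega> U(3) harm])
  have f2: "?f x = 0" if "x \<notin> \<Omega>" for x using that by (simp add: harmonic_version_def)
  have "AE x in lebesgue_on \<Omega>. ?f x = U x"
    using AE_harmonic_version[OF \<Omega> U(3) harm] by (simp add: AE_lebesgue_on_iff[OF \<Omega>(1)])
  moreover have "AE x in lebesgue_on \<Omega>. u x = U x" using U(1) by (simp add: borel_version_def)
  ultimately have f3: "AE x in lebesgue_on \<Omega>. ?f x = u x" by eventually_elim simp
  have uniq: "g = h" if g: "Cinf_on \<Omega> g" "\<forall>x. x \<notin> \<Omega> \<longrightarrow> g x = 0" "AE x in lebesgue_on \<Omega>. g x = u x"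
    and h: "Cinf_on \<Omega> h" "\<forall>x. x \<notin> \<Omega> \<longrightarrow> h x = 0" "AE x in lebesgue_on \<Omega>. h x = u x" for g h
  proof
    fix x
    have "AE x in lebesgue_on \<Omega>. g x = h x" using g(3) h(3) by eventually_elim simp
    from continuous_AE_eq_imp_eq[OF \<Omega>(1) Cinf_on_continuous[OF g(1)] Cinf_on_continuous[OF h(1)] this]
    show "g x = h x" using g(2) h(2) by (cases "x \<in> \<Omega>") auto
  qed
  show un: "Cinf_version \<Omega> u = f"
    if "Cinf_on \<Omega> f" "\<And>x. x \<notin> \<Omega> \<Longrightarrow> f x = 0" "AE x in lebesgue_on \<Omega>. f x = u x" for f
    unfolding Cinf_version_def by (rule the_equality) (use that uniq in blast)+
  have e: "Cinf_version \<Omega> u = ?f" by (rule un[OF f1 f2 f3])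
  show "Cinf_on \<Omega> (Cinf_version \<Omega> u)" "\<And>x. x \<notin> \<Omega> \<Longrightarrow> Cinf_version \<Omega> u x = 0"
    "AE x in lebesgue_on \<Omega>. Cinf_version \<Omega> u x = u x"
    unfolding e using f1 f2 f3 by blast+
  have "L2_norm (lebesgue_on \<Omega>) u = L2_norm lborel U"
    unfolding L2_norm_def borel_version_L2_inner[OF \<Omega>(1) U(1) U(1)] ..
  then show "\<bar>Cinf_version \<Omega> u x\<bar> \<le> evaluation_bound \<Omega> x * L2_norm (lebesgue_on \<Omega>) u" if "x \<in> \<Omega>" for x
    using harmonic_version_bound[OF \<Omega> U(2) that] by (simp add: e evaluation_bound_def)
qed

section \<open>Weak derivatives\<close>

lemma Cc_inf_L2_lborel: "\<phi> \<in> Cc_inf \<Omega> \<Longrightarrow> \<phi> \<in> L2 lborel"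
  using Cc_inf_borel integrable_mult_Cc_inf(1)[OF Cc_inf_integrable]
  by (auto simp: L2_def power2_eq_square)

lemma Cc_inf_vanish:
  assumes "\<phi> \<in> Cc_inf \<Omega>" "x \<notin> \<Omega>" shows "\<phi> x = 0"
  using Cc_inf_support[OF assms(1)] assms(2) by (metis subsetD)

lemma Cc_inf_borel_version:
  assumes "open \<Omega>" "\<phi> \<in> Cc_inf \<Omega>" shows "borel_version \<Omega> \<phi> \<phi>"
  unfolding borel_version_def
  using Cc_inf_vanish[OF assms(2)] Cc_inf_borel[OF assms(2)]
    borel_measurable_lebesgue_onI[OF assms(1) Cc_inf_borel[OF assms(2)]] by auto

lemma Cc_inf_L2: "open \<Omega> \<Longrightarrow> \<phi> \<in> Cc_inf \<Omega> \<Longrightarrow> \<phi> \<in> L2 (lebesgue_on \<Omega>)"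
  using borel_version_L2[OF _ Cc_inf_borel_version] Cc_inf_L2_lborel by blast

lemma Cc_inf_L2_inner:
  "open \<Omega> \<Longrightarrow> \<phi> \<in> Cc_inf \<Omega> \<Longrightarrow> \<psi> \<in> Cc_inf \<Omega> \<Longrightarrow>
    L2_inner (lebesgue_on \<Omega>) \<phi> \<psi> = L2_inner lborel \<phi> \<psi>"
  using borel_version_L2_inner[OF _ Cc_inf_borel_version Cc_inf_borel_version] by blast

lemma finite_measure_lebesgue_on_bounded:
  assumes "open \<Omega>" "bounded \<Omega>" shows "finite_measure (lebesgue_on \<Omega>)"
  using assms by (intro finite_measure_lebesgue_on bounded_set_imp_lmeasurable) auto

lemma continuous_L2:
  fixes f :: "'a::euclidean_space \<Rightarrow> real"
  assumes \<Omega>: "open \<Omega>" "bounded \<Omega>" and f: "continuous_on UNIV f"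
  shows "f \<in> L2 (lebesgue_on \<Omega>)"
proof -
  interpret finite_measure "lebesgue_on \<Omega>" by (rule finite_measure_lebesgue_on_bounded[OF \<Omega>])
  have m: "f \<in> borel_measurable (lebesgue_on \<Omega>)"
    by (intro borel_measurable_lebesgue_onI \<Omega> borel_measurable_continuous_onI f)
  have "compact (closure \<Omega>)" using \<Omega>(2) by simp
  then have "bounded (f ` closure \<Omega>)"
    using f by (intro compact_imp_bounded compact_continuous_image) (auto intro: continuous_on_subset)
  then obtain B where B: "\<And>x. x \<in> closure \<Omega> \<Longrightarrow> \<bar>f x\<bar> \<le> B" by (auto simp: bounded_iff)
  show ?thesis by (rule bounded_L2[OF m, of B]) (use B closure_subset in auto)
qed

text \<open>Weak derivatives are unique almost everywhere because of this, so that the choices of a weak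
  gradient and a weak Laplacian can be replaced by any known ones.\<close>

lemma L2_eq_if_same_pairings:
  assumes \<Omega>: "open \<Omega>" "bounded \<Omega>" and p: "p \<in> L2 (lebesgue_on \<Omega>)" and q: "q \<in> L2 (lebesgue_on \<Omega>)"
    and eq: "\<And>\<phi>. \<phi> \<in> Cc_inf \<Omega> \<Longrightarrow> (\<integral>x. p x * \<phi> x \<partial>lebesgue_on \<Omega>) = (\<integral>x. q x * \<phi> x \<partial>lebesgue_on \<Omega>)"
  shows "AE x in lebesgue_on \<Omega>. p x = q x"
proof -
  have pq: "(\<lambda>x. p x - q x) \<in> L2 (lebesgue_on \<Omega>)" by (rule L2_diff[OF p q])
  obtain D where D: "borel_version \<Omega> (\<lambda>x. p x - q x) D" "D \<in> L2 lborel" "integrable lborel D"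
    using L2_extension[OF \<Omega> pq] by blast
  have "AE x in lborel. x \<in> \<Omega> \<longrightarrow> D x = 0"
  proof (rule AE_zero_if_orthogonal_to_test_functions[OF \<Omega>(1)])
    fix \<phi> assume \<phi>: "\<phi> \<in> Cc_inf \<Omega>"
    show "integrable lborel (\<lambda>x. D x * \<phi> x)" by (rule integrable_mult_Cc_inf(1)[OF D(3) \<phi>])
    have "(\<integral>x. D x * \<phi> x \<partial>lborel) = (\<integral>x. (p x - q x) * \<phi> x \<partial>lebesgue_on \<Omega>)"
      by (rule integral_lebesgue_on_times_borel[OF \<Omega>(1) D(1) Cc_inf_borel[OF \<phi>], symmetric])
    also have "\<dots> = 0"
      using eq[OF \<phi>] L2_mult_integrable[OF p Cc_inf_L2[OF \<Omega>(1) \<phi>]]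
        L2_mult_integrable[OF q Cc_inf_L2[OF \<Omega>(1) \<phi>]] by (simp add: left_diff_distrib)
    finally show "(\<integral>x. D x * \<phi> x \<partial>lborel) = 0" .
  qed
  then have "AE x in lebesgue_on \<Omega>. D x = 0" by (simp add: AE_lebesgue_on_iff[OF \<Omega>(1)])
  moreover have "AE x in lebesgue_on \<Omega>. p x - q x = D x" using D(1) by (simp add: borel_version_def)
  ultimately show ?thesis by eventually_elim simp
qed

lemma has_weak_grad_weak_grad: "has_weak_grad \<Omega> u G \<Longrightarrow> has_weak_grad \<Omega> u (weak_grad \<Omega> u)"
  unfolding weak_grad_def by (rule someI[of "has_weak_grad \<Omega> u"])

lemma weak_grad_AE:
  assumes \<Omega>: "open \<Omega>" "bounded \<Omega>" and G: "has_weak_grad \<Omega> u G"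
  shows "AE x in lebesgue_on \<Omega>. weak_grad \<Omega> u x = G x"
proof -
  have W: "has_weak_grad \<Omega> u (weak_grad \<Omega> u)" by (rule has_weak_grad_weak_grad[OF G])
  have "AE x in lebesgue_on \<Omega>. weak_grad \<Omega> u x \<bullet> i = G x \<bullet> i" if "i \<in> Basis" for i
  proof (rule L2_eq_if_same_pairings[OF \<Omega>])
    show "(\<lambda>x. weak_grad \<Omega> u x \<bullet> i) \<in> L2 (lebesgue_on \<Omega>)" "(\<lambda>x. G x \<bullet> i) \<in> L2 (lebesgue_on \<Omega>)"
      using W G that by (auto simp: has_weak_grad_def)
    fix \<phi> assume "\<phi> \<in> Cc_inf \<Omega>"
    then have "(\<integral>x. u x * partial i \<phi> x \<partial>lebesgue_on \<Omega>) = - (\<integral>x. (weak_grad \<Omega> u x \<bullet> i) * \<phi> x \<partial>lebesgue_on \<Omega>)"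
      "(\<integral>x. u x * partial i \<phi> x \<partial>lebesgue_on \<Omega>) = - (\<integral>x. (G x \<bullet> i) * \<phi> x \<partial>lebesgue_on \<Omega>)"
      using W G that unfolding has_weak_grad_def by blast+
    then show "(\<integral>x. (weak_grad \<Omega> u x \<bullet> i) * \<phi> x \<partial>lebesgue_on \<Omega>) = (\<integral>x. (G x \<bullet> i) * \<phi> x \<partial>lebesgue_on \<Omega>)"
      by linarith
  qed
  then have "AE x in lebesgue_on \<Omega>. \<forall>i\<in>Basis. weak_grad \<Omega> u x \<bullet> i = G x \<bullet> i"
    by (intro AE_finite_allI) auto
  then show ?thesis by eventually_elim (rule euclidean_eqI, blast)
qed

lemma has_weak_lap_weak_lap: "has_weak_lap \<Omega> u w \<Longrightarrow> has_weak_lap \<Omega> u (weak_lap \<Omega> u)"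
  unfolding weak_lap_def by (rule someI[of "has_weak_lap \<Omega> u"])

lemma weak_lap_AE:
  assumes \<Omega>: "open \<Omega>" "bounded \<Omega>" and w: "has_weak_lap \<Omega> u w"
  shows "AE x in lebesgue_on \<Omega>. weak_lap \<Omega> u x = w x"
  by (rule L2_eq_if_same_pairings[OF \<Omega>])
    (use w has_weak_lap_weak_lap[OF w] in \<open>auto simp: has_weak_lap_def\<close>)

definition gradient :: "('a::euclidean_space \<Rightarrow> real) \<Rightarrow> 'a \<Rightarrow> 'a" where
  "gradient f x = (\<Sum>i\<in>Basis. partial i f x *\<^sub>R i)"

lemma gradient_inner: "i \<in> Basis \<Longrightarrow> gradient f x \<bullet> i = partial i f x"
  by (simp add: gradient_def inner_sum_left inner_Basis if_distrib cong: if_cong)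

lemma integral_by_parts_lebesgue_on:
  assumes \<Omega>: "open \<Omega>" and f: "Cinf_on UNIV f" and \<phi>: "\<phi> \<in> Cc_inf \<Omega>" and i: "i \<in> Basis"
  shows "(\<integral>x. f x * partial i \<phi> x \<partial>lebesgue_on \<Omega>) = - (\<integral>x. partial i f x * \<phi> x \<partial>lebesgue_on \<Omega>)"
proof -
  have b: "g \<in> borel_measurable borel" if "Cinf_on UNIV g" for g :: "'a \<Rightarrow> real"
    by (intro borel_measurable_continuous_onI Cinf_on_continuous that)
  obtain K where K: "compact K" "\<And>x. x \<notin> K \<Longrightarrow> \<phi> x = 0" using Cc_inf_support[OF \<phi>] by metis
  have "(\<integral>x. partial i \<phi> x * f x \<partial>lebesgue_on \<Omega>) = (\<integral>x. partial i \<phi> x * f x \<partial>lborel)"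
    by (rule integral_lebesgue_on_times_borel[OF \<Omega> Cc_inf_borel_version[OF \<Omega> Cc_inf_partial[OF \<phi> i]] b[OF f]])
  moreover have "(\<integral>x. \<phi> x * partial i f x \<partial>lebesgue_on \<Omega>) = (\<integral>x. \<phi> x * partial i f x \<partial>lborel)"
    by (rule integral_lebesgue_on_times_borel[OF \<Omega> Cc_inf_borel_version[OF \<Omega> \<phi>]
          b[OF Cinf_on_partial[OF f i]]])
  moreover have "(\<integral>x. f x * partial i \<phi> x \<partial>lborel) = - (\<integral>x. partial i f x * \<phi> x \<partial>lborel)"
    by (rule integration_by_parts[OF Cinf_on_imp_Ck_on[OF f] Cinf_on_imp_Ck_on[OF Cc_inf_Cinf[OF \<phi>]] K i])
  ultimately show ?thesis by (simp add: mult.commute)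
qed

lemma has_weak_grad_smooth:
  assumes \<Omega>: "open \<Omega>" "bounded \<Omega>" and f: "Cinf_on UNIV f"
  shows "has_weak_grad \<Omega> f (gradient f)"
  unfolding has_weak_grad_def
  using continuous_L2[OF \<Omega> Cinf_on_continuous[OF Cinf_on_partial[OF f]]]
    integral_by_parts_lebesgue_on[OF \<Omega>(1) f]
  by (auto simp: gradient_inner)

lemma smooth_H1:
  assumes "open \<Omega>" "bounded \<Omega>" "Cinf_on UNIV f"
  shows "f \<in> H1 \<Omega>"
  unfolding H1_def using has_weak_grad_smooth[OF assms] continuous_L2[OF assms(1,2) Cinf_on_continuous[OF assms(3)]]
  by blast

lemma has_weak_grad_diff:
  assumes \<Omega>: "open \<Omega>" and u: "u \<in> L2 (lebesgue_on \<Omega>)" "has_weak_grad \<Omega> u G"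
    and v: "v \<in> L2 (lebesgue_on \<Omega>)" "has_weak_grad \<Omega> v H"
  shows "has_weak_grad \<Omega> (\<lambda>x. u x - v x) (\<lambda>x. G x - H x)"
  unfolding has_weak_grad_def
proof (intro ballI conjI)
  fix i :: 'a assume i: "i \<in> Basis"
  have GH: "(\<lambda>x. G x \<bullet> i) \<in> L2 (lebesgue_on \<Omega>)" "(\<lambda>x. H x \<bullet> i) \<in> L2 (lebesgue_on \<Omega>)"
    using u(2) v(2) i by (auto simp: has_weak_grad_def)
  show "(\<lambda>x. (G x - H x) \<bullet> i) \<in> L2 (lebesgue_on \<Omega>)"
    using L2_diff[OF GH] by (simp add: inner_diff_left)
  fix \<phi> assume \<phi>: "\<phi> \<in> Cc_inf \<Omega>"
  note a = Cc_inf_L2[OF \<Omega> \<phi>] Cc_inf_L2[OF \<Omega> Cc_inf_partial[OF \<phi> i]]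
  have "(\<integral>x. u x * partial i \<phi> x \<partial>lebesgue_on \<Omega>) = - (\<integral>x. (G x \<bullet> i) * \<phi> x \<partial>lebesgue_on \<Omega>)"
    "(\<integral>x. v x * partial i \<phi> x \<partial>lebesgue_on \<Omega>) = - (\<integral>x. (H x \<bullet> i) * \<phi> x \<partial>lebesgue_on \<Omega>)"
    using u(2) v(2) i \<phi> by (auto simp: has_weak_grad_def)
  then show "(\<integral>x. (u x - v x) * partial i \<phi> x \<partial>lebesgue_on \<Omega>) = - (\<integral>x. ((G x - H x) \<bullet> i) * \<phi> x \<partial>lebesgue_on \<Omega>)"
    using L2_mult_integrable[OF u(1) a(2)] L2_mult_integrable[OF v(1) a(2)]
      L2_mult_integrable[OF GH(1) a(1)] L2_mult_integrable[OF GH(2) a(1)]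
    by (simp add: left_diff_distrib inner_diff_left)
qed

lemma H1_norm_power2:
  assumes \<Omega>: "open \<Omega>" "bounded \<Omega>" and u: "u \<in> L2 (lebesgue_on \<Omega>)" and G: "has_weak_grad \<Omega> u G"
  shows "(H1_norm \<Omega> u)\<^sup>2 = (L2_norm (lebesgue_on \<Omega>) u)\<^sup>2
    + (\<Sum>i\<in>Basis. (L2_norm (lebesgue_on \<Omega>) (\<lambda>x. G x \<bullet> i))\<^sup>2)"
proof -
  have Gi: "(\<lambda>x. G x \<bullet> i) \<in> L2 (lebesgue_on \<Omega>)" if "i \<in> Basis" for i
    using G that by (auto simp: has_weak_grad_def)
  have W: "has_weak_grad \<Omega> u (weak_grad \<Omega> u)" by (rule has_weak_grad_weak_grad[OF G])
  have Wi: "(\<lambda>x. weak_grad \<Omega> u x \<bullet> i) \<in> L2 (lebesgue_on \<Omega>)" if "i \<in> Basis" for i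
    using W that by (auto simp: has_weak_grad_def)
  have ns: "(norm y)\<^sup>2 = (\<Sum>i\<in>Basis. (y \<bullet> i)\<^sup>2)" for y :: 'a
    unfolding power2_norm_eq_inner by (subst euclidean_inner) (simp add: power2_eq_square)
  have "(\<integral>x. (u x)\<^sup>2 + (norm (weak_grad \<Omega> u x))\<^sup>2 \<partial>lebesgue_on \<Omega>)
      = (\<integral>x. (u x)\<^sup>2 + (\<Sum>i\<in>Basis. (G x \<bullet> i)\<^sup>2) \<partial>lebesgue_on \<Omega>)"
  proof (rule integral_cong_AE)
    show "(\<lambda>x. (u x)\<^sup>2 + (norm (weak_grad \<Omega> u x))\<^sup>2) \<in> borel_measurable (lebesgue_on \<Omega>)"
      unfolding ns using L2_measurable[OF u] L2_measurable[OF Wi] by simp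
    show "(\<lambda>x. (u x)\<^sup>2 + (\<Sum>i\<in>Basis. (G x \<bullet> i)\<^sup>2)) \<in> borel_measurable (lebesgue_on \<Omega>)"
      using L2_measurable[OF u] L2_measurable[OF Gi] by simp
    show "AE x in lebesgue_on \<Omega>. (u x)\<^sup>2 + (norm (weak_grad \<Omega> u x))\<^sup>2 = (u x)\<^sup>2 + (\<Sum>i\<in>Basis. (G x \<bullet> i)\<^sup>2)"
      using weak_grad_AE[OF \<Omega> G] by eventually_elim (simp add: ns)
  qed
  also have "\<dots> = (\<integral>x. (u x)\<^sup>2 \<partial>lebesgue_on \<Omega>) + (\<Sum>i\<in>Basis. \<integral>x. (G x \<bullet> i)\<^sup>2 \<partial>lebesgue_on \<Omega>)"
    using L2_sq_integrable[OF u] L2_sq_integrable[OF Gi] by simp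
  finally have e: "(\<integral>x. (u x)\<^sup>2 + (norm (weak_grad \<Omega> u x))\<^sup>2 \<partial>lebesgue_on \<Omega>)
    = (L2_norm (lebesgue_on \<Omega>) u)\<^sup>2 + (\<Sum>i\<in>Basis. (L2_norm (lebesgue_on \<Omega>) (\<lambda>x. G x \<bullet> i))\<^sup>2)"
    by (simp only: L2_norm_power2 L2_inner_def power2_eq_square[symmetric])
  show ?thesis unfolding H1_norm_def e by (intro real_sqrt_pow2 add_nonneg_nonneg sum_nonneg) auto
qed

section \<open>The Dirichlet problem\<close>

text \<open>Riesz representation without completeness: minimising \<open>B f f - 2 L f\<close> over a vector space of
  functions gives a Cauchy sequence, in the seminorm of \<open>B\<close>, that represents \<open>L\<close> in the limit.\<close>

lemma approximate_Riesz:
  fixes V :: "('x \<Rightarrow> real) set" and B :: "('x \<Rightarrow> real) \<Rightarrow> ('x \<Rightarrow> real) \<Rightarrow> real"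
  assumes V0: "(\<lambda>x. 0) \<in> V"
    and Vadd: "\<And>f g. f \<in> V \<Longrightarrow> g \<in> V \<Longrightarrow> (\<lambda>x. f x + g x) \<in> V"
    and Vc: "\<And>c f. f \<in> V \<Longrightarrow> (\<lambda>x. c * f x) \<in> V"
    and Badd: "\<And>f g h. f \<in> V \<Longrightarrow> g \<in> V \<Longrightarrow> h \<in> V \<Longrightarrow> B (\<lambda>x. f x + g x) h = B f h + B g h"
    and Bc: "\<And>c f h. f \<in> V \<Longrightarrow> h \<in> V \<Longrightarrow> B (\<lambda>x. c * f x) h = c * B f h"
    and Bsym: "\<And>f h. B f h = B h f"
    and Bpos: "\<And>f. B f f \<ge> 0"
    and Ladd: "\<And>f g. f \<in> V \<Longrightarrow> g \<in> V \<Longrightarrow> L (\<lambda>x. f x + g x) = L f + (L g :: real)"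
    and Lc: "\<And>c f. f \<in> V \<Longrightarrow> L (\<lambda>x. c * f x) = c * L f"
    and bd: "\<And>f. f \<in> V \<Longrightarrow> (L f)\<^sup>2 \<le> C * B f f" and C: "C \<ge> 0"
  obtains v where "\<And>n. v n \<in> V"
    "\<And>e. e > 0 \<Longrightarrow> \<exists>N. \<forall>m\<ge>N. \<forall>n\<ge>N. B (\<lambda>x. v m x - v n x) (\<lambda>x. v m x - v n x) < e"
    "\<And>\<psi>. \<psi> \<in> V \<Longrightarrow> (\<lambda>n. B (v n) \<psi>) \<longlonglongrightarrow> L \<psi>"
proof -
  define J where "J f = B f f - 2 * L f" for f
  have expand: "J (\<lambda>x. f x + t * g x) = J f + 2 * t * (B f g - L g) + t\<^sup>2 * B g g"
    if f: "f \<in> V" and g: "g \<in> V" for f g t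
  proof -
    note tg = Vc[OF g, of t]
    have 1: "B (\<lambda>x. f x + t * g x) h = B f h + t * B g h" if "h \<in> V" for h
      using Badd[OF f tg that] Bc[OF g that, of t] by simp
    have "B (\<lambda>x. f x + t * g x) (\<lambda>x. f x + t * g x)
        = B f (\<lambda>x. f x + t * g x) + t * B g (\<lambda>x. f x + t * g x)" by (rule 1[OF Vadd[OF f tg]])
    also have "B f (\<lambda>x. f x + t * g x) = B f f + t * B g f" using 1[OF f] Bsym by metis
    also have "B g (\<lambda>x. f x + t * g x) = B f g + t * B g g" using 1[OF g] Bsym by metis
    also have "B g f = B f g" by (rule Bsym)
    finally have "B (\<lambda>x. f x + t * g x) (\<lambda>x. f x + t * g x) = B f f + 2 * t * B f g + t\<^sup>2 * B g g"
      by (simp add: algebra_simps power2_eq_square)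
    moreover have "L (\<lambda>x. f x + t * g x) = L f + t * L g" using Ladd[OF f tg] Lc[OF g, of t] by simp
    ultimately show ?thesis by (simp add: J_def algebra_simps)
  qed
  have lower: "- C \<le> J f" if f: "f \<in> V" for f
  proof -
    have "(L f)\<^sup>2 \<le> C * B f f" by (rule bd[OF f])
    also have "\<dots> \<le> ((C + B f f) / 2)\<^sup>2"
      using sum_squares_bound[of C "B f f"] by (simp add: power2_eq_square algebra_simps)
    finally have "\<bar>L f\<bar> \<le> \<bar>(C + B f f) / 2\<bar>" by (simp only: abs_le_square_iff)
    then show ?thesis using C Bpos[of f] by (simp add: J_def)
  qed
  define m where "m = Inf (J ` V)"
  have bdd: "bdd_below (J ` V)" using lower by (intro bdd_belowI[of _ "- C"]) auto
  have m: "m \<le> J f" if "f \<in> V" for f unfolding m_def using bdd that by (intro cInf_lower) auto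
  have "\<exists>f\<in>V. J f < m + 1 / (real n + 1)" for n
  proof -
    have "Inf (J ` V) < m + 1 / (real n + 1)" by (simp add: m_def)
    then show ?thesis using cInf_lessD[of "J ` V"] V0 by auto
  qed
  then obtain v where v: "\<And>n. v n \<in> V" "\<And>n. J (v n) < m + 1 / (real n + 1)" by metis
  \<comment> \<open>By the parallelogram identity near-minimisers are close to each other.\<close>
  have par: "B (\<lambda>x. f x - g x) (\<lambda>x. f x - g x) \<le> 2 * (J f - m) + 2 * (J g - m)"
    if f: "f \<in> V" and g: "g \<in> V" for f g
  proof -
    have 0: "J f = B f f - 2 * L f" "J g = B g g - 2 * L g" by (simp_all add: J_def)
    have 1: "J (\<lambda>x. f x + (-1) * g x) = J f + 2 * (-1) * (B f g - L g) + (-1)\<^sup>2 * B g g"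
      by (rule expand[OF f g])
    have Lm: "L (\<lambda>x. f x + (-1) * g x) = L f - L g" using Ladd[OF f Vc[OF g, of "-1"]] Lc[OF g, of "-1"] by simp
    have "m \<le> J (\<lambda>x. (1/2) * f x + (1/2) * g x)" by (intro m Vadd Vc f g)
    also have "\<dots> = J (\<lambda>x. (1/2) * f x) + 2 * (1/2) * (B (\<lambda>x. (1/2) * f x) g - L g) + (1/2)\<^sup>2 * B g g"
      by (rule expand[OF Vc[OF f] g])
    also have "B (\<lambda>x. (1/2) * f x) g = (1/2) * B f g" by (rule Bc[OF f g])
    also have "J (\<lambda>x. (1/2) * f x) = (1/4) * B f f - L f"
      using Bc[OF f Vc[OF f, of "1/2"], of "1/2"] Bc[OF f f, of "1/2"] Bsym[of f "\<lambda>x. (1/2) * f x"]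
        Lc[OF f, of "1/2"] by (simp add: J_def)
    finally have "4 * m \<le> B f f + B g g + 2 * B f g - 4 * L f - 4 * L g"
      by (simp add: power2_eq_square algebra_simps)
    moreover have "B (\<lambda>x. f x - g x) (\<lambda>x. f x - g x) = B f f - 2 * B f g + B g g"
      using 1 Lm 0 by (simp add: J_def algebra_simps)
    ultimately show ?thesis using 0 by simp
  qed
  show ?thesis
  proof
    show "v n \<in> V" for n by (rule v(1))
  next
    fix e :: real assume e: "e > 0"
    obtain N :: nat where N: "4 / e < real N" using reals_Archimedean2 by blast
    have "B (\<lambda>x. v k x - v n x) (\<lambda>x. v k x - v n x) < e" if kn: "k \<ge> N" "n \<ge> N" for k n
    proof -
      have small: "1 / (real j + 1) < e / 4" if "j \<ge> N" for j :: nat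
      proof -
        have "4 / e < real j + 1" using N that by linarith
        then show ?thesis using e by (simp add: field_simps)
      qed
      have "J (v k) < m + e / 4" "J (v n) < m + e / 4"
        by (rule less_trans[OF v(2) add_strict_left_mono[OF small]]; rule kn)+
      then show ?thesis using par[OF v(1)[of k] v(1)[of n]] by argo
    qed
    then show "\<exists>N. \<forall>m\<ge>N. \<forall>n\<ge>N. B (\<lambda>x. v m x - v n x) (\<lambda>x. v m x - v n x) < e" by blast
  next
    fix \<psi> assume \<psi>: "\<psi> \<in> V"
    \<comment> \<open>The first variation at a near-minimiser is small, as \<open>J (v n + t \<psi>) \<ge> m\<close> for all \<open>t\<close>.\<close>
    have sq: "(B (v n) \<psi> - L \<psi>)\<^sup>2 \<le> (1 / (real n + 1)) * B \<psi> \<psi>" for n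
    proof -
      have "(B (v n) \<psi> - L \<psi>)\<^sup>2 \<le> (J (v n) - m) * B \<psi> \<psi>"
      proof (rule quadratic_nonneg_imp_discriminant[OF _ Bpos])
        fix t
        have "m \<le> J (\<lambda>x. v n x + t * \<psi> x)" by (intro m Vadd Vc v(1) \<psi>)
        then show "0 \<le> J (v n) - m + 2 * t * (B (v n) \<psi> - L \<psi>) + t\<^sup>2 * B \<psi> \<psi>"
          unfolding expand[OF v(1) \<psi>] by simp
      qed
      also have "\<dots> \<le> (1 / (real n + 1)) * B \<psi> \<psi>"
        using v(2)[of n] by (intro mult_right_mono Bpos) simp
      finally show ?thesis .
    qed
    have "(\<lambda>n. (1 / (real n + 1)) * B \<psi> \<psi>) \<longlonglongrightarrow> 0 * B \<psi> \<psi>"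
      using LIMSEQ_inverse_real_of_nat by (intro tendsto_mult tendsto_const) (simp add: inverse_eq_divide add.commute)
    then have "(\<lambda>n. (B (v n) \<psi> - L \<psi>)\<^sup>2) \<longlonglongrightarrow> 0"
      by (intro Lim_null_comparison[of "\<lambda>n. (B (v n) \<psi> - L \<psi>)\<^sup>2" "\<lambda>n. (1 / (real n + 1)) * B \<psi> \<psi>"])
        (use sq in auto)
    then have "(\<lambda>n. B (v n) \<psi> - L \<psi>) \<longlonglongrightarrow> 0" by simp
    then show "(\<lambda>n. B (v n) \<psi>) \<longlonglongrightarrow> L \<psi>" using LIM_zero_iff by blast
  qed
qed

text \<open>Integration by parts of \<open>\<phi>\<^sup>2\<close> against the coordinate function \<open>x \<bullet> i\<close>, whose partial derivative
  is \<open>1\<close>, followed by the Cauchy--Schwarz inequality.\<close>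

lemma Poincare_inequality:
  assumes R: "\<And>x. x \<in> \<Omega> \<Longrightarrow> norm x \<le> R" "R \<ge> 0" and \<phi>: "\<phi> \<in> Cc_inf \<Omega>" and i: "i \<in> Basis"
  shows "L2_norm lborel \<phi> \<le> 2 * R * L2_norm lborel (partial i \<phi>)"
proof -
  let ?N = "L2_norm (lborel :: 'a measure)"
  have lin: "Cinf_on UNIV (\<lambda>x. x \<bullet> i)" by (intro Cinf_on_linear bounded_linear_inner_left)
  have x\<phi>: "(\<lambda>x. (x \<bullet> i) * \<phi> x) \<in> Cc_inf \<Omega>" by (rule Cc_inf_mult(2)[OF \<phi> lin])
  have sq: "(\<lambda>x. \<phi> x * \<phi> x) \<in> Cc_inf \<Omega>" by (rule Cc_inf_mult(1)[OF \<phi> Cc_inf_Cinf[OF \<phi>]])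
  obtain K where K: "compact K" "\<And>x. x \<notin> K \<Longrightarrow> \<phi> x * \<phi> x = 0" using Cc_inf_support[OF sq] by metis
  note d = Cinf_on_differentiable[OF Cc_inf_Cinf[OF \<phi>]]
  have "(\<integral>x. (x \<bullet> i) * partial i (\<lambda>x. \<phi> x * \<phi> x) x \<partial>lborel)
      = - (\<integral>x. partial i (\<lambda>x. x \<bullet> i) x * (\<phi> x * \<phi> x) \<partial>lborel)"
    by (rule integration_by_parts[OF Cinf_on_imp_Ck_on[OF lin] Cinf_on_imp_Ck_on[OF Cc_inf_Cinf[OF sq]] K i])
  moreover have "partial i (\<lambda>x. x \<bullet> i) x = 1" for x :: 'a
    using partial_linear[OF bounded_linear_inner_left, of i i x] i by simp
  moreover have "partial i (\<lambda>x. \<phi> x * \<phi> x) x = 2 * (\<phi> x * partial i \<phi> x)" for x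
    using partial_mult[OF d d, of x] by simp
  ultimately have "L2_inner lborel \<phi> \<phi> = - 2 * L2_inner lborel (\<lambda>x. (x \<bullet> i) * \<phi> x) (partial i \<phi>)"
    by (simp add: L2_inner_def mult.assoc mult.left_commute[of _ 2])
  then have "(?N \<phi>)\<^sup>2 \<le> 2 * \<bar>L2_inner lborel (\<lambda>x. (x \<bullet> i) * \<phi> x) (partial i \<phi>)\<bar>"
    by (simp add: L2_norm_power2)
  also have "\<dots> \<le> 2 * (?N (\<lambda>x. (x \<bullet> i) * \<phi> x) * ?N (partial i \<phi>))"
    using L2_Cauchy_Schwarz[OF Cc_inf_L2_lborel[OF x\<phi>] Cc_inf_L2_lborel[OF Cc_inf_partial[OF \<phi> i]]] by simp
  also have "?N (\<lambda>x. (x \<bullet> i) * \<phi> x) \<le> R * ?N \<phi>"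
  proof -
    have "L2_inner lborel (\<lambda>x. (x \<bullet> i) * \<phi> x) (\<lambda>x. (x \<bullet> i) * \<phi> x) \<le> (\<integral>x. R\<^sup>2 * (\<phi> x * \<phi> x) \<partial>lborel)"
      unfolding L2_inner_def
    proof (rule integral_mono)
      show "integrable lborel (\<lambda>x. (x \<bullet> i) * \<phi> x * ((x \<bullet> i) * \<phi> x))"
        using L2_mult_integrable[OF Cc_inf_L2_lborel[OF x\<phi>] Cc_inf_L2_lborel[OF x\<phi>]] .
      show "integrable lborel (\<lambda>x. R\<^sup>2 * (\<phi> x * \<phi> x))" using Cc_inf_integrable[OF sq] by simp
      fix x
      show "(x \<bullet> i) * \<phi> x * ((x \<bullet> i) * \<phi> x) \<le> R\<^sup>2 * (\<phi> x * \<phi> x)"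
      proof (cases "x \<in> \<Omega>")
        case True
        have "\<bar>x \<bullet> i\<bar> \<le> R" using Basis_le_norm[OF i, of x] R(1)[OF True] by linarith
        then have "\<bar>x \<bullet> i\<bar>\<^sup>2 \<le> R\<^sup>2" by (rule power_mono) simp
        then have "(x \<bullet> i)\<^sup>2 * (\<phi> x * \<phi> x) \<le> R\<^sup>2 * (\<phi> x * \<phi> x)" by (intro mult_right_mono) auto
        then show ?thesis by (simp add: power2_eq_square ac_simps)
      qed (simp add: Cc_inf_vanish[OF \<phi>])
    qed
    also have "\<dots> = (R * ?N \<phi>)\<^sup>2"
      by (simp add: power_mult_distrib L2_norm_power2 L2_inner_def)
    finally have "(?N (\<lambda>x. (x \<bullet> i) * \<phi> x))\<^sup>2 \<le> (R * ?N \<phi>)\<^sup>2" by (simp only: L2_norm_power2)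
    then show ?thesis by (rule power2_le_imp_le) (simp add: R L2_norm_nonneg)
  qed
  finally have le: "(?N \<phi>)\<^sup>2 \<le> 2 * (R * ?N \<phi> * ?N (partial i \<phi>))"
    by (simp add: mult_right_mono L2_norm_nonneg)
  show ?thesis
  proof (cases "?N \<phi> = 0")
    case True
    then show ?thesis using R(2) by (simp add: L2_norm_nonneg)
  next
    case False
    then have "?N \<phi> > 0" using L2_norm_nonneg[of lborel \<phi>] by linarith
    moreover have "?N \<phi> * ?N \<phi> \<le> ?N \<phi> * (2 * R * ?N (partial i \<phi>))"
      using le by (simp add: power2_eq_square ac_simps)
    ultimately show ?thesis by simp
  qed
qed


text \<open>The Dirichlet energy represents \<open>\<phi> \<mapsto> - \<integral> u \<phi>\<close> along a sequence of test functions that is Cauchy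
  for the energy; by the Poincare inequality the functions and their partial derivatives converge in
  \<open>L\<^sup>2\<close>. The approximating sequence is kept in the statement, because it also extends integration by
  parts for \<open>w\<close> to functions that do not vanish on the boundary.\<close>

lemma Dirichlet_problem:
  fixes u :: "'a::euclidean_space \<Rightarrow> real"
  assumes \<Omega>: "open \<Omega>" "bounded \<Omega>" and u: "u \<in> L2 (lebesgue_on \<Omega>)"
  obtains w G v where "w \<in> L2 (lebesgue_on \<Omega>)" "has_weak_grad \<Omega> w G" "has_weak_lap \<Omega> w u"
    "w \<in> H0_Lap \<Omega>" "\<And>n. v n \<in> Cc_inf \<Omega>"
    "(\<lambda>n. L2_norm (lebesgue_on \<Omega>) (\<lambda>x. v n x - w x)) \<longlonglongrightarrow> 0"
    "\<And>i. i \<in> Basis \<Longrightarrow> (\<lambda>n. L2_norm (lebesgue_on \<Omega>) (\<lambda>x. partial i (v n) x - G x \<bullet> i)) \<longlonglongrightarrow> 0"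
proof -
  let ?M = "lebesgue_on \<Omega>"
  interpret M: finite_measure ?M by (rule finite_measure_lebesgue_on_bounded[OF \<Omega>])
  note L2t = Cc_inf_L2[OF \<Omega>(1)]
  obtain R where "R > 0" "\<forall>x\<in>\<Omega>. norm x \<le> R" using \<Omega>(2) bounded_pos by blast
  then have R: "\<And>x. x \<in> \<Omega> \<Longrightarrow> norm x \<le> R" "R \<ge> 0" by auto
  define B where "B f g = (\<Sum>i\<in>Basis. L2_inner ?M (partial i f) (partial i g))" for f g :: "'a \<Rightarrow> real"
  define L where "L f = - L2_inner ?M u f" for f
  obtain i0 :: 'a where i0: "i0 \<in> Basis" using nonempty_Basis by blast
  have d: "f differentiable (at x)" if "f \<in> Cc_inf \<Omega>" for f x
    using Cinf_on_differentiable[OF Cc_inf_Cinf[OF that]] by simp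
  have padd: "partial i (\<lambda>x. f x + g x) = (\<lambda>x. partial i f x + partial i g x)"
    if "f \<in> Cc_inf \<Omega>" "g \<in> Cc_inf \<Omega>" for f g i using partial_add[OF d d] that by blast
  have pc: "partial i (\<lambda>x. c * f x) = (\<lambda>x. c * partial i f x)" if "f \<in> Cc_inf \<Omega>" for f c i
    using partial_cmult[OF d] that by blast
  have cdiff: "(\<lambda>x. f x - g x) \<in> Cc_inf \<Omega>" if "f \<in> Cc_inf \<Omega>" "g \<in> Cc_inf \<Omega>" for f g
    using Cc_inf_add[OF that(1) Cc_inf_cmult[OF that(2), of "-1"]] by simp
  have pdiff: "partial i (\<lambda>x. f x - g x) = (\<lambda>x. partial i f x - partial i g x)"
    if "f \<in> Cc_inf \<Omega>" "g \<in> Cc_inf \<Omega>" for f g i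
    using padd[OF that(1) Cc_inf_cmult[OF that(2), of "-1"]] pc[OF that(2), of i "-1"] by simp
  have N: "L2_norm ?M f = L2_norm lborel f" if "f \<in> Cc_inf \<Omega>" for f
    by (simp add: L2_norm_def Cc_inf_L2_inner[OF \<Omega>(1) that that])
  have Bge: "(L2_norm ?M (partial i f))\<^sup>2 \<le> B f f" if "i \<in> Basis" for f i
    unfolding B_def L2_norm_power2
    by (rule member_le_sum) (use that L2_inner_self_nonneg in auto)
  have P: "(L2_norm ?M f)\<^sup>2 \<le> (2 * R)\<^sup>2 * B f f" if f: "f \<in> Cc_inf \<Omega>" for f
  proof -
    have "L2_norm ?M f \<le> 2 * R * L2_norm ?M (partial i0 f)"
      using Poincare_inequality[OF R f i0] N[OF f] N[OF Cc_inf_partial[OF f i0]] by simp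
    then have "(L2_norm ?M f)\<^sup>2 \<le> (2 * R * L2_norm ?M (partial i0 f))\<^sup>2"
      by (rule power_mono) (rule L2_norm_nonneg)
    also have "\<dots> \<le> (2 * R)\<^sup>2 * B f f"
      unfolding power_mult_distrib[of "2 * R"] by (intro mult_left_mono Bge i0) simp
    finally show ?thesis .
  qed
  obtain v where v: "\<And>n. v n \<in> Cc_inf \<Omega>"
    and vC: "\<And>e. e > 0 \<Longrightarrow> \<exists>N. \<forall>m\<ge>N. \<forall>n\<ge>N. B (\<lambda>x. v m x - v n x) (\<lambda>x. v m x - v n x) < e"
    and vL: "\<And>\<psi>. \<psi> \<in> Cc_inf \<Omega> \<Longrightarrow> (\<lambda>n. B (v n) \<psi>) \<longlonglongrightarrow> L \<psi>"
  proof (rule approximate_Riesz[of "Cc_inf \<Omega>" B L "(L2_norm ?M u * (2 * R))\<^sup>2"])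
    show "B (\<lambda>x. f x + g x) h = B f h + B g h" if "f \<in> Cc_inf \<Omega>" "g \<in> Cc_inf \<Omega>" "h \<in> Cc_inf \<Omega>" for f g h
      unfolding B_def sum.distrib[symmetric] padd[OF that(1,2)]
      by (intro sum.cong refl L2_inner_add L2t Cc_inf_partial that)
    show "B (\<lambda>x. c * f x) h = c * B f h" if "f \<in> Cc_inf \<Omega>" for c f h
      unfolding B_def pc[OF that] L2_inner_cmult by (simp add: sum_distrib_left)
    show "B f h = B h f" for f h unfolding B_def by (intro sum.cong refl L2_inner_commute)
    show "B f f \<ge> 0" for f unfolding B_def by (intro sum_nonneg L2_inner_self_nonneg)
    show "L (\<lambda>x. f x + g x) = L f + L g" if "f \<in> Cc_inf \<Omega>" "g \<in> Cc_inf \<Omega>" for f g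
      using L2_inner_add[OF L2t[OF that(1)] L2t[OF that(2)] u]
      by (simp add: L_def L2_inner_commute[of _ u])
    show "L (\<lambda>x. c * f x) = c * L f" for c f
      using L2_inner_cmult[of ?M c f u] by (simp add: L_def L2_inner_commute[of _ u])
    show "(L f)\<^sup>2 \<le> (L2_norm ?M u * (2 * R))\<^sup>2 * B f f" if f: "f \<in> Cc_inf \<Omega>" for f
    proof -
      have "(L f)\<^sup>2 = \<bar>L2_inner ?M u f\<bar>\<^sup>2" by (simp add: L_def)
      also have "\<dots> \<le> (L2_norm ?M u * L2_norm ?M f)\<^sup>2"
        by (rule power_mono[OF L2_Cauchy_Schwarz[OF u L2t[OF f]]]) simp
      also have "\<dots> = (L2_norm ?M u)\<^sup>2 * (L2_norm ?M f)\<^sup>2" by (rule power_mult_distrib)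
      also have "\<dots> \<le> (L2_norm ?M u)\<^sup>2 * ((2 * R)\<^sup>2 * B f f)" by (intro mult_left_mono P f) simp
      finally show ?thesis by (simp add: power_mult_distrib)
    qed
  qed (use Cc_inf_zero Cc_inf_add Cc_inf_cmult in auto)
  have cauchy: "\<exists>N. \<forall>m\<ge>N. \<forall>n\<ge>N. s m n < e"
    if e: "e > 0" and c: "c \<ge> 0" and s: "\<And>m n. (s m n)\<^sup>2 \<le> c\<^sup>2 * B (\<lambda>x. v m x - v n x) (\<lambda>x. v m x - v n x)"
    for c e and s :: "nat \<Rightarrow> nat \<Rightarrow> real"
  proof -
    have "(e / (c + 1))\<^sup>2 > 0" using e c by simp
    from vC[OF this] obtain K where K: "\<And>m n. m \<ge> K \<Longrightarrow> n \<ge> K \<Longrightarrow>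
        B (\<lambda>x. v m x - v n x) (\<lambda>x. v m x - v n x) < (e / (c + 1))\<^sup>2" by blast
    have "s m n < e" if "m \<ge> K" "n \<ge> K" for m n
    proof -
      have "(s m n)\<^sup>2 \<le> c\<^sup>2 * (e / (c + 1))\<^sup>2"
        using s[of m n] K[OF that] by (meson less_imp_le mult_left_mono order_trans zero_le_power2)
      also have "\<dots> = (c * (e / (c + 1)))\<^sup>2" by (rule power_mult_distrib[symmetric])
      finally have "\<bar>s m n\<bar> \<le> \<bar>c * (e / (c + 1))\<bar>" by (simp only: abs_le_square_iff)
      moreover have "c * (e / (c + 1)) < e" "c * (e / (c + 1)) \<ge> 0" using e c by (auto simp: field_simps)
      ultimately show ?thesis by linarith
    qed
    then show ?thesis by blast
  qed
  have "\<exists>w\<in>L2 ?M. (\<lambda>n. L2_norm ?M (\<lambda>x. v n x - w x)) \<longlonglongrightarrow> 0"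
    by (rule M.L2_complete[OF L2t[OF v]], rule cauchy[where c = "2 * R"])
      (use R(2) P[OF cdiff[OF v v]] in auto)
  then obtain w where w: "w \<in> L2 ?M" "(\<lambda>n. L2_norm ?M (\<lambda>x. v n x - w x)) \<longlonglongrightarrow> 0" by blast
  have "\<exists>g\<in>L2 ?M. (\<lambda>n. L2_norm ?M (\<lambda>x. partial i (v n) x - g x)) \<longlonglongrightarrow> 0" if i: "i \<in> Basis" for i
    by (rule M.L2_complete[OF L2t[OF Cc_inf_partial[OF v i]]], rule cauchy[where c = 1])
      (use Bge[OF i] in \<open>auto simp: pdiff[OF v v, symmetric]\<close>)
  then have "\<forall>i\<in>Basis. \<exists>g. g \<in> L2 ?M \<and> (\<lambda>n. L2_norm ?M (\<lambda>x. partial i (v n) x - g x)) \<longlonglongrightarrow> 0"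
    by blast
  from bchoice[OF this] obtain g where "\<forall>i\<in>Basis. g i \<in> L2 ?M
      \<and> (\<lambda>n. L2_norm ?M (\<lambda>x. partial i (v n) x - g i x)) \<longlonglongrightarrow> 0" ..
  then have g: "\<And>i. i \<in> Basis \<Longrightarrow> g i \<in> L2 ?M"
    "\<And>i. i \<in> Basis \<Longrightarrow> (\<lambda>n. L2_norm ?M (\<lambda>x. partial i (v n) x - g i x)) \<longlonglongrightarrow> 0" by auto
  define G where "G x = (\<Sum>i\<in>Basis. g i x *\<^sub>R i)" for x
  have Gi: "G x \<bullet> i = g i x" if "i \<in> Basis" for x i
    using that by (simp add: G_def inner_sum_left inner_Basis if_distrib cong: if_cong)
  have wg: "has_weak_grad \<Omega> w G"
    unfolding has_weak_grad_def
  proof (intro ballI conjI)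
    fix i :: 'a assume i: "i \<in> Basis"
    show "(\<lambda>x. G x \<bullet> i) \<in> L2 ?M" using g(1)[OF i] by (simp add: Gi[OF i])
    fix \<phi> assume \<phi>: "\<phi> \<in> Cc_inf \<Omega>"
    have 1: "(\<lambda>n. L2_inner ?M (v n) (partial i \<phi>)) \<longlonglongrightarrow> L2_inner ?M w (partial i \<phi>)"
      by (rule L2_inner_tendsto[OF L2t[OF v] w(1) L2t[OF Cc_inf_partial[OF \<phi> i]] w(2)])
    have 2: "(\<lambda>n. - L2_inner ?M (partial i (v n)) \<phi>) \<longlonglongrightarrow> - L2_inner ?M (g i) \<phi>"
      by (intro tendsto_minus L2_inner_tendsto[OF L2t[OF Cc_inf_partial[OF v i]] g(1)[OF i] L2t[OF \<phi>] g(2)[OF i]])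
    have "L2_inner ?M (v n) (partial i \<phi>) = - L2_inner ?M (partial i (v n)) \<phi>" for n
      unfolding L2_inner_def by (rule integral_by_parts_lebesgue_on[OF \<Omega>(1) Cc_inf_Cinf[OF v] \<phi> i])
    then have "L2_inner ?M w (partial i \<phi>) = - L2_inner ?M (g i) \<phi>"
      using LIMSEQ_unique[OF 1] 2 by simp
    then show "(\<integral>x. w x * partial i \<phi> x \<partial>?M) = - (\<integral>x. (G x \<bullet> i) * \<phi> x \<partial>?M)"
      by (simp add: L2_inner_def Gi[OF i])
  qed
  have wl: "has_weak_lap \<Omega> w u"
    unfolding has_weak_lap_def
  proof (intro conjI ballI u)
    fix \<phi> assume \<phi>: "\<phi> \<in> Cc_inf \<Omega>"
    note p = Cc_inf_partial[OF \<phi>]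
    have wpp: "integrable ?M (\<lambda>x. w x * partial i (partial i \<phi>) x)" if "i \<in> Basis" for i
      by (rule L2_mult_integrable[OF w(1) L2t[OF Cc_inf_partial[OF p[OF that] that]]])
    have "(\<lambda>n. B (v n) \<phi>) \<longlonglongrightarrow> (\<Sum>i\<in>Basis. L2_inner ?M (g i) (partial i \<phi>))"
      unfolding B_def
      by (intro tendsto_sum L2_inner_tendsto[OF L2t[OF Cc_inf_partial[OF v]] g(1) L2t[OF p] g(2)])
    then have e: "(\<Sum>i\<in>Basis. L2_inner ?M (g i) (partial i \<phi>)) = L \<phi>" using vL[OF \<phi>] LIMSEQ_unique by blast
    have "(\<integral>x. w x * laplacian \<phi> x \<partial>?M) = (\<Sum>i\<in>Basis. \<integral>x. w x * partial i (partial i \<phi>) x \<partial>?M)"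
      unfolding laplacian_def sum_distrib_left using wpp by (intro Bochner_Integration.integral_sum) auto
    also have "\<dots> = (\<Sum>i\<in>Basis. - L2_inner ?M (g i) (partial i \<phi>))"
      using wg p by (intro sum.cong refl) (auto simp: has_weak_grad_def L2_inner_def Gi)
    also have "\<dots> = L2_inner ?M u \<phi>" using e by (simp add: sum_negf L_def)
    finally show "(\<integral>x. w x * laplacian \<phi> x \<partial>?M) = (\<integral>x. u x * \<phi> x \<partial>?M)" by (simp add: L2_inner_def)
  qed
  have H1c: "(\<lambda>n. H1_norm \<Omega> (\<lambda>x. w x - v n x)) \<longlonglongrightarrow> 0"
  proof -
    have e: "(H1_norm \<Omega> (\<lambda>x. w x - v n x))\<^sup>2 = (L2_norm ?M (\<lambda>x. v n x - w x))\<^sup>2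
        + (\<Sum>i\<in>Basis. (L2_norm ?M (\<lambda>x. partial i (v n) x - g i x))\<^sup>2)" for n
    proof -
      have hw: "has_weak_grad \<Omega> (\<lambda>x. w x - v n x) (\<lambda>x. G x - gradient (v n) x)"
        by (rule has_weak_grad_diff[OF \<Omega>(1) w(1) wg L2t[OF v] has_weak_grad_smooth[OF \<Omega> Cc_inf_Cinf[OF v]]])
      have "(H1_norm \<Omega> (\<lambda>x. w x - v n x))\<^sup>2 = (L2_norm ?M (\<lambda>x. w x - v n x))\<^sup>2
        + (\<Sum>i\<in>Basis. (L2_norm ?M (\<lambda>x. (G x - gradient (v n) x) \<bullet> i))\<^sup>2)"
        by (rule H1_norm_power2[OF \<Omega> L2_diff[OF w(1) L2t[OF v]] hw])
      also have "\<dots> = (L2_norm ?M (\<lambda>x. v n x - w x))\<^sup>2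
        + (\<Sum>i\<in>Basis. (L2_norm ?M (\<lambda>x. partial i (v n) x - g i x))\<^sup>2)"
        by (intro arg_cong2[where f = "(+)"] sum.cong refl arg_cong[where f = "\<lambda>t. t\<^sup>2"])
          (auto simp: inner_diff_left gradient_inner Gi L2_norm_minus_commute)
      finally show ?thesis .
    qed
    have "(\<lambda>n. (L2_norm ?M (\<lambda>x. v n x - w x))\<^sup>2 + (\<Sum>i\<in>Basis. (L2_norm ?M (\<lambda>x. partial i (v n) x - g i x))\<^sup>2))
        \<longlonglongrightarrow> 0\<^sup>2 + (\<Sum>i\<in>(Basis::'a set). 0\<^sup>2)"
      by (intro tendsto_add tendsto_sum tendsto_power w(2) g(2))
    then have "(\<lambda>n. (H1_norm \<Omega> (\<lambda>x. w x - v n x))\<^sup>2) \<longlonglongrightarrow> 0" by (simp add: e)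
    then show ?thesis by simp
  qed
  have "w \<in> H10 \<Omega>" unfolding H10_def H1_def using w(1) wg v H1c by blast
  then have "w \<in> H0_Lap \<Omega>" unfolding H0_Lap_def using wl by blast
  then show ?thesis using that[OF w(1) wg wl _ v w(2)] g(2) by (simp add: Gi)
qed

section \<open>Traces and normal derivatives\<close>

text \<open>The surface measure enters the argument through two properties: it is a measure on the Borel
  sets of the boundary, and it is finite.\<close>

lemma sets_surface_measure:
  "sets (surface_measure (\<Omega> :: 'a::euclidean_space set)) = sets (restrict_space borel (frontier \<Omega>))"
proof -
  have "sets (hausdorff_measure s :: 'a measure) = sets borel" for s
    unfolding hausdorff_measure_def by (simp add: sets_measure_of_conv sets.sigma_sets_eq[of borel, simplified])
  then show ?thesis unfolding surface_measure_def by (rule sets_restrict_space_cong)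
qed

lemma space_surface_measure: "space (surface_measure \<Omega>) = frontier \<Omega>"
  using sets_eq_imp_space_eq[OF sets_surface_measure] by (simp add: space_restrict_space)

lemma finite_measure_surface_measure:
  assumes "B1 \<Omega>" shows "finite_measure (surface_measure \<Omega>)"
proof (rule finite_measureI)
  obtain F where F: "finite F" "\<Union>F = frontier \<Omega>"
    "\<And>S. S \<in> F \<Longrightarrow> compact S" "\<And>S. S \<in> F \<Longrightarrow> emeasure (surface_measure \<Omega>) S < \<infinity>"
    using assms unfolding B1_def closed_lipschitz_surface_def by metis
  have "S \<in> sets (surface_measure \<Omega>)" if "S \<in> F" for S
  proof -
    have "S \<in> sets borel" by (rule borel_closed[OF compact_imp_closed[OF F(3)[OF that]]])
    moreover have "S = frontier \<Omega> \<inter> S" using F(2) that by blast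
    ultimately show ?thesis unfolding sets_surface_measure sets_restrict_space by blast
  qed
  then have "emeasure (surface_measure \<Omega>) (\<Union>S\<in>F. S) \<le> (\<Sum>S\<in>F. emeasure (surface_measure \<Omega>) S)"
    using F(1) by (intro emeasure_subadditive_finite) auto
  also have "\<dots> < \<infinity>"
    using F(1,4) by (induction F rule: finite_induct) (auto simp: ennreal_add_less_top)
  finally show "emeasure (surface_measure \<Omega>) (space (surface_measure \<Omega>)) \<noteq> \<infinity>"
    using F(2) by (simp add: space_surface_measure)
qed

lemma continuous_L2_surface:
  fixes f :: "'a::euclidean_space \<Rightarrow> real"
  assumes B1: "B1 \<Omega>" and f: "continuous_on UNIV f"
  shows "f \<in> L2 (surface_measure \<Omega>)"
proof -
  interpret finite_measure "surface_measure \<Omega>" by (rule finite_measure_surface_measure[OF B1])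
  have m: "f \<in> borel_measurable (surface_measure \<Omega>)"
    using measurable_restrict_space1[OF borel_measurable_continuous_onI[OF f]]
      measurable_cong_sets[OF sets_surface_measure refl] by blast
  have "compact (frontier \<Omega>)" using B1 by (simp add: B1_def compact_frontier_bounded)
  then have "bounded (f ` frontier \<Omega>)"
    using f by (intro compact_imp_bounded compact_continuous_image) (auto intro: continuous_on_subset)
  then obtain B where B: "\<And>x. x \<in> frontier \<Omega> \<Longrightarrow> \<bar>f x\<bar> \<le> B" by (auto simp: bounded_iff)
  show ?thesis by (rule bounded_L2[OF m, of B]) (use B in \<open>simp add: space_surface_measure\<close>)
qed

lemma smooth_lipschitz_on_bounded:
  fixes f :: "'a::euclidean_space \<Rightarrow> real"
  assumes f: "Cinf_on UNIV f" and S: "bounded S"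
  obtains L where "L-lipschitz_on S f"
proof -
  obtain R where R: "S \<subseteq> cball 0 R" using S unfolding bounded_iff by (auto simp: subset_iff)
  have "\<exists>B\<ge>0. \<forall>x\<in>cball 0 R. \<bar>partial i f x\<bar> \<le> B" if i: "i \<in> Basis" for i
  proof -
    have "continuous_on (cball 0 R) (partial i f)"
      using Cinf_on_continuous[OF Cinf_on_partial[OF f i]] continuous_on_subset by blast
    then have "bounded (partial i f ` cball 0 R)"
      by (intro compact_imp_bounded compact_continuous_image) auto
    then obtain B where "B > 0" "\<forall>y\<in>partial i f ` cball 0 R. norm y \<le> B" using bounded_pos by blast
    then show ?thesis by (intro exI[of _ B]) auto
  qed
  then have "\<forall>i\<in>Basis. \<exists>B. B \<ge> 0 \<and> (\<forall>x\<in>cball 0 R. \<bar>partial i f x\<bar> \<le> B)" by blast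
  from bchoice[OF this] obtain B
    where B: "\<And>i. i \<in> Basis \<Longrightarrow> B i \<ge> 0" "\<And>i x. i \<in> Basis \<Longrightarrow> x \<in> cball 0 R \<Longrightarrow> \<bar>partial i f x\<bar> \<le> B i"
    by blast
  have "(\<Sum>i\<in>Basis. B i)-lipschitz_on (cball 0 R) f"
  proof (rule bounded_derivative_imp_lipschitz)
    fix x :: 'a assume x: "x \<in> cball 0 R"
    show "(f has_derivative (\<lambda>h. \<Sum>i\<in>Basis. (h \<bullet> i) * partial i f x)) (at x within cball 0 R)"
      using has_derivative_partial[OF Cinf_on_differentiable[OF f]] has_derivative_at_withinI by blast
    show "onorm (\<lambda>h. \<Sum>i\<in>Basis. (h \<bullet> i) * partial i f x) \<le> (\<Sum>i\<in>Basis. B i)"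
    proof (rule onorm_bound)
      show "0 \<le> (\<Sum>i\<in>Basis. B i)" by (intro sum_nonneg B)
      fix h :: 'a
      have "norm (\<Sum>i\<in>Basis. (h \<bullet> i) * partial i f x) \<le> (\<Sum>i\<in>Basis. norm ((h \<bullet> i) * partial i f x))"
        by (rule norm_sum)
      also have "\<dots> \<le> (\<Sum>i\<in>Basis. norm h * B i)"
        by (rule sum_mono) (use B x Basis_le_norm in \<open>auto simp: abs_mult intro!: mult_mono\<close>)
      finally show "norm (\<Sum>i\<in>Basis. (h \<bullet> i) * partial i f x) \<le> (\<Sum>i\<in>Basis. B i) * norm h"
        by (simp add: sum_distrib_left mult.commute)
    qed
  qed (auto intro!: sum_nonneg B)
  then have "(\<Sum>i\<in>Basis. B i)-lipschitz_on S f" using R lipschitz_on_subset by blast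
  then show ?thesis using that by blast
qed

lemma H1_norm_zero:
  assumes "open \<Omega>" "bounded \<Omega>" shows "H1_norm \<Omega> (\<lambda>x. 0) = 0"
proof -
  have "has_weak_grad \<Omega> (\<lambda>x. 0) (\<lambda>x. 0)" by (simp add: has_weak_grad_def L2_zero)
  from H1_norm_power2[OF assms L2_zero this] show ?thesis by (simp add: L2_norm_def L2_inner_def)
qed

lemma is_trace_smooth:
  assumes \<Omega>: "open \<Omega>" and B1: "B1 \<Omega>" and f: "Cinf_on UNIV f"
  shows "is_trace \<Omega> f f"
proof -
  have b: "bounded \<Omega>" using B1 by (simp add: B1_def)
  obtain L where L: "L-lipschitz_on (closure \<Omega>) f"
    using smooth_lipschitz_on_bounded[OF f bounded_closure[OF b]] by blast
  have "L2_norm (surface_measure \<Omega>) (\<lambda>x. f x - f x) = 0" by (simp add: L2_norm_def L2_inner_def)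
  then show ?thesis
    unfolding is_trace_def
    using smooth_H1[OF \<Omega> b f] continuous_L2_surface[OF B1 Cinf_on_continuous[OF f]] L H1_norm_zero[OF \<Omega> b]
    by (intro conjI exI[of _ "\<lambda>_. f"]) auto
qed

lemma B2_normal_deriv:
  assumes "B2 \<Omega>" "u \<in> H0_Lap \<Omega>"
  shows "is_normal_deriv \<Omega> u (normal_deriv \<Omega> u)"
proof -
  have "\<exists>g. is_normal_deriv \<Omega> u g" using assms unfolding B2_def compact_normal_deriv_def by blast
  then show ?thesis unfolding normal_deriv_def by (rule someI_ex)
qed

lemma normal_deriv_L2: "B2 \<Omega> \<Longrightarrow> u \<in> H0_Lap \<Omega> \<Longrightarrow> normal_deriv \<Omega> u \<in> L2 (surface_measure \<Omega>)"
  using B2_normal_deriv unfolding is_normal_deriv_def by blast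

text \<open>A smooth function on the whole space is its own trace, so it may be used in Green's formula, and
  there the chosen weak derivatives may be replaced by the given ones.\<close>

lemma normal_deriv_pairing_smooth:
  assumes \<Omega>: "open \<Omega>" and B2: "B2 \<Omega>" and u: "u \<in> H0_Lap \<Omega>"
    and G: "has_weak_grad \<Omega> u G" and l: "has_weak_lap \<Omega> u l" and f: "Cinf_on UNIV f"
  shows "(\<integral>x. f x * normal_deriv \<Omega> u x \<partial>surface_measure \<Omega>)
    = (\<Sum>i\<in>Basis. \<integral>x. (G x \<bullet> i) * partial i f x \<partial>lebesgue_on \<Omega>) + (\<integral>x. f x * l x \<partial>lebesgue_on \<Omega>)"
proof -
  have B1: "B1 \<Omega>" using B2 by (simp add: B2_def)
  then have b: "bounded \<Omega>" by (simp add: B1_def)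
  note sm = continuous_L2[OF \<Omega> b Cinf_on_continuous]
  have Gi: "(\<lambda>x. G x \<bullet> i) \<in> L2 (lebesgue_on \<Omega>)" if "i \<in> Basis" for i
    using G that by (auto simp: has_weak_grad_def)
  have l2: "l \<in> L2 (lebesgue_on \<Omega>)" using l by (simp add: has_weak_lap_def)
  have W: "(\<lambda>x. weak_grad \<Omega> u x \<bullet> i) \<in> L2 (lebesgue_on \<Omega>)" if "i \<in> Basis" for i
    using has_weak_grad_weak_grad[OF G] that by (auto simp: has_weak_grad_def)
  have Wf: "(\<lambda>x. weak_grad \<Omega> f x \<bullet> i) \<in> L2 (lebesgue_on \<Omega>)" if "i \<in> Basis" for i
    using has_weak_grad_weak_grad[OF has_weak_grad_smooth[OF \<Omega> b f]] that by (auto simp: has_weak_grad_def)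
  have wl: "weak_lap \<Omega> u \<in> L2 (lebesgue_on \<Omega>)"
    using has_weak_lap_weak_lap[OF l] by (simp add: has_weak_lap_def)
  have W_inner: "weak_grad \<Omega> u x \<bullet> weak_grad \<Omega> f x
      = (\<Sum>i\<in>Basis. (weak_grad \<Omega> u x \<bullet> i) * (weak_grad \<Omega> f x \<bullet> i))" for x
    by (rule euclidean_inner)
  have G_inner: "G x \<bullet> gradient f x = (\<Sum>i\<in>Basis. (G x \<bullet> i) * partial i f x)" for x
    by (subst euclidean_inner) (simp add: gradient_inner)
  have "(\<integral>x. f x * normal_deriv \<Omega> u x \<partial>surface_measure \<Omega>)
      = (\<integral>x. weak_grad \<Omega> u x \<bullet> weak_grad \<Omega> f x + f x * weak_lap \<Omega> u x \<partial>lebesgue_on \<Omega>)"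
    using B2_normal_deriv[OF B2 u] smooth_H1[OF \<Omega> b f] is_trace_smooth[OF \<Omega> B1 f]
    unfolding is_normal_deriv_def by blast
  also have "\<dots> = (\<integral>x. (\<Sum>i\<in>Basis. (G x \<bullet> i) * partial i f x) + f x * l x \<partial>lebesgue_on \<Omega>)"
  proof (rule integral_cong_AE)
    show "(\<lambda>x. weak_grad \<Omega> u x \<bullet> weak_grad \<Omega> f x + f x * weak_lap \<Omega> u x) \<in> borel_measurable (lebesgue_on \<Omega>)"
      unfolding W_inner using L2_measurable[OF W] L2_measurable[OF Wf] L2_measurable[OF wl] L2_measurable[OF sm[OF f]] by simp
    show "(\<lambda>x. (\<Sum>i\<in>Basis. (G x \<bullet> i) * partial i f x) + f x * l x) \<in> borel_measurable (lebesgue_on \<Omega>)"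
      using L2_measurable[OF Gi] L2_measurable[OF sm[OF Cinf_on_partial[OF f]]] L2_measurable[OF l2]
        L2_measurable[OF sm[OF f]] by simp
    show "AE x in lebesgue_on \<Omega>. weak_grad \<Omega> u x \<bullet> weak_grad \<Omega> f x + f x * weak_lap \<Omega> u x
        = (\<Sum>i\<in>Basis. (G x \<bullet> i) * partial i f x) + f x * l x"
      using weak_grad_AE[OF \<Omega> b G] weak_grad_AE[OF \<Omega> b has_weak_grad_smooth[OF \<Omega> b f]]
        weak_lap_AE[OF \<Omega> b l]
      by eventually_elim (simp add: G_inner)
  qed
  also have "\<dots> = (\<Sum>i\<in>Basis. \<integral>x. (G x \<bullet> i) * partial i f x \<partial>lebesgue_on \<Omega>) + (\<integral>x. f x * l x \<partial>lebesgue_on \<Omega>)"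
  proof -
    have "integrable (lebesgue_on \<Omega>) (\<lambda>x. (G x \<bullet> i) * partial i f x)" if "i \<in> Basis" for i
      by (rule L2_mult_integrable[OF Gi[OF that] sm[OF Cinf_on_partial[OF f that]]])
    then show ?thesis using L2_mult_integrable[OF sm[OF f] l2] by simp
  qed
  finally show ?thesis .
qed

lemma Cc_inf_H0_Lap:
  assumes \<Omega>: "open \<Omega>" "bounded \<Omega>" and v: "v \<in> Cc_inf \<Omega>"
  shows "v \<in> H0_Lap \<Omega>" "has_weak_lap \<Omega> v (laplacian v)"
proof -
  have Lv: "laplacian v \<in> Cc_inf \<Omega>" by (rule Cc_inf_laplacian[OF v])
  show l: "has_weak_lap \<Omega> v (laplacian v)"
    unfolding has_weak_lap_def
  proof (intro conjI ballI Cc_inf_L2[OF \<Omega>(1) Lv])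
    fix \<phi> assume \<phi>: "\<phi> \<in> Cc_inf \<Omega>"
    obtain K where K: "compact K" "\<And>x. x \<notin> K \<Longrightarrow> \<phi> x = 0" using Cc_inf_support[OF \<phi>] by metis
    have "(\<integral>x. v x * laplacian \<phi> x \<partial>lborel) = (\<integral>x. laplacian v x * \<phi> x \<partial>lborel)"
      by (rule Green_identity[OF _ _ K]) (intro Cinf_on_imp_Ck_on Cc_inf_Cinf[OF v] Cc_inf_Cinf[OF \<phi>])+
    then show "(\<integral>x. v x * laplacian \<phi> x \<partial>lebesgue_on \<Omega>) = (\<integral>x. laplacian v x * \<phi> x \<partial>lebesgue_on \<Omega>)"
      using integral_lebesgue_on_times_borel[OF \<Omega>(1) Cc_inf_borel_version[OF \<Omega>(1) v] Cc_inf_borel[OF Cc_inf_laplacian[OF \<phi>]]]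
        integral_lebesgue_on_times_borel[OF \<Omega>(1) Cc_inf_borel_version[OF \<Omega>(1) Lv] Cc_inf_borel[OF \<phi>]] by simp
  qed
  have "v \<in> H10 \<Omega>"
    unfolding H10_def using smooth_H1[OF \<Omega> Cc_inf_Cinf[OF v]] v H1_norm_zero[OF \<Omega>]
    by (auto intro!: exI[of _ "\<lambda>_. v"])
  then show "v \<in> H0_Lap \<Omega>" unfolding H0_Lap_def using l by blast
qed

text \<open>Integration by parts in \<open>\<Omega>\<close> shows that the normal derivative is orthogonal to all polynomials,
  and these determine it on the compact boundary.\<close>

lemma normal_deriv_test_function:
  assumes \<Omega>: "open \<Omega>" and B2: "B2 \<Omega>" and v: "v \<in> Cc_inf \<Omega>"
  shows "AE x in surface_measure \<Omega>. normal_deriv \<Omega> v x = 0"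
proof -
  have B1: "B1 \<Omega>" using B2 by (simp add: B2_def)
  then have b: "bounded \<Omega>" by (simp add: B1_def)
  note vH = Cc_inf_H0_Lap[OF \<Omega> b v]
  note nd = normal_deriv_L2[OF B2 vH(1)]
  interpret finite_measure "surface_measure \<Omega>" by (rule finite_measure_surface_measure[OF B1])
  show ?thesis
  proof (rule AE_zero_if_orthogonal_to_polynomials[OF _ sets_surface_measure])
    show "finite_measure (surface_measure \<Omega>)" by unfold_locales
    show "compact (frontier \<Omega>)" using b by (rule compact_frontier_bounded)
    show "integrable (surface_measure \<Omega>) (normal_deriv \<Omega> v)"
      using L2_mult_integrable[OF nd continuous_L2_surface[OF B1 continuous_on_const[of _ 1]]] by simp
    fix p :: "'a \<Rightarrow> real" assume "real_polynomial_function p"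
    then have p: "Cinf_on UNIV p" by (rule Cinf_on_polynomial)
    note pv = Cc_inf_partial[OF v]
    have int: "integrable (lebesgue_on \<Omega>) (\<lambda>x. p x * partial i (partial i v) x)" if "i \<in> Basis" for i
      by (rule L2_mult_integrable[OF continuous_L2[OF \<Omega> b Cinf_on_continuous[OF p]]
            Cc_inf_L2[OF \<Omega> Cc_inf_partial[OF pv[OF that] that]]])
    have "(\<integral>x. p x * normal_deriv \<Omega> v x \<partial>surface_measure \<Omega>)
      = (\<Sum>i\<in>Basis. \<integral>x. (gradient v x \<bullet> i) * partial i p x \<partial>lebesgue_on \<Omega>)
        + (\<integral>x. p x * laplacian v x \<partial>lebesgue_on \<Omega>)"
      by (rule normal_deriv_pairing_smooth[OF \<Omega> B2 vH(1) has_weak_grad_smooth[OF \<Omega> b Cc_inf_Cinf[OF v]] vH(2) p])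
    also have "(\<integral>x. p x * laplacian v x \<partial>lebesgue_on \<Omega>)
        = (\<Sum>i\<in>Basis. \<integral>x. p x * partial i (partial i v) x \<partial>lebesgue_on \<Omega>)"
      unfolding laplacian_def sum_distrib_left using int by (intro Bochner_Integration.integral_sum) auto
    also have "\<dots> = (\<Sum>i\<in>Basis. - (\<integral>x. (gradient v x \<bullet> i) * partial i p x \<partial>lebesgue_on \<Omega>))"
    proof (rule sum.cong[OF refl])
      fix i :: 'a assume i: "i \<in> Basis"
      show "(\<integral>x. p x * partial i (partial i v) x \<partial>lebesgue_on \<Omega>)
          = - (\<integral>x. (gradient v x \<bullet> i) * partial i p x \<partial>lebesgue_on \<Omega>)"
        using integral_by_parts_lebesgue_on[OF \<Omega> p pv[OF i] i] by (simp add: gradient_inner[OF i] mult.commute)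
    qed
    finally show "(\<integral>x. normal_deriv \<Omega> v x * p x \<partial>surface_measure \<Omega>) = 0"
      by (simp add: sum_negf mult.commute)
  qed
qed

lemma weak_lap_L2:
  assumes "u \<in> H0_Lap \<Omega>" shows "weak_lap \<Omega> u \<in> L2 (lebesgue_on \<Omega>)"
proof -
  obtain w where "has_weak_lap \<Omega> u w" using assms by (auto simp: H0_Lap_def)
  from has_weak_lap_weak_lap[OF this] show ?thesis by (simp add: has_weak_lap_def)
qed

text \<open>Tested with a test function, the boundary side of the eigenvalue equation is zero.\<close>

lemma weakly_harmonic_DBS:
  assumes \<Omega>: "open \<Omega>" and B2: "B2 \<Omega>" and b: "DBS_eigenpair \<Omega> q b"
  shows "weakly_harmonic \<Omega> (weak_lap \<Omega> b)"
  unfolding weakly_harmonic_def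
proof (intro conjI ballI)
  have bd: "bounded \<Omega>" using B2 by (simp add: B2_def B1_def)
  have bH: "b \<in> H0_Lap \<Omega>" using b by (simp add: DBS_eigenpair_def)
  show w: "weak_lap \<Omega> b \<in> L2 (lebesgue_on \<Omega>)" by (rule weak_lap_L2[OF bH])
  fix \<phi> assume \<phi>: "\<phi> \<in> Cc_inf \<Omega>"
  note pH = Cc_inf_H0_Lap[OF \<Omega> bd \<phi>]
  have "(\<integral>x. weak_lap \<Omega> b x * laplacian \<phi> x \<partial>lebesgue_on \<Omega>) = lap_inner \<Omega> b \<phi>"
    unfolding lap_inner_def L2_inner_def
  proof (rule integral_cong_AE)
    show "AE x in lebesgue_on \<Omega>. weak_lap \<Omega> b x * laplacian \<phi> x = weak_lap \<Omega> b x * weak_lap \<Omega> \<phi> x"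
      using weak_lap_AE[OF \<Omega> bd pH(2)] by eventually_elim simp
  qed (use L2_measurable[OF w] L2_measurable[OF weak_lap_L2[OF pH(1)]]
      L2_measurable[OF Cc_inf_L2[OF \<Omega> Cc_inf_laplacian[OF \<phi>]]] in auto)
  also have "\<dots> = q * L2_inner (surface_measure \<Omega>) (normal_deriv \<Omega> b) (normal_deriv \<Omega> \<phi>)"
    using b pH(1) by (simp add: DBS_eigenpair_def)
  also have "L2_inner (surface_measure \<Omega>) (normal_deriv \<Omega> b) (normal_deriv \<Omega> \<phi>) = 0"
    unfolding L2_inner_def
    by (rule integral_eq_zero_AE) (use normal_deriv_test_function[OF \<Omega> B2 \<phi>] in \<open>eventually_elim, simp\<close>)
  finally show "(\<integral>x. weak_lap \<Omega> b x * laplacian \<phi> x \<partial>lebesgue_on \<Omega>) = 0" by simp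
qed

section \<open>Pushing functions inside a Lipschitz domain\<close>

text \<open>The balls of radius \<open>\<epsilon>\<close> leave room for a mollification after the translation by \<open>z\<close>. Near a
  boundary point it is the Lipschitz condition that provides such translations.\<close>

definition pushes_into :: "'a::euclidean_space set \<Rightarrow> 'a set \<Rightarrow> bool" where
  "pushes_into K \<Omega> \<longleftrightarrow>
     (\<forall>\<eta>>0. \<exists>z \<epsilon>. 0 < \<epsilon> \<and> norm z + \<epsilon> < \<eta> \<and> (\<forall>y\<in>K. cball (y + z) \<epsilon> \<subseteq> \<Omega>))"

lemma pushes_intoI:
  assumes \<Omega>: "open \<Omega>" and K: "compact K"
    and z: "\<And>\<eta>. \<eta> > 0 \<Longrightarrow> \<exists>z. norm z < \<eta> \<and> (\<forall>y\<in>K. y + z \<in> \<Omega>)"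
  shows "pushes_into K \<Omega>"
  unfolding pushes_into_def
proof (intro allI impI)
  fix \<eta> :: real assume "\<eta> > 0"
  from z[OF this] obtain z where z: "norm z < \<eta>" "\<forall>y\<in>K. y + z \<in> \<Omega>" by blast
  have "compact ((\<lambda>y. y + z) ` K)" by (intro compact_continuous_image K continuous_intros)
  then obtain \<epsilon> where \<epsilon>: "\<epsilon> > 0" "(\<Union>x\<in>(\<lambda>y. y + z) ` K. cball x \<epsilon>) \<subseteq> \<Omega>"
    using compact_subset_open_imp_cball_epsilon_subset[OF _ \<Omega>, of "(\<lambda>y. y + z) ` K"] z(2) by blast
  define d where "d = min \<epsilon> ((\<eta> - norm z) / 2)"
  have d: "0 < d" "d \<le> \<epsilon>" "norm z + d < \<eta>"
    using \<epsilon>(1) z(1) by (auto simp: d_def min_def field_simps)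
  have "cball (y + z) d \<subseteq> \<Omega>" if "y \<in> K" for y
  proof -
    have "cball (y + z) d \<subseteq> cball (y + z) \<epsilon>" using d(2) by (rule subset_cball)
    also have "\<dots> \<subseteq> \<Omega>" using \<epsilon>(2) that by blast
    finally show ?thesis .
  qed
  then show "\<exists>z \<epsilon>. 0 < \<epsilon> \<and> norm z + \<epsilon> < \<eta> \<and> (\<forall>y\<in>K. cball (y + z) \<epsilon> \<subseteq> \<Omega>)" using d by blast
qed

lemma pushes_into_compact_subset:
  assumes "open \<Omega>" "compact K" "K \<subseteq> \<Omega>" shows "pushes_into K \<Omega>"
  by (rule pushes_intoI[OF assms(1,2)]) (use assms(3) in \<open>auto intro!: exI[of _ 0]\<close>)

text \<open>In graph coordinates the part of the closure near \<open>p\<close> lies on or above the graph. Moving it upwards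
  by any small amount puts it strictly above.\<close>

lemma pushes_into_near_boundary:
  assumes \<Omega>: "open \<Omega>" and S: "closed_lipschitz_surface \<Omega> S" and p: "p \<in> S"
  shows "\<exists>r>0. pushes_into (closure \<Omega> \<inter> cball p r) \<Omega>"
proof -
  obtain U e g L where U: "open U" "p \<in> U" and e: "norm e = 1" and g: "L-lipschitz_on {z. z \<bullet> e = 0} g"
    and \<Omega>U: "\<Omega> \<inter> U = {y \<in> U. y \<bullet> e > g (y - (y \<bullet> e) *\<^sub>R e)}"
  proof -
    have "\<forall>p\<in>S. \<exists>U e g L. open U \<and> p \<in> U \<and> norm e = 1 \<and> L-lipschitz_on {z. z \<bullet> e = 0} g \<and>
        S \<inter> U = {y \<in> U. y \<bullet> e = g (y - (y \<bullet> e) *\<^sub>R e)} \<and>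
        \<Omega> \<inter> U = {y \<in> U. y \<bullet> e > g (y - (y \<bullet> e) *\<^sub>R e)}"
      using S unfolding closed_lipschitz_surface_def by (elim conjE) assumption
    from bspec[OF this p] show ?thesis using that by (elim exE conjE)
  qed
  have ee: "e \<bullet> e = 1" using e by (simp add: dot_square_norm)
  define h where "h y = y \<bullet> e - g (y - (y \<bullet> e) *\<^sub>R e)" for y
  have h: "continuous_on UNIV h"
    unfolding h_def
  proof (intro continuous_intros)
    show "continuous_on UNIV (\<lambda>y. g (y - (y \<bullet> e) *\<^sub>R e))"
      by (rule continuous_on_compose2[OF lipschitz_on_continuous_on[OF g]])
        (auto intro!: continuous_intros simp: inner_diff_left ee)
  qed
  have shift: "h (y + t *\<^sub>R e) = h y + t" for y t
    by (simp add: h_def inner_add_left ee algebra_simps)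
  have in\<Omega>: "y \<in> \<Omega> \<longleftrightarrow> h y > 0" if "y \<in> U" for y
  proof -
    have "y \<in> \<Omega> \<longleftrightarrow> y \<in> \<Omega> \<inter> U" using that by simp
    then show ?thesis unfolding \<Omega>U using that by (simp add: h_def)
  qed
  have cl: "h y \<ge> 0" if y: "y \<in> closure \<Omega>" "y \<in> U" for y
  proof (rule ccontr)
    assume "\<not> h y \<ge> 0"
    define T where "T = U \<inter> h -` {..<0}"
    have "open T" unfolding T_def
      using continuous_open_vimage[OF _ h[unfolded continuous_on_eq_continuous_at[OF open_UNIV], rule_format]] U(1)
      by (intro open_Int open_vimage open_lessThan h) auto
    moreover have "y \<in> T" using y(2) \<open>\<not> h y \<ge> 0\<close> by (simp add: T_def)
    ultimately have "\<Omega> \<inter> T \<noteq> {}" using y(1) by (metis Int_commute closure_iff_nhds_not_empty order_refl disjoint_iff)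
    then obtain y' where "y' \<in> \<Omega>" "y' \<in> U" "h y' < 0" by (auto simp: T_def)
    then show False using in\<Omega> by force
  qed
  obtain r where r: "r > 0" "cball p r \<subseteq> U" using U open_contains_cball by blast
  define K where "K = closure \<Omega> \<inter> cball p (r / 2)"
  have "pushes_into K \<Omega>"
  proof (rule pushes_intoI[OF \<Omega>])
    show "compact K" unfolding K_def by (intro closed_Int_compact) auto
    fix \<eta> :: real assume \<eta>: "\<eta> > 0"
    define t where "t = min (\<eta> / 2) (r / 2)"
    have t: "t > 0" "t < \<eta>" "t \<le> r / 2" using \<eta> r(1) by (auto simp: t_def)
    have "y + t *\<^sub>R e \<in> \<Omega>" if y: "y \<in> K" for y
    proof -
      have d: "dist p y \<le> r / 2" using y by (simp add: K_def)
      have "dist p (y + t *\<^sub>R e) \<le> dist p y + dist y (y + t *\<^sub>R e)" by (rule dist_triangle)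
      also have "dist y (y + t *\<^sub>R e) = t" using t(1) e by (simp add: dist_norm)
      finally have "y + t *\<^sub>R e \<in> U" using d t(3) r(2) by force
      moreover have "y \<in> U" using d r by force
      then have "h y \<ge> 0" using cl y by (simp add: K_def)
      then have "h (y + t *\<^sub>R e) > 0" using shift t(1) by simp
      ultimately show ?thesis using in\<Omega> by blast
    qed
    then show "\<exists>z. norm z < \<eta> \<and> (\<forall>y\<in>K. y + z \<in> \<Omega>)"
      using t e by (intro exI[of _ "t *\<^sub>R e"]) auto
  qed
  then show ?thesis using r(1) by (intro exI[of _ "r / 2"]) (auto simp: K_def)
qed

lemma pushes_into_near_closure_point:
  assumes \<Omega>: "open \<Omega>" and B1: "B1 \<Omega>" and p: "p \<in> closure \<Omega>"
  shows "\<exists>r>0. pushes_into (closure \<Omega> \<inter> cball p r) \<Omega>"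
proof (cases "p \<in> \<Omega>")
  case True
  then obtain r where r: "r > 0" "cball p r \<subseteq> \<Omega>" using \<Omega> open_contains_cball by blast
  have "pushes_into (closure \<Omega> \<inter> cball p r) \<Omega>"
    by (rule pushes_into_compact_subset[OF \<Omega>]) (use r(2) in \<open>auto intro: closed_Int_compact\<close>)
  then show ?thesis using r(1) by blast
next
  case False
  then have "p \<in> frontier \<Omega>" using p \<Omega> by (simp add: frontier_def interior_open)
  then obtain S where "closed_lipschitz_surface \<Omega> S" "p \<in> S"
    using B1 unfolding B1_def by (metis UnionE)
  then show ?thesis using pushes_into_near_boundary[OF \<Omega>] by blast
qed

section \<open>Harmonic functions are orthogonal to Laplacians of compactly supported functions\<close>

text \<open>Jensen's inequality for the probability density \<open>\<kappa>\<close>, since the average of \<open>(U + t)\<^sup>2\<close> is a nonnegative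
  quadratic polynomial in \<open>t\<close>.\<close>

lemma average_square_le:
  fixes U \<kappa> :: "'a::euclidean_space \<Rightarrow> real"
  assumes U: "integrable lborel U" "U \<in> L2 lborel" and \<kappa>: "\<kappa> \<in> Cc_inf UNIV" "\<And>x. \<kappa> x \<ge> 0"
    "(\<integral>x. \<kappa> x \<partial>lborel) = 1"
  shows "(\<integral>x. U x * \<kappa> x \<partial>lborel)\<^sup>2 \<le> (\<integral>x. (U x)\<^sup>2 * \<kappa> x \<partial>lborel)"
proof -
  note i1 = integrable_mult_Cc_inf(1)[OF U(1) \<kappa>(1)]
  note i2 = integrable_mult_Cc_inf(1)[OF L2_sq_integrable[OF U(2)] \<kappa>(1)]
  note i3 = Cc_inf_integrable[OF \<kappa>(1)]
  have "(\<integral>x. U x * \<kappa> x \<partial>lborel)\<^sup>2 \<le> (\<integral>x. (U x)\<^sup>2 * \<kappa> x \<partial>lborel) * 1"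
  proof (rule quadratic_nonneg_imp_discriminant)
    fix t :: real
    have "0 \<le> (\<integral>x. (U x + t)\<^sup>2 * \<kappa> x \<partial>lborel)" using \<kappa>(2) by (intro Bochner_Integration.integral_nonneg) simp
    also have "\<dots> = (\<integral>x. (U x)\<^sup>2 * \<kappa> x + 2 * t * (U x * \<kappa> x) + t\<^sup>2 * \<kappa> x \<partial>lborel)"
      by (rule Bochner_Integration.integral_cong) (auto simp: power2_eq_square algebra_simps)
    also have "\<dots> = (\<integral>x. (U x)\<^sup>2 * \<kappa> x \<partial>lborel) + 2 * t * (\<integral>x. U x * \<kappa> x \<partial>lborel) + t\<^sup>2 * 1"
      using i1 i2 i3 \<kappa>(3) by simp
    finally show "0 \<le> (\<integral>x. (U x)\<^sup>2 * \<kappa> x \<partial>lborel) + 2 * t * (\<integral>x. U x * \<kappa> x \<partial>lborel) + t\<^sup>2 * 1" .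
  qed simp
  then show ?thesis by simp
qed

text \<open>Let \<open>V\<close> vanish off \<open>K\<close> and have weak Laplacian \<open>Z\<close> on the whole space. Convolving \<open>V\<close> with
  mollifiers centred at small translations that push \<open>K\<close> into \<open>\<Omega>\<close> gives test functions on \<open>\<Omega>\<close>,
  whose Laplacians are averages of \<open>Z\<close>. Moving the averages over to \<open>u\<close>, which is continuous in
  \<open>\<Omega>\<close>, they converge pointwise and stay bounded in \<open>L\<^sup>2\<close>.\<close>

lemma harmonic_orthogonal_to_compact_Laplacian:
  fixes u V Z :: "'a::euclidean_space \<Rightarrow> real"
  assumes \<Omega>: "open \<Omega>" "bounded \<Omega>" and u: "weakly_harmonic \<Omega> u" and cu: "continuous_on \<Omega> u"
    and V: "V \<in> L2 (lebesgue_on \<Omega>)" and Z: "Z \<in> L2 (lebesgue_on \<Omega>)"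
    and K: "compact K" "pushes_into K \<Omega>" "\<And>x. x \<in> \<Omega> \<Longrightarrow> x \<notin> K \<Longrightarrow> V x = 0"
    and lap: "\<And>\<psi>. \<psi> \<in> Cc_inf UNIV \<Longrightarrow>
      (\<integral>x. V x * laplacian \<psi> x \<partial>lebesgue_on \<Omega>) = (\<integral>x. Z x * \<psi> x \<partial>lebesgue_on \<Omega>)"
  shows "L2_inner (lebesgue_on \<Omega>) u Z = 0"
proof -
  have [measurable]: "\<Omega> \<in> sets borel" "K \<in> sets borel"
    using \<Omega>(1) K(1) by (auto intro: borel_closed compact_imp_closed)
  have u2: "u \<in> L2 (lebesgue_on \<Omega>)" using u by (simp add: weakly_harmonic_def)
  define U where "U x = indicator \<Omega> x *\<^sub>R u x" for x
  have Um[measurable]: "U \<in> borel_measurable borel"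
    unfolding U_def[abs_def] by (rule borel_measurable_continuous_on_indicator[OF _ cu]) simp
  have U: "borel_version \<Omega> u U"
    unfolding borel_version_def using Um L2_measurable[OF u2]
    by (auto simp: U_def AE_lebesgue_on_iff[OF \<Omega>(1)])
  have U2: "U \<in> L2 lborel" using borel_version_L2[OF \<Omega>(1) U] u2 by simp
  have U1: "integrable lborel U"
    by (rule L2_bounded_set_integrable[OF \<Omega>(2) U2]) (simp add: U_def)
  obtain V0 where V0: "borel_version \<Omega> V V0" "V0 \<in> L2 lborel" "integrable lborel V0"
    using L2_extension[OF \<Omega> V] by blast
  obtain Z0 where Z0: "borel_version \<Omega> Z Z0" "Z0 \<in> L2 lborel" "integrable lborel Z0"
    using L2_extension[OF \<Omega> Z] by blast
  have [measurable]: "V0 \<in> borel_measurable borel" "Z0 \<in> borel_measurable borel"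
    using V0(3) Z0(3) by auto
  \<comment> \<open>A Borel version of \<open>V\<close> vanishes off \<open>K\<close> only almost everywhere; the support of the
    convolution needs a version that vanishes there at every point.\<close>
  define V1 where "V1 x = V0 x * indicator K x" for x
  have V1: "integrable lborel V1"
    unfolding V1_def[abs_def] by (rule integrable_mult_bounded[OF V0(3), where B = 1]) auto
  have V1V: "borel_version \<Omega> V V1"
    unfolding borel_version_def
  proof (intro conjI)
    show "V1 \<in> borel_measurable borel" unfolding V1_def[abs_def] by measurable
    show "\<forall>x. x \<notin> \<Omega> \<longrightarrow> V1 x = 0" using V0(1) by (auto simp: V1_def borel_version_def)
    have "AE x in lebesgue_on \<Omega>. V x = V0 x" using V0(1) by (simp add: borel_version_def)
    then have "AE x in lborel. x \<in> \<Omega> \<longrightarrow> V x = V0 x" by (simp add: AE_lebesgue_on_iff[OF \<Omega>(1)])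
    then have "AE x in lborel. x \<in> \<Omega> \<longrightarrow> V x = V1 x"
      by eventually_elim (use K(3) in \<open>auto simp: V1_def indicator_def\<close>)
    then show "AE x in lebesgue_on \<Omega>. V x = V1 x" by (simp add: AE_lebesgue_on_iff[OF \<Omega>(1)])
  qed (rule L2_measurable[OF V])
  have lap1: "(\<integral>x. V1 x * laplacian \<psi> x \<partial>lborel) = (\<integral>x. Z0 x * \<psi> x \<partial>lborel)" if \<psi>: "\<psi> \<in> Cc_inf UNIV" for \<psi>
    using lap[OF \<psi>] integral_lebesgue_on_times_borel[OF \<Omega>(1) V1V Cc_inf_borel[OF Cc_inf_laplacian[OF \<psi>]]]
      integral_lebesgue_on_times_borel[OF \<Omega>(1) Z0(1) Cc_inf_borel[OF \<psi>]] by simp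
  have "\<exists>z \<epsilon>. 0 < \<epsilon> \<and> norm z + \<epsilon> < 1 / (real n + 1) \<and> (\<forall>y\<in>K. cball (y + z) \<epsilon> \<subseteq> \<Omega>)" for n
    using K(2) unfolding pushes_into_def by simp
  then obtain z \<epsilon> where z: "\<And>n. 0 < \<epsilon> n" "\<And>n. norm (z n) + \<epsilon> n < 1 / (real n + 1)"
    "\<And>n y. y \<in> K \<Longrightarrow> cball (y + z n) (\<epsilon> n) \<subseteq> \<Omega>" by metis
  define \<kappa> where "\<kappa> n x = moll (\<epsilon> n) (x - z n)" for n x
  have \<kappa>: "\<kappa> n \<in> Cc_inf UNIV" for n
    using Cc_inf_affine[OF moll_Cc_inf[OF z(1)[of n]], of 1 "- z n"] by (simp add: \<kappa>_def[abs_def])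
  note [measurable] = Cc_inf_borel[OF \<kappa>]
  have \<kappa>0: "\<kappa> n x \<ge> 0" for n x unfolding \<kappa>_def by (rule moll_nonneg[OF z(1)])
  have \<kappa>_supp: "norm (x - z n) < \<epsilon> n" if "\<kappa> n x \<noteq> 0" for n x
    using that moll_outside[OF z(1)] unfolding \<kappa>_def by (meson not_le)
  have \<kappa>y: "(\<lambda>x. \<kappa> n (x - y)) \<in> Cc_inf UNIV" "(\<lambda>x. \<kappa> n (y - x)) \<in> Cc_inf UNIV" for n y
    using Cc_inf_affine[OF \<kappa>, of 1 n "- y"] Cc_inf_affine[OF \<kappa>, of "-1" n y] by simp_all
  have \<kappa>1: "(\<integral>x. \<kappa> n (x - y) \<partial>lborel) = 1" "(\<integral>x. \<kappa> n (y - x) \<partial>lborel) = 1" for n y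
  proof -
    have "(\<integral>x. \<kappa> n x \<partial>lborel) = 1"
      using integral_moll_shift(2)[OF z(1)] by (simp add: \<kappa>_def)
    then show "(\<integral>x. \<kappa> n (x - y) \<partial>lborel) = 1" "(\<integral>x. \<kappa> n (y - x) \<partial>lborel) = 1"
      using integral_translate[of "\<kappa> n" "- y"] integral_reflect[of "\<kappa> n" y] by simp_all
  qed
  define A where "A n y = (\<integral>x. U x * \<kappa> n (x - y) \<partial>lborel)" for n y
  have Aconv: "A n = conv U (\<lambda>x. \<kappa> n (0 - x))" for n
    by (rule ext) (simp add: A_def conv_def)
  have Ac: "continuous_on UNIV (A n)" for n
    unfolding Aconv by (intro Cinf_on_continuous Cinf_on_conv U1 \<kappa>y(2))
  note [measurable] = borel_measurable_continuous_onI[OF Ac]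
  have orth: "(\<integral>y. Z0 y * A n y \<partial>lborel) = 0" for n
  proof -
    obtain B where B: "\<And>x. \<bar>\<kappa> n x\<bar> \<le> B" using Cc_inf_bounded[OF \<kappa>[of n]] by blast
    define \<phi> where "\<phi> = conv V1 (\<kappa> n)"
    define K' where "K' = {x + y |x y. x \<in> K \<and> y \<in> cball (z n) (\<epsilon> n)}"
    have K': "compact K'" unfolding K'_def by (rule compact_sums[OF K(1) compact_cball])
    have "K' \<subseteq> \<Omega>"
    proof
      fix x assume "x \<in> K'"
      then obtain y c where yc: "x = y + c" "y \<in> K" "c \<in> cball (z n) (\<epsilon> n)" by (auto simp: K'_def)
      then have "x \<in> cball (y + z n) (\<epsilon> n)" by (simp add: dist_norm)
      then show "x \<in> \<Omega>" using z(3)[OF yc(2)] by blast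
    qed
    moreover have "\<phi> x = 0" if x: "x \<notin> K'" for x
    proof -
      have z0: "V1 y * \<kappa> n (x - y) = 0" for y
      proof (rule ccontr)
        assume a: "V1 y * \<kappa> n (x - y) \<noteq> 0"
        then have "y \<in> K" by (auto simp: V1_def indicator_def split: if_splits)
        moreover have "x - y \<in> cball (z n) (\<epsilon> n)"
          using \<kappa>_supp[of n "x - y"] a by (simp add: dist_norm norm_minus_commute)
        moreover have "x = y + (x - y)" by simp
        ultimately show False using x unfolding K'_def by blast
      qed
      show ?thesis unfolding \<phi>_def conv_def z0 by simp
    qed
    ultimately have \<phi>: "\<phi> \<in> Cc_inf \<Omega>"
      by (intro Cc_infI[OF _ K']) (auto simp: \<phi>_def intro: Cinf_on_conv V1 \<kappa>)
    have lapconv: "laplacian \<phi> x = (\<integral>y. Z0 y * \<kappa> n (x - y) \<partial>lborel)" for x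
    proof -
      have "laplacian (\<lambda>y. \<kappa> n (x - y)) y = laplacian (\<kappa> n) (x - y)" for y
        using laplacian_affine[OF Cc_inf_Cinf[OF \<kappa>[of n]], of x "-1" y] by simp
      then show ?thesis
        unfolding \<phi>_def laplacian_conv[OF V1 \<kappa>] conv_def using lap1[OF \<kappa>y(2)[of n x]] by simp
    qed
    have "0 = (\<integral>x. u x * laplacian \<phi> x \<partial>lebesgue_on \<Omega>)" using u \<phi> by (simp add: weakly_harmonic_def)
    also have "\<dots> = (\<integral>x. U x * laplacian \<phi> x \<partial>lborel)"
      by (rule integral_lebesgue_on_times_borel[OF \<Omega>(1) U Cc_inf_borel[OF Cc_inf_laplacian[OF \<phi>]]])
    also have "\<dots> = (\<integral>y. Z0 y * A n y \<partial>lborel)"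
      unfolding lapconv A_def by (rule integral_swap_kernel[OF U1 Z0(3) _ B]) measurable
    finally show ?thesis by simp
  qed
  let ?f = "\<lambda>n y. indicator \<Omega> y * A n y - U y"
  have IA: "(\<lambda>y. indicator \<Omega> y * A n y) \<in> L2 lborel" for n
  proof -
    have "borel_version \<Omega> (A n) (\<lambda>y. indicator \<Omega> y * A n y)" by (rule borel_version_borel[OF \<Omega>(1)]) measurable
    from borel_version_L2[OF \<Omega>(1) this] continuous_L2[OF \<Omega> Ac] show ?thesis by simp
  qed
  have f2: "?f n \<in> L2 lborel" for n by (rule L2_diff[OF IA U2])
  have "(\<lambda>n. L2_inner lborel Z0 (?f n)) \<longlonglongrightarrow> 0"
  proof (rule L2_bounded_pointwise_imp_weak[OF f2 Z0(2), where C = "(2 * L2_norm lborel U)\<^sup>2"])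
    fix n
    have le: "L2_inner lborel (\<lambda>y. indicator \<Omega> y * A n y) (\<lambda>y. indicator \<Omega> y * A n y) \<le> L2_inner lborel U U"
    proof -
      obtain B where B: "\<And>x. \<bar>\<kappa> n x\<bar> \<le> B" using Cc_inf_bounded[OF \<kappa>[of n]] by blast
      have I: "integrable lborel (indicat_real \<Omega>)"
        using emeasure_bounded_finite[OF \<Omega>(2)] by (simp add: integrable_indicator_iff)
      note UU = L2_sq_integrable[OF U2]
      have Q: "continuous_on UNIV (\<lambda>y. \<integral>x. (U x)\<^sup>2 * \<kappa> n (x - y) \<partial>lborel)"
      proof -
        have e: "(\<lambda>y. \<integral>x. (U x)\<^sup>2 * \<kappa> n (x - y) \<partial>lborel) = conv (\<lambda>x. (U x)\<^sup>2) (\<lambda>x. \<kappa> n (0 - x))"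
          by (rule ext) (simp add: conv_def)
        show ?thesis unfolding e by (rule Cinf_on_continuous[OF Cinf_on_conv[OF UU \<kappa>y(2)]])
      qed
      note [measurable] = borel_measurable_continuous_onI[OF Q]
      have Qb: "\<bar>\<integral>x. (U x)\<^sup>2 * \<kappa> n (x - y) \<partial>lborel\<bar> \<le> (\<integral>x. (U x)\<^sup>2 * B \<partial>lborel)" for y
      proof -
        have "\<bar>\<integral>x. (U x)\<^sup>2 * \<kappa> n (x - y) \<partial>lborel\<bar> \<le> (\<integral>x. \<bar>(U x)\<^sup>2 * \<kappa> n (x - y)\<bar> \<partial>lborel)"
          by (rule integral_abs_bound)
        also have "\<dots> \<le> (\<integral>x. (U x)\<^sup>2 * B \<partial>lborel)"
          by (rule integral_mono)
            (use UU B integrable_abs[OF integrable_mult_Cc_inf(1)[OF UU \<kappa>y(1)]] in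
              \<open>auto simp: abs_mult intro!: mult_left_mono\<close>)
        finally show ?thesis .
      qed
      have cI: "continuous_on UNIV (\<lambda>x. \<integral>y. indicator \<Omega> y * \<kappa> n (x - y) \<partial>lborel)"
        using Cinf_on_continuous[OF Cinf_on_conv[OF I \<kappa>[of n]]] by (simp add: conv_def[abs_def])
      note [measurable] = borel_measurable_continuous_onI[OF cI]
      have I01: "0 \<le> (\<integral>y. indicator \<Omega> y * \<kappa> n (x - y) \<partial>lborel)" "(\<integral>y. indicator \<Omega> y * \<kappa> n (x - y) \<partial>lborel) \<le> 1" for x
      proof -
        show "0 \<le> (\<integral>y. indicator \<Omega> y * \<kappa> n (x - y) \<partial>lborel)" using \<kappa>0 by (intro Bochner_Integration.integral_nonneg) simp
        have "(\<integral>y. indicator \<Omega> y * \<kappa> n (x - y) \<partial>lborel) \<le> (\<integral>y. \<kappa> n (x - y) \<partial>lborel)"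
          by (rule integral_mono)
            (use integrable_mult_Cc_inf(1)[OF I \<kappa>y(2)] Cc_inf_integrable[OF \<kappa>y(2)] \<kappa>0 in
              \<open>auto simp: indicator_def\<close>)
        then show "(\<integral>y. indicator \<Omega> y * \<kappa> n (x - y) \<partial>lborel) \<le> 1" by (simp add: \<kappa>1)
      qed
      have "L2_inner lborel (\<lambda>y. indicator \<Omega> y * A n y) (\<lambda>y. indicator \<Omega> y * A n y)
          \<le> (\<integral>y. indicator \<Omega> y * (\<integral>x. (U x)\<^sup>2 * \<kappa> n (x - y) \<partial>lborel) \<partial>lborel)"
        unfolding L2_inner_def
      proof (rule integral_mono)
        show "integrable lborel (\<lambda>y. indicator \<Omega> y * A n y * (indicator \<Omega> y * A n y))"
          by (rule L2_mult_integrable[OF IA IA])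
        show "integrable lborel (\<lambda>y. indicator \<Omega> y * (\<integral>x. (U x)\<^sup>2 * \<kappa> n (x - y) \<partial>lborel))"
          by (rule integrable_mult_bounded[OF I _ Qb]) measurable
        fix y
        have "(A n y)\<^sup>2 \<le> (\<integral>x. (U x)\<^sup>2 * \<kappa> n (x - y) \<partial>lborel)"
          unfolding A_def by (rule average_square_le[OF U1 U2 \<kappa>y(1) \<kappa>0 \<kappa>1(1)])
        then show "indicator \<Omega> y * A n y * (indicator \<Omega> y * A n y)
            \<le> indicator \<Omega> y * (\<integral>x. (U x)\<^sup>2 * \<kappa> n (x - y) \<partial>lborel)"
          by (simp add: indicator_def power2_eq_square)
      qed
      also have "\<dots> = (\<integral>x. (U x)\<^sup>2 * (\<integral>y. indicator \<Omega> y * \<kappa> n (x - y) \<partial>lborel) \<partial>lborel)"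
        by (rule integral_swap_kernel[OF UU I _ B, symmetric]) measurable
      also have "\<dots> \<le> (\<integral>x. (U x)\<^sup>2 \<partial>lborel)"
      proof (rule integral_mono)
        show "integrable lborel (\<lambda>x. (U x)\<^sup>2 * (\<integral>y. indicator \<Omega> y * \<kappa> n (x - y) \<partial>lborel))"
          by (rule integrable_mult_bounded[OF UU, where B = 1]) (use I01 in auto)
        show "integrable lborel (\<lambda>x. (U x)\<^sup>2)" by (rule UU)
        show "(U x)\<^sup>2 * (\<integral>y. indicator \<Omega> y * \<kappa> n (x - y) \<partial>lborel) \<le> (U x)\<^sup>2" for x
          using mult_left_mono[OF I01(2), of "(U x)\<^sup>2" x] by simp
      qed
      also have "\<dots> = L2_inner lborel U U" by (simp add: L2_inner_def power2_eq_square)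
      finally show ?thesis .
    qed
    then have le': "L2_norm lborel (\<lambda>y. indicator \<Omega> y * A n y) \<le> L2_norm lborel U"
      unfolding L2_norm_def by (rule real_sqrt_le_mono)
    have "L2_norm lborel (?f n) \<le> L2_norm lborel (\<lambda>y. indicator \<Omega> y * A n y) + L2_norm lborel (\<lambda>y. (-1) * U y)"
      using L2_norm_triangle[OF IA L2_cmult[OF U2, of "-1"]] by simp
    also have "L2_norm lborel (\<lambda>y. (-1) * U y) = L2_norm lborel U" by (simp add: L2_norm_def L2_inner_def)
    finally have "L2_norm lborel (?f n) \<le> 2 * L2_norm lborel U" using le' by simp
    then have "(L2_norm lborel (?f n))\<^sup>2 \<le> (2 * L2_norm lborel U)\<^sup>2" by (rule power_mono) (rule L2_norm_nonneg)
    then show "L2_inner lborel (?f n) (?f n) \<le> (2 * L2_norm lborel U)\<^sup>2" by (simp only: L2_norm_power2)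
  next
    fix y
    show "(\<lambda>n. ?f n y) \<longlonglongrightarrow> 0"
    proof (cases "y \<in> \<Omega>")
      case True
      have cUy: "continuous_on \<Omega> U"
        using cu by (rule continuous_on_eq) (simp add: U_def)
      have "(\<lambda>n. A n y) \<longlonglongrightarrow> U y"
      proof (rule LIMSEQ_I)
        fix e :: real assume e: "e > 0"
        have "isCont U y" using cUy True continuous_on_eq_continuous_at[OF \<Omega>(1)] by blast
        then obtain d where d: "d > 0" "\<And>x. dist x y < d \<Longrightarrow> \<bar>U x - U y\<bar> < e / 2"
          using e unfolding continuous_at_eps_delta by (metis dist_real_def half_gt_zero)
        obtain N :: nat where N: "1 / d < real N" using reals_Archimedean2 by blast
        have "norm (A n y - U y) < e" if n: "n \<ge> N" for n
        proof -
          have "1 / d < real n + 1" using N n by linarith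
          then have nd: "1 / (real n + 1) < d" using d(1) by (simp add: field_simps)
          have "\<bar>A n y - U y\<bar> \<le> e / 2"
            unfolding A_def
          proof (rule average_close[OF Cc_inf_integrable[OF \<kappa>y(1)] \<kappa>0 \<kappa>1(1)
                integrable_mult_Cc_inf(1)[OF U1 \<kappa>y(1)]])
            fix x assume "\<kappa> n (x - y) \<noteq> 0"
            then have "norm (x - y - z n) < \<epsilon> n" by (rule \<kappa>_supp)
            then have "dist x y < norm (z n) + \<epsilon> n"
              using norm_triangle_ineq[of "x - y - z n" "z n"] by (simp add: dist_norm)
            also have "\<dots> < d" using z(2)[of n] nd by linarith
            finally show "\<bar>U x - U y\<bar> \<le> e / 2" using d(2) less_imp_le by blast
          qed
          then show ?thesis using e by simp
        qed
        then show "\<exists>N. \<forall>n\<ge>N. norm (A n y - U y) < e" by blast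
      qed
      then have "(\<lambda>n. A n y - U y) \<longlonglongrightarrow> 0" using LIM_zero by blast
      then show ?thesis using True by simp
    qed (simp add: U_def)
  qed
  moreover have "L2_inner lborel Z0 (?f n) = - L2_inner lborel Z0 U" for n
  proof -
    have "L2_inner lborel Z0 (?f n) = L2_inner lborel Z0 (\<lambda>y. indicator \<Omega> y * A n y) - L2_inner lborel Z0 U"
      using L2_inner_diff[OF IA U2 Z0(2)] by (simp add: L2_inner_commute[of _ Z0])
    also have "L2_inner lborel Z0 (\<lambda>y. indicator \<Omega> y * A n y) = (\<integral>y. Z0 y * A n y \<partial>lborel)"
      unfolding L2_inner_def
      by (rule Bochner_Integration.integral_cong) (use Z0(1) in \<open>auto simp: borel_version_def indicator_def\<close>)
    finally show ?thesis using orth by simp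
  qed
  ultimately have "L2_inner lborel Z0 U = 0" using LIMSEQ_unique[OF _ tendsto_const] by force
  then show ?thesis using borel_version_L2_inner[OF \<Omega>(1) U Z0(1)] by (simp add: L2_inner_commute)
qed

lemma L2_times_continuous:
  fixes f g :: "'a::euclidean_space \<Rightarrow> real"
  assumes \<Omega>: "open \<Omega>" "bounded \<Omega>" and f: "f \<in> L2 (lebesgue_on \<Omega>)" and g: "continuous_on UNIV g"
  shows "(\<lambda>x. f x * g x) \<in> L2 (lebesgue_on \<Omega>)"
proof -
  have "compact (closure \<Omega>)" using \<Omega>(2) by simp
  then have "bounded (g ` closure \<Omega>)"
    using g by (intro compact_imp_bounded compact_continuous_image) (auto intro: continuous_on_subset)
  then obtain B where B: "\<And>x. x \<in> closure \<Omega> \<Longrightarrow> \<bar>g x\<bar> \<le> B" by (auto simp: bounded_iff)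
  have gm: "g \<in> borel_measurable (lebesgue_on \<Omega>)"
    by (intro borel_measurable_lebesgue_onI \<Omega> borel_measurable_continuous_onI g)
  have "integrable (lebesgue_on \<Omega>) (\<lambda>x. (f x)\<^sup>2 * (g x)\<^sup>2)"
  proof (rule integrable_mult_bounded[OF L2_sq_integrable[OF f]])
    show "(\<lambda>x. (g x)\<^sup>2) \<in> borel_measurable (lebesgue_on \<Omega>)" using gm by simp
    fix x assume "x \<in> space (lebesgue_on \<Omega>)"
    then have "\<bar>g x\<bar> \<le> B" using B closure_subset by auto
    then have "\<bar>g x\<bar>\<^sup>2 \<le> B\<^sup>2" by (rule power_mono) simp
    then show "\<bar>(g x)\<^sup>2\<bar> \<le> B\<^sup>2" by simp
  qed
  then show ?thesis using L2_measurable[OF f] gm by (simp add: L2_def power_mult_distrib)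
qed

lemma weakly_harmonic_Cinf_version:
  assumes \<Omega>: "open \<Omega>" "bounded \<Omega>" and u: "weakly_harmonic \<Omega> u"
  shows "weakly_harmonic \<Omega> (Cinf_version \<Omega> u)"
proof -
  define f where "f = Cinf_version \<Omega> u"
  note W = Weyl_lemma[OF \<Omega> u, folded f_def]
  have u2: "u \<in> L2 (lebesgue_on \<Omega>)" using u by (simp add: weakly_harmonic_def)
  have fm: "f \<in> borel_measurable (lebesgue_on \<Omega>)"
  proof -
    have "(\<lambda>x. indicator \<Omega> x *\<^sub>R f x) \<in> borel_measurable borel"
      using \<Omega>(1) by (intro borel_measurable_continuous_on_indicator Cinf_on_continuous[OF W(1)]) auto
    moreover have "(\<lambda>x. indicator \<Omega> x *\<^sub>R f x) = f"
      by (rule ext) (use W(2) in \<open>auto simp: indicator_def\<close>)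
    ultimately show ?thesis using borel_measurable_lebesgue_onI[OF \<Omega>(1)] by simp
  qed
  have "integrable (lebesgue_on \<Omega>) (\<lambda>x. (f x)\<^sup>2)"
    using L2_sq_integrable[OF u2]
    by (rule integrable_cong_AE[THEN iffD1, rotated 3])
      (use W(3) fm L2_measurable[OF u2] in \<open>auto elim: eventually_mono\<close>)
  then have f2: "f \<in> L2 (lebesgue_on \<Omega>)" using fm by (simp add: L2_def)
  have "(\<integral>x. f x * laplacian \<phi> x \<partial>lebesgue_on \<Omega>) = 0" if \<phi>: "\<phi> \<in> Cc_inf \<Omega>" for \<phi>
  proof -
    note l = L2_measurable[OF Cc_inf_L2[OF \<Omega>(1) Cc_inf_laplacian[OF \<phi>]]]
    have "(\<integral>x. f x * laplacian \<phi> x \<partial>lebesgue_on \<Omega>) = (\<integral>x. u x * laplacian \<phi> x \<partial>lebesgue_on \<Omega>)"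
    proof (rule integral_cong_AE)
      show "AE x in lebesgue_on \<Omega>. f x * laplacian \<phi> x = u x * laplacian \<phi> x"
        using W(3) by eventually_elim simp
    qed (use l fm L2_measurable[OF u2] in auto)
    then show ?thesis using u \<phi> by (simp add: weakly_harmonic_def)
  qed
  then show ?thesis using f2 by (simp add: weakly_harmonic_def f_def)
qed

text \<open>The support of \<open>v\<close> is a compact subset of \<open>\<Omega>\<close>, so mollification alone turns \<open>v\<close> into smooth test
  functions.\<close>

lemma harmonic_orthogonal_to_Laplacian_Cc2:
  assumes \<Omega>: "open \<Omega>" "bounded \<Omega>" and u: "weakly_harmonic \<Omega> u" and v: "v \<in> Cc 2 \<Omega>"
  shows "(\<integral>x. u x * laplacian v x \<partial>lebesgue_on \<Omega>) = 0"
proof -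
  define K where "K = closure {x. v x \<noteq> 0}"
  have v2: "Ck_on 2 UNIV v" and K: "compact K" "K \<subseteq> \<Omega>" using v by (auto simp: Cc_def K_def)
  have v0: "v x = 0" if "x \<notin> K" for x using that closure_subset[of "{x. v x \<noteq> 0}"] by (auto simp: K_def)
  have cv: "continuous_on UNIV v" using Ck_on_continuous[OF v2] .
  have cl: "continuous_on UNIV (laplacian v)"
  proof -
    have "Ck_on 0 UNIV (partial i (partial i v))" if "i \<in> Basis" for i
      using v2 that unfolding numeral_2_eq_2 by (simp only: Ck_on.simps(2))
    then have "continuous_on UNIV (partial i (partial i v))" if "i \<in> Basis" for i
      using that by simp
    then show ?thesis unfolding laplacian_def[abs_def] by (intro continuous_on_sum)
  qed
  have l0: "laplacian v x = 0" if "x \<notin> K" for x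
    by (rule laplacian_zero_outside[OF compact_imp_closed[OF K(1)] v0 that])
  have bv: "borel_version \<Omega> v v" "borel_version \<Omega> (laplacian v) (laplacian v)"
    unfolding borel_version_def
    using borel_measurable_continuous_onI[OF cv] borel_measurable_continuous_onI[OF cl] v0 l0 K(2)
      borel_measurable_lebesgue_onI[OF \<Omega>(1)] by auto
  define f where "f = Cinf_version \<Omega> u"
  note W = Weyl_lemma[OF \<Omega> u, folded f_def]
  have fh: "weakly_harmonic \<Omega> f" unfolding f_def by (rule weakly_harmonic_Cinf_version[OF \<Omega> u])
  have u2: "u \<in> L2 (lebesgue_on \<Omega>)" and f2: "f \<in> L2 (lebesgue_on \<Omega>)"
    using u fh by (auto simp: weakly_harmonic_def)
  have "L2_inner (lebesgue_on \<Omega>) f (laplacian v) = 0"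
  proof (rule harmonic_orthogonal_to_compact_Laplacian[OF \<Omega> fh Cinf_on_continuous[OF W(1)] _ _ K(1)
        pushes_into_compact_subset[OF \<Omega>(1) K]])
    show "v \<in> L2 (lebesgue_on \<Omega>)" "laplacian v \<in> L2 (lebesgue_on \<Omega>)"
      by (intro continuous_L2 \<Omega> cv cl)+
    fix \<psi> :: "'a \<Rightarrow> real" assume \<psi>: "\<psi> \<in> Cc_inf UNIV"
    obtain K' where K': "compact K'" "\<And>x. x \<notin> K' \<Longrightarrow> \<psi> x = 0" using Cc_inf_support[OF \<psi>] by metis
    have "(\<integral>x. v x * laplacian \<psi> x \<partial>lborel) = (\<integral>x. laplacian v x * \<psi> x \<partial>lborel)"
      by (rule Green_identity[OF v2 Cinf_on_imp_Ck_on[OF Cc_inf_Cinf[OF \<psi>]] K'])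
    then show "(\<integral>x. v x * laplacian \<psi> x \<partial>lebesgue_on \<Omega>) = (\<integral>x. laplacian v x * \<psi> x \<partial>lebesgue_on \<Omega>)"
      using integral_lebesgue_on_times_borel[OF \<Omega>(1) bv(1) Cc_inf_borel[OF Cc_inf_laplacian[OF \<psi>]]]
        integral_lebesgue_on_times_borel[OF \<Omega>(1) bv(2) Cc_inf_borel[OF \<psi>]] by simp
  qed (use v0 in auto)
  moreover have "L2_inner (lebesgue_on \<Omega>) f (laplacian v) = L2_inner (lebesgue_on \<Omega>) u (laplacian v)"
    using L2_measurable[OF f2] L2_measurable[OF u2] W(3) bv(2)
    by (intro L2_inner_cong_AE) (auto simp: borel_version_def)
  ultimately show ?thesis by (simp add: L2_inner_def)
qed

lemma L2H_iff_weakly_harmonic: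
  assumes "open \<Omega>" "bounded \<Omega>"
  shows "u \<in> L2H \<Omega> \<longleftrightarrow> weakly_harmonic \<Omega> u"
proof
  assume "u \<in> L2H \<Omega>"
  moreover have "Cc_inf \<Omega> \<subseteq> Cc 2 \<Omega>" unfolding Cc_inf_def by blast
  ultimately show "weakly_harmonic \<Omega> u" unfolding L2H_def weakly_harmonic_def by blast
next
  assume "weakly_harmonic \<Omega> u"
  then show "u \<in> L2H \<Omega>"
    using harmonic_orthogonal_to_Laplacian_Cc2[OF assms] by (auto simp: L2H_def weakly_harmonic_def)
qed

section \<open>A harmonic function with a potential of zero Cauchy data vanishes\<close>

lemma plateau_exists:
  fixes p :: "'a::euclidean_space"
  assumes r: "r > 0"
  obtains \<theta> where "Cinf_on UNIV \<theta>" "\<And>x. x \<in> ball p (r / 2) \<Longrightarrow> \<theta> x = 1" "\<And>x. x \<notin> cball p r \<Longrightarrow> \<theta> x = 0"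
proof
  let ?I = "indicat_real (ball p (3 / 4 * r))"
  have I: "integrable lborel ?I"
    using emeasure_bounded_finite[of "ball p (3 / 4 * r)"] by (simp add: integrable_indicator_iff)
  have r4: "r / 4 > 0" using r by simp
  show "Cinf_on UNIV (conv ?I (moll (r / 4)))" by (rule Cinf_on_conv[OF I moll_Cc_inf[OF r4]])
  have near: "dist x y < r / 4" if "moll (r / 4) (x - y) \<noteq> 0" for x y :: 'a
    using that moll_outside[OF r4] unfolding dist_norm by (meson not_le)
  show "conv ?I (moll (r / 4)) x = 1" if x: "x \<in> ball p (r / 2)" for x
  proof -
    have e: "?I y * moll (r / 4) (x - y) = moll (r / 4) (x - y)" for y
    proof (cases "moll (r / 4) (x - y) = 0")
      case False
      have "dist p y \<le> dist p x + dist x y" by (rule dist_triangle)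
      then have "y \<in> ball p (3 / 4 * r)" using near[OF False] x by simp
      then show ?thesis by simp
    qed simp
    show ?thesis unfolding conv_def e by (rule integral_moll_shift(1)[OF r4])
  qed
  show "conv ?I (moll (r / 4)) x = 0" if x: "x \<notin> cball p r" for x
  proof -
    have e: "?I y * moll (r / 4) (x - y) = 0" for y
    proof (cases "moll (r / 4) (x - y) = 0")
      case False
      have "dist p x \<le> dist p y + dist y x" by (rule dist_triangle)
      then have "y \<notin> ball p (3 / 4 * r)" using near[OF False] x by (simp add: dist_commute)
      then show ?thesis by simp
    qed simp
    show ?thesis unfolding conv_def e by simp
  qed
qed

text \<open>The Laplacian of the product of a smooth function \<open>c\<close> and a function \<open>w\<close> with weak gradient
  \<open>G\<close> and weak Laplacian \<open>u\<close>.\<close>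

definition product_lap ::
    "('a::euclidean_space \<Rightarrow> real) \<Rightarrow> ('a \<Rightarrow> 'a) \<Rightarrow> ('a \<Rightarrow> real) \<Rightarrow> ('a \<Rightarrow> real) \<Rightarrow> 'a \<Rightarrow> real" where
  "product_lap w G u c x = u x * c x + 2 * (\<Sum>i\<in>Basis. (G x \<bullet> i) * partial i c x) + w x * laplacian c x"

lemma product_lap_diff:
  assumes c: "Cinf_on UNIV c" and d: "Cinf_on UNIV d"
  shows "product_lap w G u (\<lambda>x. c x - d x) x = product_lap w G u c x - product_lap w G u d x"
proof -
  have pd: "partial i (\<lambda>x. f x - g x) = (\<lambda>x. partial i f x - partial i g x)"
    if f: "Cinf_on UNIV f" and g: "Cinf_on UNIV g" for f g :: "'a \<Rightarrow> real" and i
  proof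
    fix x
    note df = Cinf_on_differentiable[OF f, of x] Cinf_on_differentiable[OF g, of x]
    show "partial i (\<lambda>x. f x - g x) x = partial i f x - partial i g x"
      using partial_eqI[OF has_derivative_diff[OF df(1)[unfolded frechet_derivative_works] df(2)[unfolded frechet_derivative_works]]]
      by (simp add: partial_def)
  qed
  have "laplacian (\<lambda>x. c x - d x) x = laplacian c x - laplacian d x"
    unfolding laplacian_def sum_subtractf[symmetric]
    by (intro sum.cong refl) (simp add: pd[OF c d] pd[OF Cinf_on_partial[OF c] Cinf_on_partial[OF d]])
  then show ?thesis
    by (simp add: product_lap_def pd[OF c d] right_diff_distrib sum_subtractf)
qed

lemma product_lap_L2:
  assumes \<Omega>: "open \<Omega>" "bounded \<Omega>" and w: "w \<in> L2 (lebesgue_on \<Omega>)" and G: "has_weak_grad \<Omega> w G"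
    and u: "u \<in> L2 (lebesgue_on \<Omega>)" and c: "Cinf_on UNIV c"
  shows "product_lap w G u c \<in> L2 (lebesgue_on \<Omega>)"
proof -
  have Gi: "(\<lambda>x. (G x \<bullet> i) * partial i c x) \<in> L2 (lebesgue_on \<Omega>)" if "i \<in> Basis" for i
    using G that Cinf_on_continuous[OF Cinf_on_partial[OF c that]]
    by (intro L2_times_continuous \<Omega>) (auto simp: has_weak_grad_def)
  have sum: "(\<lambda>x. \<Sum>i\<in>I. f i x) \<in> L2 (lebesgue_on \<Omega>)" if "finite I" "\<And>i. i \<in> I \<Longrightarrow> f i \<in> L2 (lebesgue_on \<Omega>)"
    for f :: "'a \<Rightarrow> 'a \<Rightarrow> real" and I
    using that by (induction I rule: finite_induct) (auto intro: L2_add L2_zero)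
  show ?thesis unfolding product_lap_def[abs_def]
    by (intro L2_add L2_cmult sum L2_times_continuous[OF \<Omega>] u w Gi Cinf_on_continuous
        Cinf_on_laplacian c finite_Basis)
qed

text \<open>Zero Cauchy data, in the weak form of the two hypotheses on \<open>w\<close>, means that the extension of
  \<open>w\<close> by zero has weak Laplacian \<open>u\<close> on the whole space. Cut-offs localise the extension near one
  point, where it can be pushed into \<open>\<Omega>\<close>.\<close>

lemma harmonic_zero_if_potential_zero_Cauchy_data:
  fixes u w :: "'a::euclidean_space \<Rightarrow> real"
  assumes \<Omega>: "open \<Omega>" and B1: "B1 \<Omega>" and u: "weakly_harmonic \<Omega> u" and cu: "continuous_on \<Omega> u"
    and w: "w \<in> L2 (lebesgue_on \<Omega>)" and G: "has_weak_grad \<Omega> w G"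
    and grad: "\<And>\<psi> i. Cinf_on UNIV \<psi> \<Longrightarrow> i \<in> Basis \<Longrightarrow>
      (\<integral>x. w x * partial i \<psi> x \<partial>lebesgue_on \<Omega>) = - (\<integral>x. (G x \<bullet> i) * \<psi> x \<partial>lebesgue_on \<Omega>)"
    and lap: "\<And>\<psi>. Cinf_on UNIV \<psi> \<Longrightarrow>
      (\<integral>x. w x * laplacian \<psi> x \<partial>lebesgue_on \<Omega>) = (\<integral>x. u x * \<psi> x \<partial>lebesgue_on \<Omega>)"
  shows "L2_inner (lebesgue_on \<Omega>) u u = 0"
proof -
  let ?M = "lebesgue_on \<Omega>"
  have b: "bounded \<Omega>" using B1 by (simp add: B1_def)
  have u2: "u \<in> L2 ?M" using u by (simp add: weakly_harmonic_def)
  have Gi: "(\<lambda>x. G x \<bullet> i) \<in> L2 ?M" if "i \<in> Basis" for i using G that by (auto simp: has_weak_grad_def)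
  note sm = continuous_L2[OF \<Omega> b Cinf_on_continuous]
  have prod_lap: "(\<integral>x. (w x * c x) * laplacian \<psi> x \<partial>?M) = (\<integral>x. product_lap w G u c x * \<psi> x \<partial>?M)"
    if c: "Cinf_on UNIV c" and \<psi>: "Cinf_on UNIV \<psi>" for c \<psi>
  proof -
    note pc = Cinf_on_partial[OF c] and lc = Cinf_on_laplacian[OF c]
    note p\<psi> = Cinf_on_partial[OF \<psi>]
    have mu: "Cinf_on UNIV (\<lambda>x. f x * g x)" if "Cinf_on UNIV f" "Cinf_on UNIV g" for f g :: "'a \<Rightarrow> real"
      by (rule Cinf_on_mult[OF open_UNIV that])
    have iw: "integrable ?M (\<lambda>x. w x * f x)" if "Cinf_on UNIV f" for f by (rule L2_mult_integrable[OF w sm[OF that]])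
    have iu: "integrable ?M (\<lambda>x. u x * f x)" if "Cinf_on UNIV f" for f by (rule L2_mult_integrable[OF u2 sm[OF that]])
    have iG: "integrable ?M (\<lambda>x. (G x \<bullet> i) * f x)" if "Cinf_on UNIV f" "i \<in> Basis" for f i
      by (rule L2_mult_integrable[OF Gi[OF that(2)] sm[OF that(1)]])
    have lapint: "(\<integral>x. w x * laplacian (\<lambda>x. c x * \<psi> x) x \<partial>?M) = (\<integral>x. w x * (c x * laplacian \<psi> x) \<partial>?M)
        + 2 * (\<Sum>i\<in>Basis. \<integral>x. w x * (partial i c x * partial i \<psi> x) \<partial>?M) + (\<integral>x. w x * (laplacian c x * \<psi> x) \<partial>?M)"
    proof -
      have "(\<integral>x. w x * laplacian (\<lambda>x. c x * \<psi> x) x \<partial>?M) = (\<integral>x. w x * (c x * laplacian \<psi> x)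
        + 2 * (\<Sum>i\<in>Basis. w x * (partial i c x * partial i \<psi> x)) + w x * (laplacian c x * \<psi> x) \<partial>?M)"
        unfolding laplacian_mult[OF c \<psi>] by (simp add: distrib_left sum_distrib_left mult.left_commute[of _ 2])
      then show ?thesis
        using iw[OF mu[OF c Cinf_on_laplacian[OF \<psi>]]] iw[OF mu[OF pc p\<psi>]] iw[OF mu[OF lc \<psi>]] by simp
    qed
    have cross: "(\<integral>x. w x * (partial i c x * partial i \<psi> x) \<partial>?M)
        = - (\<integral>x. (G x \<bullet> i) * (partial i c x * \<psi> x) \<partial>?M) - (\<integral>x. w x * (partial i (partial i c) x * \<psi> x) \<partial>?M)"
      if i: "i \<in> Basis" for i
    proof -
      have "partial i (\<lambda>x. partial i c x * \<psi> x) x = partial i c x * partial i \<psi> x + partial i (partial i c) x * \<psi> x" for x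
        by (rule partial_mult) (use Cinf_on_differentiable pc[OF i] \<psi> in auto)
      then have "(\<integral>x. w x * partial i (\<lambda>x. partial i c x * \<psi> x) x \<partial>?M)
        = (\<integral>x. w x * (partial i c x * partial i \<psi> x) \<partial>?M) + (\<integral>x. w x * (partial i (partial i c) x * \<psi> x) \<partial>?M)"
        using iw[OF mu[OF pc[OF i] p\<psi>[OF i]]] iw[OF mu[OF Cinf_on_partial[OF pc[OF i] i] \<psi>]]
        by (simp add: distrib_left)
      then show ?thesis using grad[OF mu[OF pc[OF i] \<psi>] i] by simp
    qed
    have lapc: "(\<Sum>i\<in>Basis. \<integral>x. w x * (partial i (partial i c) x * \<psi> x) \<partial>?M) = (\<integral>x. w x * (laplacian c x * \<psi> x) \<partial>?M)"
    proof -
      have "(\<integral>x. w x * (laplacian c x * \<psi> x) \<partial>?M) = (\<integral>x. (\<Sum>i\<in>Basis. w x * (partial i (partial i c) x * \<psi> x)) \<partial>?M)"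
        by (simp add: laplacian_def sum_distrib_left sum_distrib_right)
      also have "\<dots> = (\<Sum>i\<in>Basis. \<integral>x. w x * (partial i (partial i c) x * \<psi> x) \<partial>?M)"
        by (rule Bochner_Integration.integral_sum) (rule iw[OF mu[OF Cinf_on_partial[OF pc] \<psi>]])
      finally show ?thesis by simp
    qed
    have "(\<integral>x. product_lap w G u c x * \<psi> x \<partial>?M) = (\<integral>x. u x * (c x * \<psi> x)
        + 2 * (\<Sum>i\<in>Basis. (G x \<bullet> i) * (partial i c x * \<psi> x)) + w x * (laplacian c x * \<psi> x) \<partial>?M)"
      by (simp add: product_lap_def distrib_right sum_distrib_right mult.assoc)
    also have "\<dots> = (\<integral>x. u x * (c x * \<psi> x) \<partial>?M)
        + 2 * (\<Sum>i\<in>Basis. \<integral>x. (G x \<bullet> i) * (partial i c x * \<psi> x) \<partial>?M) + (\<integral>x. w x * (laplacian c x * \<psi> x) \<partial>?M)"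
      using iu[OF mu[OF c \<psi>]] iG[OF mu[OF pc \<psi>]] iw[OF mu[OF lc \<psi>]] by simp
    finally have R: "(\<integral>x. product_lap w G u c x * \<psi> x \<partial>?M) = (\<integral>x. u x * (c x * \<psi> x) \<partial>?M)
        + 2 * (\<Sum>i\<in>Basis. \<integral>x. (G x \<bullet> i) * (partial i c x * \<psi> x) \<partial>?M) + (\<integral>x. w x * (laplacian c x * \<psi> x) \<partial>?M)" .
    have "(\<Sum>i\<in>Basis. \<integral>x. w x * (partial i c x * partial i \<psi> x) \<partial>?M)
        = - (\<Sum>i\<in>Basis. \<integral>x. (G x \<bullet> i) * (partial i c x * \<psi> x) \<partial>?M) - (\<integral>x. w x * (laplacian c x * \<psi> x) \<partial>?M)"
      unfolding lapc[symmetric] sum_negf[symmetric] sum_subtractf[symmetric]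
      by (rule sum.cong[OF refl]) (simp add: cross)
    then have "(\<integral>x. w x * (c x * laplacian \<psi> x) \<partial>?M) = (\<integral>x. product_lap w G u c x * \<psi> x \<partial>?M)"
      using lapint lap[OF mu[OF c \<psi>]] R by simp
    then show ?thesis by (simp add: mult.assoc)
  qed
  define T where "T c = L2_inner ?M u (product_lap w G u c)" for c
  have T_local: "T c = 0"
    if c: "Cinf_on UNIV c" and p: "pushes_into (closure \<Omega> \<inter> cball p r) \<Omega>" and c0: "\<And>x. x \<notin> cball p r \<Longrightarrow> c x = 0" for c p r
    unfolding T_def
  proof (rule harmonic_orthogonal_to_compact_Laplacian[OF \<Omega> b u cu _ product_lap_L2[OF \<Omega> b w G u2 c] _ p])
    show "(\<lambda>x. w x * c x) \<in> L2 ?M" by (rule L2_times_continuous[OF \<Omega> b w Cinf_on_continuous[OF c]])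
    show "compact (closure \<Omega> \<inter> cball p r)" by (intro closed_Int_compact) auto
    show "w x * c x = 0" if "x \<in> \<Omega>" "x \<notin> closure \<Omega> \<inter> cball p r" for x
      using that c0 closure_subset by fastforce
    show "(\<integral>x. (w x * c x) * laplacian \<psi> x \<partial>?M) = (\<integral>x. product_lap w G u c x * \<psi> x \<partial>?M)"
      if "\<psi> \<in> Cc_inf UNIV" for \<psi> by (rule prod_lap[OF c Cc_inf_Cinf[OF that]])
  qed
  have T_diff: "T (\<lambda>x. c x - d x) = T c - T d" if c: "Cinf_on UNIV c" and d: "Cinf_on UNIV d" for c d
  proof -
    have "product_lap w G u (\<lambda>x. c x - d x) = (\<lambda>x. product_lap w G u c x - product_lap w G u d x)"
      using product_lap_diff[OF c d] by blast
    then show ?thesis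
      using L2_inner_diff[OF product_lap_L2[OF \<Omega> b w G u2 c] product_lap_L2[OF \<Omega> b w G u2 d] u2]
      by (simp add: T_def L2_inner_commute[of _ u])
  qed
  have "\<forall>p\<in>closure \<Omega>. \<exists>r. r > 0 \<and> pushes_into (closure \<Omega> \<inter> cball p r) \<Omega>"
    using pushes_into_near_closure_point[OF \<Omega> B1] by blast
  from bchoice[OF this] obtain r where r: "\<And>p. p \<in> closure \<Omega> \<Longrightarrow> r p > 0"
    "\<And>p. p \<in> closure \<Omega> \<Longrightarrow> pushes_into (closure \<Omega> \<inter> cball p (r p)) \<Omega>" by blast
  have "\<forall>p\<in>closure \<Omega>. \<exists>\<theta>. Cinf_on UNIV \<theta> \<and> (\<forall>x\<in>ball p (r p / 2). \<theta> x = 1) \<and> (\<forall>x. x \<notin> cball p (r p) \<longrightarrow> \<theta> x = 0)"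
  proof
    fix p assume "p \<in> closure \<Omega>"
    then show "\<exists>\<theta>. Cinf_on UNIV \<theta> \<and> (\<forall>x\<in>ball p (r p / 2). \<theta> x = 1) \<and> (\<forall>x. x \<notin> cball p (r p) \<longrightarrow> \<theta> x = 0)"
      using plateau_exists[OF r(1)] by metis
  qed
  from bchoice[OF this] obtain \<theta> where \<theta>: "\<And>p. p \<in> closure \<Omega> \<Longrightarrow> Cinf_on UNIV (\<theta> p)"
    "\<And>p x. p \<in> closure \<Omega> \<Longrightarrow> x \<in> ball p (r p / 2) \<Longrightarrow> \<theta> p x = 1"
    "\<And>p x. p \<in> closure \<Omega> \<Longrightarrow> x \<notin> cball p (r p) \<Longrightarrow> \<theta> p x = 0" by blast
  have "compact (closure \<Omega>)" using b by simp
  moreover have "closure \<Omega> \<subseteq> (\<Union>p\<in>closure \<Omega>. ball p (r p / 2))"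
    using r(1) by force
  ultimately obtain D where D: "D \<subseteq> closure \<Omega>" "finite D" "closure \<Omega> \<subseteq> (\<Union>p\<in>D. ball p (r p / 2))"
    using compactE_image[of "closure \<Omega>" "closure \<Omega>" "\<lambda>p. ball p (r p / 2)"] by blast
  \<comment> \<open>\<open>T\<close> vanishes on all smooth multiples of \<open>\<theta> p\<close>. Multiplication by \<open>1 - \<theta> p\<close> therefore does not
    change its value, while the product over the finite cover vanishes near the closure of \<open>\<Omega>\<close>.\<close>
  have step: "Cinf_on UNIV (\<lambda>x. \<Prod>p\<in>E. 1 - \<theta> p x) \<and> T (\<lambda>x. \<Prod>p\<in>E. 1 - \<theta> p x) = T (\<lambda>x. 1)"
    if "finite E" "E \<subseteq> closure \<Omega>" for E
    using that
  proof (induction E rule: finite_induct)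
    case empty
    then show ?case by (simp add: Cinf_on_const)
  next
    case (insert p E)
    define c where "c x = (\<Prod>p\<in>E. 1 - \<theta> p x)" for x
    have p: "p \<in> closure \<Omega>" and c: "Cinf_on UNIV c" "T c = T (\<lambda>x. 1)"
      using insert by (auto simp: c_def[abs_def])
    have ct: "Cinf_on UNIV (\<lambda>x. c x * \<theta> p x)" by (rule Cinf_on_mult[OF open_UNIV c(1) \<theta>(1)[OF p]])
    have e: "(\<lambda>x. \<Prod>p\<in>insert p E. 1 - \<theta> p x) = (\<lambda>x. c x - c x * \<theta> p x)"
      using insert(1,2) by (auto simp: c_def fun_eq_iff algebra_simps)
    have "T (\<lambda>x. c x * \<theta> p x) = 0"
      by (rule T_local[OF ct r(2)[OF p]]) (use \<theta>(3)[OF p] in auto)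
    then show ?case unfolding e using T_diff[OF c(1) ct] Cinf_on_diff[OF open_UNIV c(1) ct] c(2) by simp
  qed
  define P where "P x = (\<Prod>p\<in>D. 1 - \<theta> p x)" for x
  define S where "S = (\<Union>p\<in>D. ball p (r p / 2))"
  have S: "open S" "\<Omega> \<subseteq> S" using D(3) closure_subset by (auto simp: S_def)
  have P0: "P x = 0" if "x \<in> S" for x
  proof -
    obtain p where p: "p \<in> D" "x \<in> ball p (r p / 2)" using \<open>x \<in> S\<close> by (auto simp: S_def)
    then have "1 - \<theta> p x = 0" using \<theta>(2) D(1) by auto
    then show ?thesis unfolding P_def using p(1) D(2) by (intro prod_zero) auto
  qed
  have "product_lap w G u P x = 0" if "x \<in> \<Omega>" for x
  proof -
    have cS: "closed (- S)" using S(1) by (simp add: closed_Compl)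
    have xS: "x \<notin> - S" using that S(2) by auto
    have "partial i P x = 0" for i by (rule partial_zero_outside[OF cS _ xS]) (use P0 in auto)
    moreover have "laplacian P x = 0" by (rule laplacian_zero_outside[OF cS _ xS]) (use P0 in auto)
    ultimately show ?thesis using P0[of x] xS by (simp add: product_lap_def)
  qed
  then have "T P = (\<integral>x. 0 \<partial>?M)" unfolding T_def L2_inner_def
    by (intro Bochner_Integration.integral_cong) auto
  then have "T (\<lambda>x. 1) = 0" using step[OF D(2,1)] by (simp add: P_def[abs_def])
  moreover have "product_lap w G u (\<lambda>x. 1) = u"
  proof
    fix x
    have 0: "partial i (\<lambda>x. c) x = 0" for i x :: 'a and c :: real
      by (rule partial_eqI[OF has_derivative_const])
    have "partial i (\<lambda>x::'a. 1) = (\<lambda>x. 0)" for i :: 'a using 0 by blast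
    then have "laplacian (\<lambda>x::'a. 1) x = 0" unfolding laplacian_def by (simp add: 0)
    then show "product_lap w G u (\<lambda>x. 1) x = u x" by (simp add: product_lap_def 0)
  qed
  ultimately show ?thesis by (simp add: T_def)
qed

section \<open>Laplacians of the eigenfunctions are total\<close>

text \<open>Compactness forces the boundary masses of the eigenfunctions to be arbitrarily small: the
  normal derivatives are orthogonal in \<open>L\<^sup>2(\<partial>\<Omega>)\<close>, so that a convergent subsequence has
  \<open>M(b\<^sub>j) + M(b\<^sub>k) = \<parallel>D b\<^sub>j - D b\<^sub>k\<parallel>\<^sup>2\<close> tending to zero.\<close>

lemma steklov_form_eigenfunctions_small:
  assumes B2: "B2 \<Omega>" and b: "dbs_sequence \<Omega> b" and e: "e > 0"
  shows "\<exists>k. steklov_form \<Omega> (b k) < e"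
proof -
  let ?M = "surface_measure \<Omega>"
  define D where "D k = normal_deriv \<Omega> (b k)" for k
  have adm: "b k \<in> admissible \<Omega> b k" and
    max: "u \<in> admissible \<Omega> b k \<Longrightarrow> steklov_form \<Omega> u \<le> steklov_form \<Omega> (b k)" and
    orth: "lap_inner \<Omega> (b j) (b k) = (if j = k then 1 else 0)" and
    eig: "DBS_eigenpair \<Omega> (1 / (SUP u\<in>admissible \<Omega> b k. steklov_form \<Omega> u)) (b k)" for j k u
    using b unfolding dbs_sequence_def by blast+
  have bH: "b k \<in> H0_Lap \<Omega>" for k using adm by (simp add: admissible_def)
  have D2: "D k \<in> L2 ?M" for k unfolding D_def by (rule normal_deriv_L2[OF B2 bH])
  have sf: "steklov_form \<Omega> (b k) = L2_inner ?M (D k) (D k)" for k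
    by (simp add: steklov_form_def L2_inner_def D_def power2_eq_square)
  have sup: "(SUP u\<in>admissible \<Omega> b k. steklov_form \<Omega> u) = L2_inner ?M (D k) (D k)" for k
    unfolding sf[symmetric] by (rule cSup_eq_maximum) (use adm max in auto)
  have pair: "lap_inner \<Omega> (b k) (b j) = (1 / L2_inner ?M (D k) (D k)) * L2_inner ?M (D k) (D j)" for j k
    using eig[of k] bH[of j] unfolding DBS_eigenpair_def sup D_def by blast
  have nz: "L2_inner ?M (D k) (D k) \<noteq> 0" for k
    using pair[of k k] orth[of k k] by auto
  have orthD: "L2_inner ?M (D k) (D j) = 0" if "k \<noteq> j" for j k
    using pair[of k j] orth[of k j] that nz[of k] by simp
  have n1: "lap_norm \<Omega> (b k) \<le> 1" for k using adm by (simp add: admissible_def)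
  have comp: "\<And>u. (\<forall>n. u n \<in> H0_Lap \<Omega>) \<and> (\<exists>K. \<forall>n::nat. lap_norm \<Omega> (u n) \<le> K) \<longrightarrow>
        (\<exists>r g. strict_mono r \<and> g \<in> L2 ?M \<and> (\<lambda>n. L2_norm ?M (\<lambda>x. normal_deriv \<Omega> (u (r n)) x - g x)) \<longlonglongrightarrow> 0)"
    using B2 unfolding B2_def compact_normal_deriv_def by blast
  obtain r g where r: "strict_mono r" and g: "g \<in> L2 ?M"
    and lim: "(\<lambda>n. L2_norm ?M (\<lambda>x. D (r n) x - g x)) \<longlonglongrightarrow> 0"
    using comp[of b] bH n1 unfolding D_def by blast
  have se: "sqrt e / 2 > 0" using e by simp
  from LIMSEQ_D[OF lim this] obtain N where
    N: "\<And>n. n \<ge> N \<Longrightarrow> norm (L2_norm ?M (\<lambda>x. D (r n) x - g x) - 0) < sqrt e / 2" by blast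
  let ?j = "r N" and ?k = "r (Suc N)"
  have jk: "?j \<noteq> ?k" using strict_mono_less[OF r, of N "Suc N"] by simp
  have near: "L2_norm ?M (\<lambda>x. D ?j x - g x) < sqrt e / 2" "L2_norm ?M (\<lambda>x. g x - D ?k x) < sqrt e / 2"
    using N[of N] N[of "Suc N"] by (simp_all add: L2_norm_minus_commute[of _ g])
  have dist: "L2_norm ?M (\<lambda>x. D ?j x - D ?k x) < sqrt e"
    using L2_norm_triangle_diff[OF D2[of ?j] g D2[of ?k]] near by simp
  have "L2_inner ?M (D ?j) (D ?j) + L2_inner ?M (D ?k) (D ?k) = (L2_norm ?M (\<lambda>x. D ?j x - D ?k x))\<^sup>2"
    using L2_inner_add_scaled[OF D2[of ?j] D2[of ?k], of "-1"] orthD[OF jk]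
    by (simp add: L2_norm_power2)
  also have "\<dots> < (sqrt e)\<^sup>2" by (rule power_strict_mono[OF dist L2_norm_nonneg]) simp
  also have "\<dots> = e" using e by simp
  finally have "steklov_form \<Omega> (b ?j) < e" using L2_inner_self_nonneg[of ?M "D ?k"] by (simp add: sf)
  then show ?thesis by blast
qed

lemma lap_inner_eq:
  assumes \<Omega>: "open \<Omega>" "bounded \<Omega>" and w: "has_weak_lap \<Omega> w l" and v: "v \<in> H0_Lap \<Omega>"
  shows "lap_inner \<Omega> w v = L2_inner (lebesgue_on \<Omega>) l (weak_lap \<Omega> v)"
  unfolding lap_inner_def
  by (rule L2_inner_cong_AE)
    (use weak_lap_AE[OF \<Omega> w] has_weak_lap_weak_lap[OF w] w weak_lap_L2[OF v] L2_measurable in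
      \<open>auto simp: has_weak_lap_def\<close>)

text \<open>The solution of \<open>\<Delta> w = u\<close> with zero boundary values is \<open>\<Delta>\<close>-orthogonal to all eigenfunctions
  and has \<open>\<Delta>\<close>-norm at most \<open>1\<close>. It competes in each of the maximum problems that define them, so
  its normal derivative vanishes and it has zero Cauchy data.\<close>

lemma DBS_Laplacians_total_normalised:
  fixes u :: "'a::euclidean_space \<Rightarrow> real"
  assumes \<Omega>: "open \<Omega>" and B2: "B2 \<Omega>" and b: "dbs_sequence \<Omega> b"
    and u: "weakly_harmonic \<Omega> u" and cu: "continuous_on \<Omega> u"
    and orth: "\<And>j. L2_inner (lebesgue_on \<Omega>) u (weak_lap \<Omega> (b j)) = 0"
    and le1: "L2_norm (lebesgue_on \<Omega>) u \<le> 1"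
  shows "L2_inner (lebesgue_on \<Omega>) u u = 0"
proof -
  let ?M = "lebesgue_on \<Omega>"
  have B1: "B1 \<Omega>" using B2 by (simp add: B2_def)
  then have bd: "bounded \<Omega>" by (simp add: B1_def)
  have u2: "u \<in> L2 ?M" using u by (simp add: weakly_harmonic_def)
  obtain w G v where w: "w \<in> L2 ?M" "has_weak_grad \<Omega> w G" "has_weak_lap \<Omega> w u" "w \<in> H0_Lap \<Omega>"
    and v: "\<And>n. v n \<in> Cc_inf \<Omega>" "(\<lambda>n. L2_norm ?M (\<lambda>x. v n x - w x)) \<longlonglongrightarrow> 0"
      "\<And>i. i \<in> Basis \<Longrightarrow> (\<lambda>n. L2_norm ?M (\<lambda>x. partial i (v n) x - G x \<bullet> i)) \<longlonglongrightarrow> 0"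
  proof (rule Dirichlet_problem[OF \<Omega> bd u2])
    fix w G and v :: "nat \<Rightarrow> 'a \<Rightarrow> real"
    assume a: "w \<in> L2 ?M" "has_weak_grad \<Omega> w G" "has_weak_lap \<Omega> w u" "w \<in> H0_Lap \<Omega>"
      "\<And>n. v n \<in> Cc_inf \<Omega>" "(\<lambda>n. L2_norm ?M (\<lambda>x. v n x - w x)) \<longlonglongrightarrow> 0"
      "\<And>i. i \<in> Basis \<Longrightarrow> (\<lambda>n. L2_norm ?M (\<lambda>x. partial i (v n) x - G x \<bullet> i)) \<longlonglongrightarrow> 0"
    show thesis by (rule that[OF a])
  qed
  note sm = continuous_L2[OF \<Omega> bd Cinf_on_continuous]
  have Gi: "(\<lambda>x. G x \<bullet> i) \<in> L2 ?M" if "i \<in> Basis" for i using w(2) that by (auto simp: has_weak_grad_def)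
  have bH: "b k \<in> H0_Lap \<Omega>" for k using b unfolding dbs_sequence_def admissible_def by blast
  have "L2_inner ?M u (weak_lap \<Omega> w) = L2_inner ?M u u"
    by (rule L2_inner_cong_AE)
      (use weak_lap_AE[OF \<Omega> bd w(3)] weak_lap_L2[OF w(4)] u2 L2_measurable in auto)
  then have "lap_norm \<Omega> w = L2_norm ?M u"
    by (simp only: lap_norm_def L2_norm_def lap_inner_eq[OF \<Omega> bd w(3,4)])
  then have adm: "w \<in> admissible \<Omega> b k" for k
    using le1 w(4) orth by (simp add: admissible_def lap_inner_eq[OF \<Omega> bd w(3) bH])
  have nd2: "normal_deriv \<Omega> w \<in> L2 (surface_measure \<Omega>)" by (rule normal_deriv_L2[OF B2 w(4)])
  have sf: "steklov_form \<Omega> w = L2_inner (surface_measure \<Omega>) (normal_deriv \<Omega> w) (normal_deriv \<Omega> w)"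
    by (simp add: steklov_form_def L2_inner_def power2_eq_square)
  have "steklov_form \<Omega> w \<le> 0"
  proof (rule ccontr)
    assume "\<not> steklov_form \<Omega> w \<le> 0"
    then obtain k where "steklov_form \<Omega> (b k) < steklov_form \<Omega> w"
      using steklov_form_eigenfunctions_small[OF B2 b, of "steklov_form \<Omega> w"] by auto
    moreover have "steklov_form \<Omega> w \<le> steklov_form \<Omega> (b k)"
      using b adm unfolding dbs_sequence_def by blast
    ultimately show False by simp
  qed
  then have "L2_inner (surface_measure \<Omega>) (normal_deriv \<Omega> w) (normal_deriv \<Omega> w) = 0"
    using L2_inner_self_nonneg[of "surface_measure \<Omega>" "normal_deriv \<Omega> w"] unfolding sf by linarith
  then have nd: "AE x in surface_measure \<Omega>. normal_deriv \<Omega> w x = 0" by (rule L2_inner_self_eq_0[OF nd2])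
  have grad: "(\<integral>x. w x * partial i \<psi> x \<partial>?M) = - (\<integral>x. (G x \<bullet> i) * \<psi> x \<partial>?M)"
    if \<psi>: "Cinf_on UNIV \<psi>" and i: "i \<in> Basis" for \<psi> i
  proof -
    have 1: "(\<lambda>n. L2_inner ?M (v n) (partial i \<psi>)) \<longlonglongrightarrow> L2_inner ?M w (partial i \<psi>)"
      by (rule L2_inner_tendsto[OF Cc_inf_L2[OF \<Omega> v(1)] w(1) sm[OF Cinf_on_partial[OF \<psi> i]] v(2)])
    have 2: "(\<lambda>n. - L2_inner ?M (partial i (v n)) \<psi>) \<longlonglongrightarrow> - L2_inner ?M (\<lambda>x. G x \<bullet> i) \<psi>"
      by (intro tendsto_minus L2_inner_tendsto[OF Cc_inf_L2[OF \<Omega> Cc_inf_partial[OF v(1) i]] Gi[OF i] sm[OF \<psi>] v(3)[OF i]])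
    have "L2_inner ?M (v n) (partial i \<psi>) = - L2_inner ?M (partial i (v n)) \<psi>" for n
      using integral_by_parts_lebesgue_on[OF \<Omega> \<psi> v(1)[of n] i] by (simp add: L2_inner_def mult.commute)
    then have "L2_inner ?M w (partial i \<psi>) = - L2_inner ?M (\<lambda>x. G x \<bullet> i) \<psi>"
      using LIMSEQ_unique[OF 1] 2 by simp
    then show ?thesis by (simp add: L2_inner_def)
  qed
  have lap: "(\<integral>x. w x * laplacian \<psi> x \<partial>?M) = (\<integral>x. u x * \<psi> x \<partial>?M)" if \<psi>: "Cinf_on UNIV \<psi>" for \<psi>
  proof -
    note pp = Cinf_on_partial[OF Cinf_on_partial[OF \<psi>]]
    have "(\<integral>x. w x * laplacian \<psi> x \<partial>?M) = (\<Sum>i\<in>Basis. \<integral>x. w x * partial i (partial i \<psi>) x \<partial>?M)"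
      unfolding laplacian_def sum_distrib_left
      by (rule Bochner_Integration.integral_sum) (rule L2_mult_integrable[OF w(1) sm[OF pp]])
    also have "\<dots> = - (\<Sum>i\<in>Basis. \<integral>x. (G x \<bullet> i) * partial i \<psi> x \<partial>?M)"
      unfolding sum_negf[symmetric] by (intro sum.cong refl grad Cinf_on_partial[OF \<psi>])
    also have "\<dots> = (\<integral>x. \<psi> x * u x \<partial>?M)"
    proof -
      have "(\<integral>x. \<psi> x * normal_deriv \<Omega> w x \<partial>surface_measure \<Omega>) = 0"
        by (rule integral_eq_zero_AE) (use nd in \<open>eventually_elim, simp\<close>)
      then show ?thesis using normal_deriv_pairing_smooth[OF \<Omega> B2 w(4) w(2) w(3) \<psi>] by simp
    qed
    finally show ?thesis by (simp add: mult.commute)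
  qed
  show ?thesis
    by (rule harmonic_zero_if_potential_zero_Cauchy_data[OF \<Omega> B1 u cu w(1,2) grad lap])
qed

lemma DBS_Laplacians_total:
  fixes u :: "'a::euclidean_space \<Rightarrow> real"
  assumes \<Omega>: "open \<Omega>" and B2: "B2 \<Omega>" and b: "dbs_sequence \<Omega> b"
    and u: "weakly_harmonic \<Omega> u" and cu: "continuous_on \<Omega> u"
    and orth: "\<And>j. L2_inner (lebesgue_on \<Omega>) u (weak_lap \<Omega> (b j)) = 0"
  shows "L2_inner (lebesgue_on \<Omega>) u u = 0"
proof -
  let ?M = "lebesgue_on \<Omega>"
  define c where "c = 1 / (1 + L2_norm ?M u)"
  have c: "c > 0" "c * L2_norm ?M u \<le> 1"
    using L2_norm_nonneg[of ?M u] by (auto simp: c_def field_simps)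
  have ip: "L2_inner ?M (\<lambda>x. c * u x) (\<lambda>x. c * u x) = c\<^sup>2 * L2_inner ?M u u"
  proof -
    have "L2_inner ?M (\<lambda>x. c * u x) (\<lambda>x. c * u x) = c * L2_inner ?M u (\<lambda>x. c * u x)"
      by (rule L2_inner_cmult)
    also have "L2_inner ?M u (\<lambda>x. c * u x) = L2_inner ?M (\<lambda>x. c * u x) u" by (rule L2_inner_commute)
    also have "\<dots> = c * L2_inner ?M u u" by (rule L2_inner_cmult)
    finally show ?thesis by (simp add: power2_eq_square)
  qed
  have "L2_inner ?M (\<lambda>x. c * u x) (\<lambda>x. c * u x) = 0"
  proof (rule DBS_Laplacians_total_normalised[OF \<Omega> B2 b])
    show "weakly_harmonic \<Omega> (\<lambda>x. c * u x)"
      using u L2_cmult by (auto simp: weakly_harmonic_def mult.assoc)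
    show "continuous_on \<Omega> (\<lambda>x. c * u x)" using cu by (intro continuous_intros)
    show "L2_inner ?M (\<lambda>x. c * u x) (weak_lap \<Omega> (b j)) = 0" for j
      using orth by (simp add: L2_inner_cmult)
    have "L2_norm ?M (\<lambda>x. c * u x) = c * L2_norm ?M u"
      unfolding L2_norm_def ip using c(1) by (simp add: real_sqrt_mult)
    then show "L2_norm ?M (\<lambda>x. c * u x) \<le> 1" using c(2) by simp
  qed
  then show ?thesis using ip c(1) by simp
qed

section \<open>The kernel of a total orthonormal sequence\<close>

text \<open>The partial sum \<open>S\<close> of \<open>\<Sum>\<^sub>j e\<^sub>j(x) e\<^sub>j\<close> satisfies \<open>S(x) = \<parallel>S\<parallel>\<^sup>2\<close>, so a bound \<open>B\<close> on the evaluation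
  at \<open>x\<close> bounds the sum of the squares \<open>e\<^sub>j(x)\<^sup>2\<close> by \<open>B\<^sup>2\<close>. The series then converges in \<open>F\<close>, and
  its pairing with \<open>f\<close> is the expansion of \<open>f\<close> in the basis, evaluated at \<open>x\<close>.\<close>

lemma hilbert_function_space_bounded_evaluation_kernel:
  fixes F :: "('x \<Rightarrow> real) set" and e :: "nat \<Rightarrow> 'x \<Rightarrow> real"
  assumes H: "hilbert_function_space X F ip"
    and ev: "\<And>x. x \<in> X \<Longrightarrow> \<exists>B. \<forall>f\<in>F. \<bar>f x\<bar> \<le> B * sqrt (ip f f)"
    and e: "\<And>j. e j \<in> F" "\<And>j k. ip (e j) (e k) = (if j = k then 1 else 0)"
    and total: "\<And>f. f \<in> F \<Longrightarrow> (\<And>j. ip f (e j) = 0) \<Longrightarrow> ip f f = 0"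
  shows "\<And>x y. x \<in> X \<Longrightarrow> y \<in> X \<Longrightarrow> summable (\<lambda>j. e j x * e j y)"
    and "rkhs_with_kernel X F ip (\<lambda>x y. \<Sum>j. e j x * e j y)"
proof -
  have out: "f x = 0" if "f \<in> F" "x \<notin> X" for f x
    using H that unfolding hilbert_function_space_def by blast
  have zero: "(\<lambda>x. 0) \<in> F" using H unfolding hilbert_function_space_def by blast
  have add: "(\<lambda>x. f x + g x) \<in> F" if "f \<in> F" "g \<in> F" for f g
    using H that unfolding hilbert_function_space_def by blast
  have cm: "(\<lambda>x. c * f x) \<in> F" if "f \<in> F" for c f
    using H that unfolding hilbert_function_space_def by blast
  have sym: "ip f g = ip g f" if "f \<in> F" "g \<in> F" for f g
    using H that unfolding hilbert_function_space_def by blast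
  have ipadd: "ip (\<lambda>x. f x + g x) h = ip f h + ip g h" if "f \<in> F" "g \<in> F" "h \<in> F" for f g h
    using H that unfolding hilbert_function_space_def by blast
  have ipc: "ip (\<lambda>x. c * f x) g = c * ip f g" if "f \<in> F" "g \<in> F" for c f g
    using H that unfolding hilbert_function_space_def by blast
  have pos: "ip f f \<ge> 0" if "f \<in> F" for f
    using H that unfolding hilbert_function_space_def by blast
  have def0: "f = (\<lambda>x. 0)" if "f \<in> F" "ip f f = 0" for f
    using H that unfolding hilbert_function_space_def by blast
  have compl: "\<exists>f\<in>F. (\<lambda>n::nat. sqrt (ip (\<lambda>x. s n x - f x) (\<lambda>x. s n x - f x))) \<longlonglongrightarrow> 0"
    if "\<And>n. s n \<in> F" "\<And>\<eta>. \<eta> > 0 \<Longrightarrow> \<exists>M. \<forall>m\<ge>M. \<forall>n\<ge>M. sqrt (ip (\<lambda>x. s m x - s n x) (\<lambda>x. s m x - s n x)) < \<eta>" for s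
    using H that unfolding hilbert_function_space_def by blast
  have df: "(\<lambda>x. f x - g x) \<in> F" if "f \<in> F" "g \<in> F" for f g
    using add[OF that(1) cm[OF that(2), of "-1"]] by simp
  have ipd: "ip (\<lambda>x. f x - g x) h = ip f h - ip g h" if "f \<in> F" "g \<in> F" "h \<in> F" for f g h
    using ipadd[OF that(1) cm[OF that(2), of "-1"] that(3)] ipc[OF that(2,3), of "-1"] by simp
  have sq: "ip (\<lambda>x. f x + t * g x) (\<lambda>x. f x + t * g x) = ip f f + 2 * t * ip f g + t\<^sup>2 * ip g g"
    if f: "f \<in> F" and g: "g \<in> F" for f g t
  proof -
    note tg = cm[OF g, of t]
    have "ip (\<lambda>x. f x + t * g x) h = ip f h + t * ip g h" if "h \<in> F" for h
      using ipadd[OF f tg that] ipc[OF g that] by simp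
    note * = this
    have "ip (\<lambda>x. f x + t * g x) (\<lambda>x. f x + t * g x)
        = ip f (\<lambda>x. f x + t * g x) + t * ip g (\<lambda>x. f x + t * g x)" by (rule *[OF add[OF f tg]])
    also have "ip f (\<lambda>x. f x + t * g x) = ip f f + t * ip g f" using *[OF f] sym[OF f add[OF f tg]] by simp
    also have "ip g (\<lambda>x. f x + t * g x) = ip f g + t * ip g g" using *[OF g] sym[OF g add[OF f tg]] by simp
    also have "ip g f = ip f g" by (rule sym[OF g f])
    finally show ?thesis by (simp add: algebra_simps power2_eq_square)
  qed
  have CS: "\<bar>ip f g\<bar> \<le> sqrt (ip f f) * sqrt (ip g g)" if f: "f \<in> F" and g: "g \<in> F" for f g
  proof -
    have "(ip f g)\<^sup>2 \<le> ip f f * ip g g"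
    proof (rule quadratic_nonneg_imp_discriminant[OF _ pos[OF g]])
      show "0 \<le> ip f f + 2 * t * ip f g + t\<^sup>2 * ip g g" for t
        using pos[OF add[OF f cm[OF g]]] unfolding sq[OF f g] .
    qed
    then have "sqrt ((ip f g)\<^sup>2) \<le> sqrt (ip f f * ip g g)" by (rule real_sqrt_le_mono)
    then show ?thesis by (simp add: real_sqrt_mult)
  qed
  define P where "P c n x = (\<Sum>j<n. c j * e j x)" for c :: "nat \<Rightarrow> real" and n x
  have PS: "P c (Suc n) = (\<lambda>x. P c n x + c n * e n x)" for c n by (simp add: P_def fun_eq_iff)
  have P0: "P c 0 = (\<lambda>x. 0)" for c by (simp add: P_def fun_eq_iff)
  have PF: "P c n \<in> F" for c n
    by (induction n) (auto simp: P0 PS zero add cm e(1))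
  have ip0: "ip (\<lambda>x. 0) h = 0" if "h \<in> F" for h using ipc[OF zero that, of 0] by simp
  have ipP: "ip (P c n) h = (\<Sum>j<n. c j * ip (e j) h)" if h: "h \<in> F" for c n h
    by (induction n) (simp_all add: P0 PS ip0[OF h] ipadd[OF PF cm[OF e(1)] h] ipc[OF e(1) h])
  have ipPe: "ip (P c n) (e k) = (if k < n then c k else 0)" for c n k
  proof -
    have "ip (P c n) (e k) = (\<Sum>j<n. if j = k then c j else 0)"
      unfolding ipP[OF e(1)] by (intro sum.cong refl) (simp add: e(2))
    then show ?thesis by simp
  qed
  have PP: "ip (P c n) (P c n) = (\<Sum>j<n. (c j)\<^sup>2)" for c n
  proof -
    have "ip (P c n) (P c n) = (\<Sum>j<n. c j * ip (P c n) (e j))"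
      unfolding ipP[OF PF] using sym[OF e(1) PF] by simp
    also have "\<dots> = (\<Sum>j<n. (c j)\<^sup>2)" by (intro sum.cong refl) (simp add: ipPe power2_eq_square)
    finally show ?thesis .
  qed
  have Pdiff: "ip (\<lambda>x. P c m x - P c n x) (\<lambda>x. P c m x - P c n x) = (\<Sum>j\<in>{n..<m}. (c j)\<^sup>2)" if "n \<le> m" for c m n
  proof -
    have "(\<lambda>x. P c m x - P c n x) = P (\<lambda>j. if n \<le> j then c j else 0) m"
    proof
      fix x
      have "P c m x - P c n x = (\<Sum>j\<in>{n..<m}. c j * e j x)"
        unfolding P_def lessThan_atLeast0 using sum_diff_nat_ivl[of 0 n m "\<lambda>j. c j * e j x"] that by simp
      also have "\<dots> = (\<Sum>j\<in>{0..<m}. (if n \<le> j then c j else 0) * e j x)"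
        by (rule sum.mono_neutral_cong_left) auto
      finally show "P c m x - P c n x = P (\<lambda>j. if n \<le> j then c j else 0) m x"
        by (simp add: P_def lessThan_atLeast0)
    qed
    then have "ip (\<lambda>x. P c m x - P c n x) (\<lambda>x. P c m x - P c n x) = (\<Sum>j<m. (if n \<le> j then c j else 0)\<^sup>2)"
      by (simp add: PP)
    also have "\<dots> = (\<Sum>j\<in>{n..<m}. (c j)\<^sup>2)"
      unfolding lessThan_atLeast0 by (rule sum.mono_neutral_cong_right) auto
    finally show ?thesis .
  qed
  \<comment> \<open>An orthogonal series with square-summable coefficients converges in \<open>F\<close>, hence pointwise.\<close>
  have series: "\<exists>g\<in>F. (\<forall>x\<in>X. (\<lambda>j. c j * e j x) sums g x) \<and> (\<forall>h\<in>F. (\<lambda>n. ip (P c n) h) \<longlonglongrightarrow> ip g h)"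
    if c: "summable (\<lambda>j. (c j)\<^sup>2)" for c
  proof -
    have cauchy: "\<exists>M. \<forall>m\<ge>M. \<forall>n\<ge>M. sqrt (ip (\<lambda>x. P c m x - P c n x) (\<lambda>x. P c m x - P c n x)) < \<eta>"
      if \<eta>: "\<eta> > 0" for \<eta>
    proof -
      have "\<eta>\<^sup>2 > 0" using \<eta> by simp
      then obtain M where M: "\<And>m n. m \<ge> M \<Longrightarrow> norm (\<Sum>j\<in>{m..<n}. (c j)\<^sup>2) < \<eta>\<^sup>2"
        using c unfolding summable_Cauchy by blast
      have le: "sqrt (ip (\<lambda>x. P c m x - P c n x) (\<lambda>x. P c m x - P c n x)) < \<eta>" if "n \<le> m" "n \<ge> M" for m n
      proof -
        have "(\<Sum>j\<in>{n..<m}. (c j)\<^sup>2) < \<eta>\<^sup>2" using M[OF that(2), of m] by simp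
        then have "sqrt (\<Sum>j\<in>{n..<m}. (c j)\<^sup>2) < sqrt (\<eta>\<^sup>2)" by (rule real_sqrt_less_mono)
        then show ?thesis unfolding Pdiff[OF that(1)] using \<eta> by simp
      qed
      have swap: "ip (\<lambda>x. P c m x - P c n x) (\<lambda>x. P c m x - P c n x) = ip (\<lambda>x. P c n x - P c m x) (\<lambda>x. P c n x - P c m x)" for m n
      proof -
        note d = df[OF PF[of c m] PF[of c n]]
        show ?thesis using sq[OF zero d, of "-1"] ip0[OF zero] ip0[OF d] by simp
      qed
      have "sqrt (ip (\<lambda>x. P c m x - P c n x) (\<lambda>x. P c m x - P c n x)) < \<eta>" if "m \<ge> M" "n \<ge> M" for m n
        using le[of n m] le[of m n] swap[of m n] that by (cases "n \<le> m") auto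
      then show ?thesis by blast
    qed
    from compl[OF PF cauchy] obtain g where g: "g \<in> F"
      and lim: "(\<lambda>n. sqrt (ip (\<lambda>x. P c n x - g x) (\<lambda>x. P c n x - g x))) \<longlonglongrightarrow> 0" by blast
    have "(\<lambda>j. c j * e j x) sums g x" if x: "x \<in> X" for x
    proof -
      obtain B where B: "\<And>f. f \<in> F \<Longrightarrow> \<bar>f x\<bar> \<le> B * sqrt (ip f f)" using ev[OF x] by blast
      have "(\<lambda>n. P c n x - g x) \<longlonglongrightarrow> 0"
      proof (rule Lim_null_comparison)
        show "\<forall>\<^sub>F n in sequentially. norm (P c n x - g x) \<le> B * sqrt (ip (\<lambda>x. P c n x - g x) (\<lambda>x. P c n x - g x))"
          using B[OF df[OF PF g]] by simp
        show "(\<lambda>n. B * sqrt (ip (\<lambda>x. P c n x - g x) (\<lambda>x. P c n x - g x))) \<longlonglongrightarrow> 0"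
          using tendsto_mult_left[OF lim, of B] by simp
      qed
      then have "(\<lambda>n. P c n x) \<longlonglongrightarrow> g x" using LIM_zero_iff by blast
      then show ?thesis by (simp add: sums_def P_def)
    qed
    moreover have "(\<lambda>n. ip (P c n) h) \<longlonglongrightarrow> ip g h" if h: "h \<in> F" for h
    proof -
      have "(\<lambda>n. ip (P c n) h - ip g h) \<longlonglongrightarrow> 0"
      proof (rule Lim_null_comparison)
        show "\<forall>\<^sub>F n in sequentially. norm (ip (P c n) h - ip g h) \<le> sqrt (ip (\<lambda>x. P c n x - g x) (\<lambda>x. P c n x - g x)) * sqrt (ip h h)"
          using CS[OF df[OF PF g] h] ipd[OF PF g h] by simp
        show "(\<lambda>n. sqrt (ip (\<lambda>x. P c n x - g x) (\<lambda>x. P c n x - g x)) * sqrt (ip h h)) \<longlonglongrightarrow> 0"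
          using tendsto_mult_right[OF lim, of "sqrt (ip h h)"] by simp
      qed
      then show ?thesis using LIM_zero_iff by blast
    qed
    ultimately show ?thesis using g by blast
  qed
  have bounded_summable: "summable (\<lambda>j. (c j)\<^sup>2)" if "\<And>n. (\<Sum>j<n. (c j)\<^sup>2) \<le> K" for c and K :: real
    by (rule summableI_nonneg_bounded[where x = K]) (use that in auto)
  have sq_eval: "summable (\<lambda>j. (e j x)\<^sup>2)" if x: "x \<in> X" for x
  proof -
    obtain B where B: "\<And>f. f \<in> F \<Longrightarrow> \<bar>f x\<bar> \<le> B * sqrt (ip f f)" using ev[OF x] by blast
    show ?thesis
    proof (rule bounded_summable[where K = "B\<^sup>2"])
      fix n
      define S where "S = (\<Sum>j<n. (e j x)\<^sup>2)"
      have S0: "S \<ge> 0" unfolding S_def by (intro sum_nonneg) simp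
      have "P (\<lambda>j. e j x) n x = S" by (simp add: P_def S_def power2_eq_square)
      then have "S \<le> B * sqrt S" using B[OF PF, of "\<lambda>j. e j x" n] by (simp add: PP S_def[symmetric])
      then have le: "sqrt S * sqrt S \<le> B * sqrt S" using S0 by simp
      have "sqrt S \<le> \<bar>B\<bar>"
      proof (cases "S = 0")
        case False
        then have "sqrt S > 0" using S0 by simp
        from mult_right_le_imp_le[OF le this] show ?thesis by simp
      qed simp
      then have "(sqrt S)\<^sup>2 \<le> \<bar>B\<bar>\<^sup>2" using S0 by (intro power_mono) auto
      then show "(\<Sum>j<n. (e j x)\<^sup>2) \<le> B\<^sup>2" using S0 by (simp add: S_def)
    qed
  qed
  have Bessel: "summable (\<lambda>j. (ip f (e j))\<^sup>2)" if f: "f \<in> F" for f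
  proof (rule bounded_summable[where K = "ip f f"])
    fix n
    let ?c = "\<lambda>j. ip f (e j)"
    have "ip f (P ?c n) = (\<Sum>j<n. (?c j)\<^sup>2)"
      unfolding sym[OF f PF] ipP[OF f] using sym[OF f e(1)] by (simp add: power2_eq_square)
    moreover have "0 \<le> ip (\<lambda>x. f x + (-1) * P ?c n x) (\<lambda>x. f x + (-1) * P ?c n x)"
      by (intro pos add cm f PF)
    ultimately show "(\<Sum>j<n. (?c j)\<^sup>2) \<le> ip f f" unfolding sq[OF f PF] PP by simp
  qed
  have expansion: "(\<lambda>j. ip f (e j) * e j x) sums f x" if f: "f \<in> F" and x: "x \<in> X" for f x
  proof -
    let ?c = "\<lambda>j. ip f (e j)"
    obtain g where g: "g \<in> F" "\<And>x. x \<in> X \<Longrightarrow> (\<lambda>j. ?c j * e j x) sums g x"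
      "\<And>h. h \<in> F \<Longrightarrow> (\<lambda>n. ip (P ?c n) h) \<longlonglongrightarrow> ip g h" using series[OF Bessel[OF f]] by blast
    have "ip g (e k) = ?c k" for k
    proof -
      have "\<forall>\<^sub>F n in sequentially. ip (P ?c n) (e k) = ?c k"
        by (rule eventually_sequentiallyI[of "Suc k"]) (simp add: ipPe)
      then have "(\<lambda>n. ip (P ?c n) (e k)) \<longlonglongrightarrow> ?c k" by (rule tendsto_eventually)
      then show ?thesis using g(3)[OF e(1)] LIMSEQ_unique by blast
    qed
    then have o: "ip (\<lambda>x. f x - g x) (e k) = 0" for k using ipd[OF f g(1) e(1)] by simp
    note d = df[OF f g(1)]
    have "(\<lambda>x. f x - g x) = (\<lambda>x. 0)" by (rule def0[OF d total[OF d o]])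
    then have "f x - g x = 0" by (rule fun_cong)
    then show ?thesis using g(2)[OF x] by simp
  qed
  show summ: "summable (\<lambda>j. e j x * e j y)" if x: "x \<in> X" and y: "y \<in> X" for x y
  proof -
    from series[OF sq_eval[OF x]] obtain g where "\<forall>y\<in>X. (\<lambda>j. e j x * e j y) sums g y"
      by (elim bexE conjE)
    from sums_summable[OF bspec[OF this y]] show ?thesis .
  qed
  have kernel: "(\<lambda>y. \<Sum>j. e j x * e j y) \<in> F \<and> (\<forall>f\<in>F. f x = ip (\<lambda>y. \<Sum>j. e j x * e j y) f)" if x: "x \<in> X" for x
  proof -
    obtain k where k: "k \<in> F" "\<And>y. y \<in> X \<Longrightarrow> (\<lambda>j. e j x * e j y) sums k y"
      "\<And>h. h \<in> F \<Longrightarrow> (\<lambda>n. ip (P (\<lambda>j. e j x) n) h) \<longlonglongrightarrow> ip k h" using series[OF sq_eval[OF x]] by blast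
    have eq: "(\<lambda>y. \<Sum>j. e j x * e j y) = k"
    proof
      fix y show "(\<Sum>j. e j x * e j y) = k y"
        using k(2) out[OF k(1)] out[OF e(1)] sums_unique by (cases "y \<in> X") (fastforce, simp)
    qed
    have "f x = ip k f" if f: "f \<in> F" for f
    proof -
      have "(\<lambda>n. \<Sum>j<n. e j x * ip (e j) f) \<longlonglongrightarrow> ip k f" using k(3)[OF f] by (simp add: ipP[OF f])
      moreover have "(\<lambda>n. \<Sum>j<n. e j x * ip (e j) f) \<longlonglongrightarrow> f x"
        using expansion[OF f x] sym[OF f e(1)] by (simp add: sums_def mult.commute)
      ultimately show ?thesis using LIMSEQ_unique by blast
    qed
    then show ?thesis unfolding eq using k(1) by blast
  qed
  show "rkhs_with_kernel X F ip (\<lambda>x y. \<Sum>j. e j x * e j y)"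
    unfolding rkhs_with_kernel_def using H ev kernel by blast
qed

section \<open>The harmonic Bergman space\<close>

lemma harmonic_bergman_iff:
  assumes \<Omega>: "open \<Omega>" "bounded \<Omega>"
  shows "f \<in> harmonic_bergman \<Omega> \<longleftrightarrow> weakly_harmonic \<Omega> f \<and> Cinf_on \<Omega> f \<and> (\<forall>x. x \<notin> \<Omega> \<longrightarrow> f x = 0)"
proof
  assume "f \<in> harmonic_bergman \<Omega>"
  then obtain u where u: "weakly_harmonic \<Omega> u" "f = Cinf_version \<Omega> u"
    using L2H_iff_weakly_harmonic[OF \<Omega>] by (auto simp: harmonic_bergman_def)
  then show "weakly_harmonic \<Omega> f \<and> Cinf_on \<Omega> f \<and> (\<forall>x. x \<notin> \<Omega> \<longrightarrow> f x = 0)"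
    using weakly_harmonic_Cinf_version[OF \<Omega> u(1)] Weyl_lemma(1,2)[OF \<Omega> u(1)] by simp
next
  assume f: "weakly_harmonic \<Omega> f \<and> Cinf_on \<Omega> f \<and> (\<forall>x. x \<notin> \<Omega> \<longrightarrow> f x = 0)"
  then have "Cinf_version \<Omega> f = f" by (intro Cinf_version_unique[OF \<Omega>]) auto
  moreover have "f \<in> L2H \<Omega>" using f L2H_iff_weakly_harmonic[OF \<Omega>] by blast
  ultimately show "f \<in> harmonic_bergman \<Omega>" unfolding harmonic_bergman_def by force
qed

lemma Cinf_version_in_harmonic_bergman:
  assumes "open \<Omega>" "bounded \<Omega>" "weakly_harmonic \<Omega> u"
  shows "Cinf_version \<Omega> u \<in> harmonic_bergman \<Omega>"
  using assms L2H_iff_weakly_harmonic unfolding harmonic_bergman_def by blast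

lemma weakly_harmonic_add:
  assumes \<Omega>: "open \<Omega>" and f: "weakly_harmonic \<Omega> f" and g: "weakly_harmonic \<Omega> g"
  shows "weakly_harmonic \<Omega> (\<lambda>x. f x + g x)"
proof -
  have fg: "f \<in> L2 (lebesgue_on \<Omega>)" "g \<in> L2 (lebesgue_on \<Omega>)" using f g by (auto simp: weakly_harmonic_def)
  have "(\<integral>x. (f x + g x) * laplacian \<phi> x \<partial>lebesgue_on \<Omega>) = 0" if \<phi>: "\<phi> \<in> Cc_inf \<Omega>" for \<phi>
    using L2_inner_add[OF fg Cc_inf_L2[OF \<Omega> Cc_inf_laplacian[OF \<phi>]]] f g \<phi>
    by (simp add: L2_inner_def weakly_harmonic_def)
  then show ?thesis using L2_add[OF fg] by (simp add: weakly_harmonic_def)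
qed

lemma weakly_harmonic_cmult:
  "weakly_harmonic \<Omega> f \<Longrightarrow> weakly_harmonic \<Omega> (\<lambda>x. c * f x)"
  using L2_cmult by (auto simp: weakly_harmonic_def mult.assoc)

lemma weakly_harmonic_L2_limit:
  assumes \<Omega>: "open \<Omega>" and s: "\<And>n. weakly_harmonic \<Omega> (s n)" and g: "g \<in> L2 (lebesgue_on \<Omega>)"
    and lim: "(\<lambda>n. L2_norm (lebesgue_on \<Omega>) (\<lambda>x. s n x - g x)) \<longlonglongrightarrow> 0"
  shows "weakly_harmonic \<Omega> g"
  unfolding weakly_harmonic_def
proof (intro conjI g ballI)
  fix \<phi> assume \<phi>: "\<phi> \<in> Cc_inf \<Omega>"
  have s2: "s n \<in> L2 (lebesgue_on \<Omega>)" for n using s by (simp add: weakly_harmonic_def)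
  have "(\<lambda>n. L2_inner (lebesgue_on \<Omega>) (s n) (laplacian \<phi>)) \<longlonglongrightarrow> L2_inner (lebesgue_on \<Omega>) g (laplacian \<phi>)"
    by (rule L2_inner_tendsto[OF s2 g Cc_inf_L2[OF \<Omega> Cc_inf_laplacian[OF \<phi>]] lim])
  moreover have "L2_inner (lebesgue_on \<Omega>) (s n) (laplacian \<phi>) = 0" for n
    using s \<phi> by (simp add: weakly_harmonic_def L2_inner_def)
  ultimately have "L2_inner (lebesgue_on \<Omega>) g (laplacian \<phi>) = 0"
    using LIMSEQ_unique[OF _ tendsto_const] by force
  then show "(\<integral>x. g x * laplacian \<phi> x \<partial>lebesgue_on \<Omega>) = 0" by (simp add: L2_inner_def)
qed

lemma hilbert_function_space_harmonic_bergman: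
  assumes \<Omega>: "open \<Omega>" "bounded \<Omega>"
  shows "hilbert_function_space \<Omega> (harmonic_bergman \<Omega>) (L2_inner (lebesgue_on \<Omega>))"
proof -
  let ?M = "lebesgue_on \<Omega>" and ?F = "harmonic_bergman \<Omega>"
  interpret finite_measure ?M by (rule finite_measure_lebesgue_on_bounded[OF \<Omega>])
  note iff = harmonic_bergman_iff[OF \<Omega>]
  have F2: "f \<in> L2 ?M" if "f \<in> ?F" for f using that by (simp add: iff weakly_harmonic_def)
  have zero: "(\<lambda>x. 0) \<in> ?F" by (simp add: iff weakly_harmonic_def L2_zero Cinf_on_const)
  have add: "(\<lambda>x. f x + g x) \<in> ?F" if "f \<in> ?F" "g \<in> ?F" for f g
    using that weakly_harmonic_add[OF \<Omega>(1)] Cinf_on_add[OF \<Omega>(1)] by (auto simp: iff)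
  have cm: "(\<lambda>x. c * f x) \<in> ?F" if "f \<in> ?F" for c f
    using that weakly_harmonic_cmult Cinf_on_mult[OF \<Omega>(1) Cinf_on_const] by (auto simp: iff)
  have def0: "f = (\<lambda>x. 0)" if f: "f \<in> ?F" and 0: "L2_inner ?M f f = 0" for f
  proof
    fix x
    have "AE x in ?M. f x = 0" by (rule L2_inner_self_eq_0[OF F2[OF f] 0])
    then show "f x = 0"
      using continuous_AE_eq_imp_eq[OF \<Omega>(1) Cinf_on_continuous continuous_on_const, of f 0 x] f
      by (cases "x \<in> \<Omega>") (auto simp: iff)
  qed
  have compl: "\<exists>f\<in>?F. (\<lambda>n::nat. sqrt (L2_inner ?M (\<lambda>x. s n x - f x) (\<lambda>x. s n x - f x))) \<longlonglongrightarrow> 0"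
    if s: "\<And>n. s n \<in> ?F"
      and c: "\<And>e. e > 0 \<Longrightarrow> \<exists>M. \<forall>m\<ge>M. \<forall>n\<ge>M. sqrt (L2_inner ?M (\<lambda>x. s m x - s n x) (\<lambda>x. s m x - s n x)) < e" for s
  proof -
    have "\<exists>g\<in>L2 ?M. (\<lambda>n. L2_norm ?M (\<lambda>x. s n x - g x)) \<longlonglongrightarrow> 0"
      by (rule L2_complete[OF F2[OF s]]) (simp add: L2_norm_def c)
    then obtain g where g: "g \<in> L2 ?M" "(\<lambda>n. L2_norm ?M (\<lambda>x. s n x - g x)) \<longlonglongrightarrow> 0"
      by (elim bexE)
    have h: "weakly_harmonic \<Omega> g"
      by (rule weakly_harmonic_L2_limit[OF \<Omega>(1) _ g]) (use s in \<open>simp add: iff\<close>)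
    define f where "f = Cinf_version \<Omega> g"
    have f: "f \<in> ?F" unfolding f_def by (rule Cinf_version_in_harmonic_bergman[OF \<Omega> h])
    have eq: "L2_inner ?M (\<lambda>x. s n x - f x) (\<lambda>x. s n x - f x) = L2_inner ?M (\<lambda>x. s n x - g x) (\<lambda>x. s n x - g x)" for n
    proof -
      have "AE x in ?M. s n x - f x = s n x - g x"
        using Weyl_lemma(3)[OF \<Omega> h] unfolding f_def by eventually_elim simp
      then show ?thesis
        using L2_measurable[OF L2_diff[OF F2[OF s] F2[OF f]]] L2_measurable[OF L2_diff[OF F2[OF s] g(1)]]
        by (intro L2_inner_cong_AE)
    qed
    show ?thesis by (rule bexI[OF _ f]) (use g(2) in \<open>simp only: eq L2_norm_def\<close>)
  qed
  show ?thesis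
    unfolding hilbert_function_space_def
  proof (intro conjI)
    show "\<forall>f\<in>?F. \<forall>x. x \<notin> \<Omega> \<longrightarrow> f x = 0" by (simp add: iff)
    show "\<forall>f\<in>?F. \<forall>g\<in>?F. \<forall>h\<in>?F. L2_inner ?M (\<lambda>x. f x + g x) h = L2_inner ?M f h + L2_inner ?M g h"
      using L2_inner_add F2 by blast
    show "\<forall>f\<in>?F. 0 \<le> L2_inner ?M f f \<and> (L2_inner ?M f f = 0 \<longrightarrow> f = (\<lambda>x. 0))"
      using L2_inner_self_nonneg def0 by blast
    show "\<forall>f\<in>?F. \<forall>g\<in>?F. L2_inner ?M f g = L2_inner ?M g f" using L2_inner_commute by blast
    show "\<forall>c. \<forall>f\<in>?F. \<forall>g\<in>?F. L2_inner ?M (\<lambda>x. c * f x) g = c * L2_inner ?M f g"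
      using L2_inner_cmult by blast
  qed (use zero add cm compl in blast)+
qed

theorem corollary6p3:
  fixes \<Omega> :: "'a::euclidean_space set" and b :: "nat \<Rightarrow> 'a \<Rightarrow> real"
  assumes "DIM('a) \<ge> 2"
    and "region \<Omega>"
    and "B2 \<Omega>"
    and "dbs_sequence \<Omega> b"
  shows "(\<forall>x\<in>\<Omega>. \<forall>y\<in>\<Omega>. summable (\<lambda>j. lap_version \<Omega> (b j) x * lap_version \<Omega> (b j) y)) \<and>
    rkhs_with_kernel \<Omega> (harmonic_bergman \<Omega>) (L2_inner (lebesgue_on \<Omega>))
      (\<lambda>x y. \<Sum>j. lap_version \<Omega> (b j) x * lap_version \<Omega> (b j) y)"
proof -
  let ?M = "lebesgue_on \<Omega>" and ?F = "harmonic_bergman \<Omega>"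
  have \<Omega>: "open \<Omega>" "bounded \<Omega>" using assms by (auto simp: region_def B2_def B1_def)
  note iff = harmonic_bergman_iff[OF \<Omega>]
  define e where "e j = lap_version \<Omega> (b j)" for j
  have wh: "weakly_harmonic \<Omega> (weak_lap \<Omega> (b j))" for j
    using weakly_harmonic_DBS[OF \<Omega>(1) assms(3)] assms(4) unfolding dbs_sequence_def by blast
  have eF: "e j \<in> ?F" for j
    unfolding e_def lap_version_def by (rule Cinf_version_in_harmonic_bergman[OF \<Omega> wh])
  have F2: "f \<in> L2 ?M" if "f \<in> ?F" for f using that by (simp add: iff weakly_harmonic_def)
  have w2: "weak_lap \<Omega> (b j) \<in> L2 ?M" for j using wh by (simp add: weakly_harmonic_def)
  have eAE: "AE x in ?M. e j x = weak_lap \<Omega> (b j) x" for j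
    unfolding e_def lap_version_def by (rule Weyl_lemma(3)[OF \<Omega> wh])
  have ipe: "L2_inner ?M f (e j) = L2_inner ?M f (weak_lap \<Omega> (b j))" if "f \<in> L2 ?M" for f j
    by (rule L2_inner_cong_AE)
      (use L2_measurable[OF that] L2_measurable[OF F2[OF eF]] L2_measurable[OF w2] eAE in auto)
  have on: "L2_inner ?M (e j) (e k) = (if j = k then 1 else 0)" for j k
  proof -
    have "L2_inner ?M (e j) (e k) = L2_inner ?M (weak_lap \<Omega> (b k)) (e j)"
      using ipe[OF F2[OF eF]] L2_inner_commute by metis
    also have "\<dots> = L2_inner ?M (weak_lap \<Omega> (b k)) (weak_lap \<Omega> (b j))" by (rule ipe[OF w2])
    also have "\<dots> = lap_inner \<Omega> (b j) (b k)" unfolding lap_inner_def by (rule L2_inner_commute)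
    finally show ?thesis using assms(4) unfolding dbs_sequence_def by simp
  qed
  have total: "L2_inner ?M f f = 0" if f: "f \<in> ?F" and 0: "\<And>j. L2_inner ?M f (e j) = 0" for f
  proof (rule DBS_Laplacians_total[OF \<Omega>(1) assms(3,4)])
    show "weakly_harmonic \<Omega> f" "continuous_on \<Omega> f" using f Cinf_on_continuous by (auto simp: iff)
    show "L2_inner ?M f (weak_lap \<Omega> (b j)) = 0" for j using 0 ipe[OF F2[OF f]] by simp
  qed
  have ev: "\<exists>B. \<forall>f\<in>?F. \<bar>f x\<bar> \<le> B * sqrt (L2_inner ?M f f)" if x: "x \<in> \<Omega>" for x
  proof (intro exI ballI)
    fix f assume f: "f \<in> ?F"
    then have "Cinf_version \<Omega> f = f" by (intro Cinf_version_unique[OF \<Omega>]) (auto simp: iff)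
    then show "\<bar>f x\<bar> \<le> evaluation_bound \<Omega> x * sqrt (L2_inner ?M f f)"
      using Weyl_lemma(4)[OF \<Omega> _ x, of f] f by (simp add: iff L2_norm_def)
  qed
  note H = hilbert_function_space_harmonic_bergman[OF \<Omega>]
  have "summable (\<lambda>j. e j x * e j y)" if "x \<in> \<Omega>" "y \<in> \<Omega>" for x y
    by (rule hilbert_function_space_bounded_evaluation_kernel(1)[where e = e, OF H ev _ _ _ that])
      (use eF on total in auto)
  moreover have "rkhs_with_kernel \<Omega> ?F (L2_inner ?M) (\<lambda>x y. \<Sum>j. e j x * e j y)"
    by (rule hilbert_function_space_bounded_evaluation_kernel(2)[where e = e, OF H ev])
      (use eF on total in auto)
  ultimately show ?thesis unfolding e_def by simp
qed

end
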